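(* For every $1\le p<\infty$ and every integer $m\ge 1$ there exist constants $c_1(m,p),c_2(m,p)>0$ such that for all $r>0$, $$\mathbb{P}\{\|X_m\|_{L^p[0,1]}>r\}\le c_1(m,p)\exp\Big\{-\frac{r^2}{2\|A_m\|_p}+c_2(m,p)\,r^{\frac{2}{2m+3}}\Big\}.$$
   Context: $W$ is a standard Brownian motion, $X_m(t)=\frac{1}{m!}\int_0^t(t-s)^m dW(s)$, $t\in[0,1]$, with covariance $K_m(s,t)=\frac{1}{(m!)^2}\int_0^{\min\{s,t\}}(s-u)^m(t-u)^m du$ and covariance operator $A_m f(t)=\int_0^1K_m(s,t)f(s)ds$. With $q=p/(p-1)$ (so $q=\infty$ if $p=1$), $\|A_m\|_p:=\sup_{\|g\|_{L^q[0,1]}\le1}\sup_{\|f\|_{L^q[0,1]}\le1}\int_0^1\int_0^1K_m(t,s)f(t)g(s)\,dt\,ds$ is the norm of $A_m:L^q[0,1]\to L^p[0,1]$. *)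

theory Defs
  imports "HOL-Probability.Probability"
begin

definition std_brownian_motion :: "'a measure \<Rightarrow> (real \<Rightarrow> 'a \<Rightarrow> real) \<Rightarrow> bool" where
  "std_brownian_motion M W \<longleftrightarrow>
     prob_space M \<and>
     (\<forall>t\<ge>0. W t \<in> borel_measurable M) \<and>
     (\<forall>\<omega>\<in>space M. W 0 \<omega> = 0) \<and>
     (\<forall>\<omega>\<in>space M. continuous_on {0..} (\<lambda>t. W t \<omega>)) \<and>
     (\<forall>s t. 0 \<le> s \<and> s < t \<longrightarrow>
        distributed M lborel (\<lambda>\<omega>. W t \<omega> - W s \<omega>) (normal_density 0 (sqrt (t - s)))) \<and>
     (\<forall>(n::nat) (\<tau>::nat \<Rightarrow> real). 0 \<le> \<tau> 0 \<and> (\<forall>i<n. \<tau> i \<le> \<tau> (Suc i)) \<longrightarrow>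
        prob_space.indep_vars M (\<lambda>_. borel) (\<lambda>i \<omega>. W (\<tau> (Suc i)) \<omega> - W (\<tau> i) \<omega>) {..<n})"

text \<open>X_m(t) = (1/m!) int_0^t (t-s)^m dW(s), for m >= 1.  The Wiener integral of the
  smooth deterministic integrand is taken pathwise (Paley-Wiener-Zygmund), i.e. via
  integration by parts: since (t-s)^m vanishes at s = t and W 0 = 0,
  X_m(t) = int_0^t (t-s)^(m-1)/(m-1)! W(s) ds.\<close>
definition X_proc :: "nat \<Rightarrow> (real \<Rightarrow> 'a \<Rightarrow> real) \<Rightarrow> real \<Rightarrow> 'a \<Rightarrow> real" where
  "X_proc m W t \<omega> = (LINT s:{0..t}|lborel. (t - s) ^ (m - 1) / fact (m - 1) * W s \<omega>)"

definition Lp_norm01 :: "real \<Rightarrow> (real \<Rightarrow> real) \<Rightarrow> real" where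
  "Lp_norm01 p f = (LINT t:{0..1}|lborel. \<bar>f t\<bar> powr p) powr (1 / p)"

definition K_cov :: "nat \<Rightarrow> real \<Rightarrow> real \<Rightarrow> real" where
  "K_cov m s t = 1 / (fact m)\<^sup>2 * (LINT u:{0..min s t}|lborel. (s - u) ^ m * (t - u) ^ m)"

definition Lq_unit_ball :: "real \<Rightarrow> (real \<Rightarrow> real) set" where
  "Lq_unit_ball p =
     (if p = 1 then
        {f. f \<in> borel_measurable lborel \<and> (AE t in lborel. t \<in> {0..1} \<longrightarrow> \<bar>f t\<bar> \<le> 1)}
      else
        {f. f \<in> borel_measurable lborel \<and>
            set_integrable lborel {0..1} (\<lambda>t. \<bar>f t\<bar> powr (p / (p - 1))) \<and>
            (LINT t:{0..1}|lborel. \<bar>f t\<bar> powr (p / (p - 1))) \<le> 1})"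

text \<open>||A_m||_p: the norm of the covariance operator A_m : L^q[0,1] -> L^p[0,1].\<close>
definition A_norm :: "nat \<Rightarrow> real \<Rightarrow> real" where
  "A_norm m p = Sup {(LINT s:{0..1}|lborel. (LINT t:{0..1}|lborel. K_cov m t s * f t * g s))
                     | f g. f \<in> Lq_unit_ball p \<and> g \<in> Lq_unit_ball p}"

end

theory Submission
  imports Defs
begin

text \<open>
  Let \<open>F r\<close> be the probability that the norm of \<open>X\<close> exceeds \<open>r\<close>, and let \<open>Y\<close> be an independent copy
  of \<open>X\<close>.  By rotation invariance \<open>U = c X + s Y\<close> and \<open>V = - s X + c Y\<close> (\<open>c\<^sup>2 + s\<^sup>2 = 1\<close>) are again
  independent copies.  If \<open>X\<close> is larger than \<open>r\<close> and \<open>Y\<close> is smaller than \<open>\<epsilon>\<close>, then \<open>U\<close> is larger than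
  \<open>c r - s \<epsilon>\<close> while \<open>V\<close> lies within \<open>\<epsilon> / c\<close> of \<open>- (s / c) U\<close>; given \<open>U\<close>, a norming functional and
  Chernoff's bound estimate the latter event.  With \<open>A\<close> the norm of the covariance operator this gives
  \<open>F r * P (norm X \<le> \<epsilon>) \<le> F (c r - O(\<epsilon>)) * exp (- (s r - O(\<epsilon>))\<^sup>2 / (2 A))\<close>.
  Since \<open>c\<^sup>2 + s\<^sup>2 = 1\<close>, iterating it reproduces \<open>r\<^sup>2 / (2 A)\<close> exactly, the errors being sums
  over the scales \<open>c\<^sup>k r\<close> of \<open>r \<epsilon>\<close> and of \<open>- ln P (norm X \<le> \<epsilon>)\<close>.

  The small ball probability is at least \<open>exp (- B \<epsilon> powr (- 2 / (2 m + 1)))\<close>: rounding the state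
  \<open>(W, X_1, \<dots>, X_m)\<close> on a grid of \<open>n\<close> points, scaled by the typical fluctuation on a cell, encodes a
  typical path by one of \<open>exp (O(n))\<close> integer sequences up to an error \<open>O(n powr (- m - 1 / 2))\<close>, and
  two independent copies share their code with probability at least \<open>exp (- O(n))\<close>.  The choice
  \<open>\<epsilon> = r powr (2 / (2 m + 3) - 1)\<close> makes both errors of order \<open>r powr (2 / (2 m + 3))\<close>.
\<close>

subsection \<open>Iterated integration on the unit interval\<close>

text \<open>Concentration around a median would leave an error linear in \<open>r\<close>, while 2 /
  (2 m + 3) is below 1. The balls must therefore shrink as \<open>r\<close> grows, and their
  probability may enter only through its logarithm; the rotation achieves this by making the small
  ball probability a factor of the tail.

  Brownian motion is given by finite families of increments. So it is the driving path, sampled on a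
  grid, that is rotated, and the norm of \<open>X\<close> is carried along as a seminorm of that
  path. Equality in law reaches the limit only when tested on continuous functions, which is why
  thresholds are relaxed a little at each use.

  The largest of \<open>n\<close> cell fluctuations exceeds the typical one by a factor of order
  sqrt (ln n), so a bound through the maximum would lose logarithms in the small ball estimate. The
  good event bounds an average of exponentials of the fluctuations instead; this is enough both to
  count the codes and to control p-th powers.\<close>

definition U01 :: "real measure" where
  "U01 = uniform_measure lborel {0..1}"

lemma sets_U01 [measurable_cong]: "sets U01 = sets borel"
  by (simp add: U01_def)

lemma space_U01 [simp]: "space U01 = UNIV"
  by (simp add: U01_def)

interpretation U01: prob_space U01
  unfolding U01_def by (rule prob_space_uniform_measure) simp_all

lemma prob_U01 [simp]: "measure U01 UNIV = 1"
  using U01.prob_space by simp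

interpretation UU: pair_sigma_finite U01 U01 ..

lemma borel_measurable_U01 [simp]: "borel_measurable U01 = borel_measurable borel"
  by (rule measurable_cong_sets) (simp_all add: sets_U01)

lemma AE_U01: "AE t in U01. t \<in> {0..1}"
  unfolding U01_def by (rule AE_uniform_measureI) auto

lemma AE_U01_I: "AE t in lborel. t \<in> {0..1} \<longrightarrow> P t \<Longrightarrow> AE t in U01. P t"
  unfolding U01_def by (rule AE_uniform_measureI) auto

lemma U01_eq_density: "U01 = density lborel (\<lambda>t. ennreal (indicator {0..1::real} t))"
  unfolding U01_def uniform_measure_def by (intro density_cong) (auto simp: divide_ennreal_def split: split_indicator)

lemma integral_U01:
  fixes f :: "real \<Rightarrow> real"
  assumes "f \<in> borel_measurable borel"
  shows "(\<integral>t. f t \<partial>U01) = (LINT t:{0..1}|lborel. f t)"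
  unfolding set_lebesgue_integral_def U01_eq_density using assms
  by (subst integral_density) auto

lemma integrable_U01_iff:
  fixes f :: "real \<Rightarrow> real"
  assumes "f \<in> borel_measurable borel"
  shows "integrable U01 f \<longleftrightarrow> set_integrable lborel {0..1} f"
  unfolding set_integrable_def U01_eq_density using assms
  by (subst integrable_density) auto

text \<open>A class that is closed under the operations used below and integrable against the
  probability measure \<open>U01\<close>, so that for paths and norming functionals integrability
  need not be tracked. Boundedness is asked on the whole line to avoid range conditions on
  arguments.\<close>

definition bdd_borel :: "(real \<Rightarrow> real) \<Rightarrow> bool" where
  "bdd_borel w \<longleftrightarrow> w \<in> borel_measurable borel \<and> (\<exists>B. \<forall>t. \<bar>w t\<bar> \<le> B)"

lemma bdd_borelI: "w \<in> borel_measurable borel \<Longrightarrow> (\<And>t. \<bar>w t\<bar> \<le> B) \<Longrightarrow> bdd_borel w"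
  by (auto simp: bdd_borel_def)

lemma bdd_borel_measurable: "bdd_borel w \<Longrightarrow> w \<in> borel_measurable borel"
  by (simp add: bdd_borel_def)

lemma bdd_borelE:
  assumes "bdd_borel w"
  obtains B where "B > 0" "\<And>t. \<bar>w t\<bar> \<le> B"
proof -
  from assms obtain B where B: "\<And>t. \<bar>w t\<bar> \<le> B" by (auto simp: bdd_borel_def)
  then have "\<bar>w t\<bar> \<le> max B 1" for t by (meson max.coboundedI1)
  then show ?thesis by (intro that[of "max B 1"]) auto
qed

lemma bdd_borel_lincomb:
  assumes "bdd_borel v" "bdd_borel w"
  shows "bdd_borel (\<lambda>t. a * v t + b * w t)"
proof -
  obtain A B where *: "\<And>t. \<bar>v t\<bar> \<le> A" "\<And>t. \<bar>w t\<bar> \<le> B"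
    using assms by (meson bdd_borelE)
  have "\<bar>a * v t + b * w t\<bar> \<le> \<bar>a\<bar> * A + \<bar>b\<bar> * B" for t
  proof -
    have "\<bar>a * v t + b * w t\<bar> \<le> \<bar>a\<bar> * \<bar>v t\<bar> + \<bar>b\<bar> * \<bar>w t\<bar>"
      by (metis abs_mult abs_triangle_ineq)
    also have "\<dots> \<le> \<bar>a\<bar> * A + \<bar>b\<bar> * B"
      by (intro add_mono mult_left_mono *) auto
    finally show ?thesis .
  qed
  moreover have "(\<lambda>t. a * v t + b * w t) \<in> borel_measurable borel"
    using assms[THEN bdd_borel_measurable] by measurable
  ultimately show ?thesis by (auto intro: bdd_borelI)
qed

lemma bdd_borel_mult:
  assumes "bdd_borel v" "bdd_borel w"
  shows "bdd_borel (\<lambda>t. v t * w t)"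
proof -
  obtain A B where *: "\<And>t. \<bar>v t\<bar> \<le> A" "\<And>t. \<bar>w t\<bar> \<le> B" "A > 0"
    using assms by (meson bdd_borelE)
  then have "\<bar>v t * w t\<bar> \<le> A * B" for t
    unfolding abs_mult by (intro mult_mono) auto
  moreover have "(\<lambda>t. v t * w t) \<in> borel_measurable borel"
    using assms[THEN bdd_borel_measurable] by measurable
  ultimately show ?thesis by (auto intro: bdd_borelI)
qed

lemma bdd_borel_const [simp]: "bdd_borel (\<lambda>t. c)"
  by (rule bdd_borelI[of _ "\<bar>c\<bar>"]) auto

lemma bdd_borel_abs_powr:
  assumes "bdd_borel w" "p > 0"
  shows "bdd_borel (\<lambda>t. \<bar>w t\<bar> powr p)"
proof -
  obtain B where "\<And>t. \<bar>w t\<bar> \<le> B" using assms by (meson bdd_borelE)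
  then have "\<bar>\<bar>w t\<bar> powr p\<bar> \<le> B powr p" for t using assms by (auto intro!: powr_mono2)
  then show ?thesis using assms(1)[THEN bdd_borel_measurable] by (intro bdd_borelI) measurable
qed

lemma integrable_bdd_borel: "bdd_borel w \<Longrightarrow> integrable U01 w"
  unfolding bdd_borel_def by (elim conjE exE, rule U01.integrable_const_bound) auto

text \<open>The cut-off at \<open>s \<le> t\<close> turns an integral over the unit interval into
  one over \<open>{0..t}\<close>; the cut-off at \<open>t \<le> 1\<close> keeps the kernel between 0
  and 1 for all real arguments.\<close>

definition kern :: "nat \<Rightarrow> real \<Rightarrow> real \<Rightarrow> real" where
  "kern j t s = (if 0 \<le> s \<and> s \<le> t \<and> t \<le> 1 then (t - s) ^ j / fact j else 0)"

lemma kern_measurable [measurable]: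
  assumes "f \<in> borel_measurable M" "g \<in> borel_measurable M"
  shows "(\<lambda>x. kern j (f x) (g x)) \<in> borel_measurable M"
  using assms unfolding kern_def by measurable

lemma kern_nonneg: "0 \<le> kern j t s"
  by (simp add: kern_def)

lemma kern_le_1: "kern j t s \<le> 1"
proof (cases "0 \<le> s \<and> s \<le> t \<and> t \<le> 1")
  case True
  then have "(t - s) ^ j \<le> 1" by (intro power_le_one) auto
  also have "1 \<le> (fact j :: real)" by (rule fact_ge_1)
  finally show ?thesis using True by (simp add: kern_def)
qed (auto simp: kern_def)

lemma abs_kern_mult_le: "\<bar>kern j t s * x\<bar> \<le> \<bar>x\<bar>"
  unfolding abs_mult using kern_nonneg[of j t s] kern_le_1[of j t s]
  by (simp add: mult_left_le_one_le)

lemma bdd_borel_kern: "bdd_borel (kern j t)"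
  by (rule bdd_borelI[of _ 1]) (auto simp: kern_nonneg kern_le_1)

text \<open>Cauchy's formula for repeated integration. Level 0 is the path itself, so that the path
  and its integrals form one family, on which Taylor expansion acts.\<close>

definition iter_int :: "nat \<Rightarrow> (real \<Rightarrow> real) \<Rightarrow> real \<Rightarrow> real" where
  "iter_int j w t = (case j of 0 \<Rightarrow> w t | Suc i \<Rightarrow> (\<integral>s. kern i t s * w s \<partial>U01))"

lemma iter_int_0 [simp]: "iter_int 0 w t = w t"
  and iter_int_Suc: "iter_int (Suc i) w t = (\<integral>s. kern i t s * w s \<partial>U01)"
  by (simp_all add: iter_int_def)

lemma iter_int_measurable:
  assumes [measurable]: "(\<lambda>(s, x). w s x) \<in> borel_measurable (borel \<Otimes>\<^sub>M N)"
    and [measurable]: "f \<in> borel_measurable L" "g \<in> measurable L N"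
  shows "(\<lambda>z. iter_int j (\<lambda>s. w s (g z)) (f z)) \<in> borel_measurable L"
proof (cases j)
  case 0
  have "(\<lambda>z. (\<lambda>(s, x). w s x) (f z, g z)) \<in> borel_measurable L" by measurable
  then show ?thesis by (simp add: 0)
next
  case (Suc i)
  have "(\<lambda>y. (\<lambda>(s, x). w s x) (snd y, g (fst y))) \<in> borel_measurable (L \<Otimes>\<^sub>M U01)"
    by measurable
  then have [measurable]: "(\<lambda>y. w (snd y) (g (fst y))) \<in> borel_measurable (L \<Otimes>\<^sub>M U01)"
    by simp
  have "(\<lambda>z. \<integral>s. kern i (f z) s * w s (g z) \<partial>U01) \<in> borel_measurable L"
    by (rule U01.borel_measurable_lebesgue_integral) (simp add: case_prod_beta)
  then show ?thesis by (simp add: Suc iter_int_Suc)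
qed

lemma Lp_norm01_eq:
  assumes "f \<in> borel_measurable borel"
  shows "Lp_norm01 p f = (\<integral>t. \<bar>f t\<bar> powr p \<partial>U01) powr (1 / p)"
  unfolding Lp_norm01_def using assms by (subst integral_U01) auto

lemma Lp_norm01_measurable:
  assumes [measurable]: "(\<lambda>(t, x). f t x) \<in> borel_measurable (borel \<Otimes>\<^sub>M N)"
  shows "(\<lambda>x. Lp_norm01 p (\<lambda>t. f t x)) \<in> borel_measurable N"
proof -
  have "(\<lambda>y. (\<lambda>(t, x). f t x) (snd y, fst y)) \<in> borel_measurable (N \<Otimes>\<^sub>M U01)"
    by measurable
  then have [measurable]: "(\<lambda>y. f (snd y) (fst y)) \<in> borel_measurable (N \<Otimes>\<^sub>M U01)"
    by simp
  have [measurable]: "(\<lambda>t. f t x) \<in> borel_measurable borel" if "x \<in> space N" for x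
  proof -
    have "(\<lambda>t. (\<lambda>(t, x). f t x) (t, x)) \<in> borel_measurable borel" using that by measurable
    then show ?thesis by simp
  qed
  have "(\<lambda>x. (\<integral>t. \<bar>f t x\<bar> powr p \<partial>U01) powr (1 / p)) \<in> borel_measurable N"
    by (intro powr_real_measurable U01.borel_measurable_lebesgue_integral) (simp_all add: case_prod_beta)
  then show ?thesis
    by (subst measurable_cong[OF Lp_norm01_eq]) auto
qed

lemma Lp_norm01_nonneg: "0 \<le> Lp_norm01 p f"
  by (simp add: Lp_norm01_def)

lemma iter_int_bound:
  assumes "bdd_borel w" "\<And>t. \<bar>w t\<bar> \<le> B"
  shows "\<bar>iter_int j w t\<bar> \<le> B"
proof (cases j)
  case (Suc i)
  have "\<bar>\<integral>s. kern i t s * w s \<partial>U01\<bar> \<le> (\<integral>s. \<bar>kern i t s * w s\<bar> \<partial>U01)"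
    by (rule integral_abs_bound)
  also have "\<dots> \<le> (\<integral>s. B \<partial>U01)"
    using abs_kern_mult_le[of i t] assms bdd_borel_mult[OF bdd_borel_kern assms(1)]
    by (intro integral_mono integrable_abs integrable_bdd_borel) (auto intro: order_trans)
  finally show ?thesis by (simp add: Suc iter_int_Suc)
qed (use assms in auto)

lemma bdd_borel_iter_int:
  assumes "bdd_borel w"
  shows "bdd_borel (iter_int j w)"
proof (cases j)
  case 0
  then have "iter_int j w = w" by (auto simp: fun_eq_iff)
  then show ?thesis using assms by simp
next
  case (Suc i)
  obtain B where B: "\<And>t. \<bar>w t\<bar> \<le> B" using assms by (meson bdd_borelE)
  have [measurable]: "w \<in> borel_measurable borel" using assms by (rule bdd_borel_measurable)
  have "(\<lambda>(s, u::unit). w s) \<in> borel_measurable (borel \<Otimes>\<^sub>M count_space UNIV)"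
    by measurable
  from iter_int_measurable[OF this, of "\<lambda>z. z" borel "\<lambda>_. ()" j]
  have "iter_int j w \<in> borel_measurable borel" by simp
  moreover have "\<bar>iter_int j w t\<bar> \<le> B" for t
    using assms B by (rule iter_int_bound)
  ultimately show ?thesis by (intro bdd_borelI) auto
qed

lemma iter_int_lincomb:
  assumes "bdd_borel v" "bdd_borel w"
  shows "iter_int j (\<lambda>t. a * v t + b * w t) t = a * iter_int j v t + b * iter_int j w t"
proof (cases j)
  case (Suc i)
  have [simp]: "integrable U01 (\<lambda>s. kern i t s * v s)" "integrable U01 (\<lambda>s. kern i t s * w s)"
    using assms by (auto intro!: integrable_bdd_borel bdd_borel_mult bdd_borel_kern)
  have "(\<integral>s. kern i t s * (a * v s + b * w s) \<partial>U01) = (\<integral>s. a * (kern i t s * v s) + b * (kern i t s * w s) \<partial>U01)"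
    by (simp add: algebra_simps)
  also have "\<dots> = a * (\<integral>s. kern i t s * v s \<partial>U01) + b * (\<integral>s. kern i t s * w s \<partial>U01)"
    by simp
  finally show ?thesis unfolding Suc iter_int_Suc .
qed simp

lemma iter_int_tendsto:
  assumes "\<And>N. w N \<in> borel_measurable borel" "\<And>N t. \<bar>w N t\<bar> \<le> B"
    and "\<And>t. t \<in> {0..1} \<Longrightarrow> (\<lambda>N. w N t) \<longlonglongrightarrow> v t" "v \<in> borel_measurable borel"
    and "t \<in> {0..1}"
  shows "(\<lambda>N. iter_int j (w N) t) \<longlonglongrightarrow> iter_int j v t"
proof (cases j)
  case 0
  then show ?thesis using assms by simp
next
  case (Suc i)
  have *: "\<bar>kern i t s * w N s\<bar> \<le> B" for s N
    using abs_kern_mult_le[of i t s "w N s"] assms(2)[of N s] by linarith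
  show ?thesis unfolding Suc iter_int_Suc
  proof (rule integral_dominated_convergence[where w = "\<lambda>_. B"])
    show "AE x in U01. (\<lambda>N. kern i t x * w N x) \<longlonglongrightarrow> kern i t x * v x"
      using AE_U01 by eventually_elim (intro tendsto_mult tendsto_const assms, auto)
  qed (use assms * in auto)
qed

lemma Lp_norm01_tendsto:
  assumes "p \<ge> 1"
    and [measurable]: "\<And>N. f N \<in> borel_measurable borel" and B: "\<And>N t. \<bar>f N t\<bar> \<le> B"
    and "\<And>t. t \<in> {0..1} \<Longrightarrow> (\<lambda>N. f N t) \<longlonglongrightarrow> g t" and [measurable]: "g \<in> borel_measurable borel"
  shows "(\<lambda>N. Lp_norm01 p (f N)) \<longlonglongrightarrow> Lp_norm01 p g"
proof -
  have "(\<lambda>N. \<integral>t. \<bar>f N t\<bar> powr p \<partial>U01) \<longlonglongrightarrow> (\<integral>t. \<bar>g t\<bar> powr p \<partial>U01)"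
  proof (rule integral_dominated_convergence[where w = "\<lambda>_. B powr p"])
    show "AE t in U01. (\<lambda>N. \<bar>f N t\<bar> powr p) \<longlonglongrightarrow> \<bar>g t\<bar> powr p"
      using AE_U01 by eventually_elim
        (rule tendsto_powr2, use assms in \<open>auto intro!: tendsto_rabs tendsto_const\<close>)
    show "AE t in U01. norm (\<bar>f N t\<bar> powr p) \<le> B powr p" for N
      using B assms(1) by (auto intro!: powr_mono2)
  qed auto
  then show ?thesis
    using assms by (auto simp: Lp_norm01_eq intro!: tendsto_powr2 tendsto_const)
qed

subsection \<open>Norming functionals and the covariance operator\<close>

text \<open>For \<open>p > 1\<close> this is the extremal of Hoelder's inequality,
  \<open>sgn h * \<bar>h\<bar> powr (p - 1)\<close> normalized; for \<open>p = 1\<close> it is the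
  sign of \<open>h\<close>. A bound \<open>D > 0\<close> in place of the norm of \<open>g\<close>
  allows division by \<open>D\<close> even when that norm vanishes.\<close>

lemma Lp_dual:
  assumes p: "1 \<le> p" and h: "bdd_borel h"
  shows "\<exists>f. bdd_borel f \<and> f \<in> Lq_unit_ball p \<and> (\<integral>t. f t * h t \<partial>U01) = Lp_norm01 p h \<and>
    (\<forall>g D. bdd_borel g \<longrightarrow> 0 < D \<longrightarrow> Lp_norm01 p g \<le> D \<longrightarrow> (\<integral>t. f t * g t \<partial>U01) \<le> D)"
proof -
  have hm [measurable]: "h \<in> borel_measurable borel" using h by (rule bdd_borel_measurable)
  consider "Lp_norm01 p h = 0" | "p = 1" | "p > 1" "Lp_norm01 p h > 0"
    using p Lp_norm01_nonneg[of p h] by linarith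
  then show ?thesis
  proof cases
    case 1
    have "(\<lambda>t. 0::real) \<in> Lq_unit_ball p"
      by (auto simp: Lq_unit_ball_def set_lebesgue_integral_def set_integrable_def)
    then show ?thesis by (intro exI[of _ "\<lambda>t. 0"]) (auto simp: 1)
  next
    case 2
    have n1: "Lp_norm01 p g = (\<integral>t. \<bar>g t\<bar> \<partial>U01)" if "bdd_borel g" for g
      using bdd_borel_measurable[OF that] by (simp add: Lp_norm01_eq 2)
    have f: "bdd_borel (\<lambda>t. sgn (h t))"
      by (rule bdd_borelI[of _ 1]) (auto simp: sgn_if)
    show ?thesis
    proof (intro exI conjI allI impI)
      show "bdd_borel (\<lambda>t. sgn (h t))" by (rule f)
      show "(\<lambda>t. sgn (h t)) \<in> Lq_unit_ball p"
        by (auto simp: Lq_unit_ball_def 2 sgn_if)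
      show "(\<integral>t. sgn (h t) * h t \<partial>U01) = Lp_norm01 p h"
        unfolding n1[OF h] by (intro Bochner_Integration.integral_cong) (auto simp: sgn_if)
      fix g D assume g: "bdd_borel g" "Lp_norm01 p g \<le> D"
      have "(\<integral>t. sgn (h t) * g t \<partial>U01) \<le> (\<integral>t. \<bar>g t\<bar> \<partial>U01)"
        using f g(1) by (intro integral_mono integrable_abs integrable_bdd_borel bdd_borel_mult) (auto simp: sgn_if)
      then show "(\<integral>t. sgn (h t) * g t \<partial>U01) \<le> D" using n1[OF g(1)] g by simp
    qed
  next
    case 3
    define N where "N = Lp_norm01 p h"
    define q where "q = p / (p - 1)"
    define f where "f t = sgn (h t) * \<bar>h t\<bar> powr (p - 1) / N powr (p - 1)" for t
    have N: "N > 0" using 3 by (simp add: N_def)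
    have q: "q > 1" "1 / p + 1 / q = 1" "(p - 1) * q = p"
      using 3 by (auto simp: q_def field_simps)
    have "(\<integral>t. \<bar>h t\<bar> powr p \<partial>U01) \<ge> 0" by simp
    then have hp: "(\<integral>t. \<bar>h t\<bar> powr p \<partial>U01) = N powr p"
      using 3 unfolding N_def Lp_norm01_eq[OF hm] powr_powr by simp
    have fm [measurable]: "f \<in> borel_measurable borel" unfolding f_def by measurable
    have absf: "\<bar>f t\<bar> = \<bar>h t\<bar> powr (p - 1) / N powr (p - 1)" for t
      by (auto simp: f_def abs_mult sgn_if)
    have fq: "\<bar>f t\<bar> powr q = \<bar>h t\<bar> powr p / N powr p" for t
      unfolding absf using N q by (simp add: powr_divide powr_powr)
    have fh: "f t * h t = \<bar>h t\<bar> powr p / N powr (p - 1)" for t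
    proof -
      have "\<bar>h t\<bar> powr (p - 1) * \<bar>h t\<bar> = \<bar>h t\<bar> powr p"
        by (cases "h t = 0") (auto simp: powr_mult_base' powr_diff)
      then show ?thesis by (auto simp: f_def sgn_if mult_ac)
    qed
    have f: "bdd_borel f"
    proof -
      have "bdd_borel (\<lambda>t. \<bar>h t\<bar> powr (p - 1))" using h 3 by (intro bdd_borel_abs_powr) auto
      then obtain B where "\<And>t. \<bar>\<bar>h t\<bar> powr (p - 1)\<bar> \<le> B" by (meson bdd_borelE)
      then have "\<bar>f t\<bar> \<le> B / N powr (p - 1)" for t
        unfolding absf using N by (intro divide_right_mono) auto
      then show ?thesis by (intro bdd_borelI fm)
    qed
    have int_fq: "integrable U01 (\<lambda>t. \<bar>f t\<bar> powr q)"
      using f q by (intro integrable_bdd_borel bdd_borel_abs_powr) auto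
    have fq1: "(\<integral>t. \<bar>f t\<bar> powr q \<partial>U01) = 1"
      unfolding fq using hp N by simp
    show ?thesis
    proof (intro exI conjI allI impI)
      show "bdd_borel f" by (rule f)
      show "f \<in> Lq_unit_ball p"
        using 3 int_fq fq1 integrable_U01_iff[of "\<lambda>t. \<bar>f t\<bar> powr q"] integral_U01[of "\<lambda>t. \<bar>f t\<bar> powr q"]
        by (auto simp: Lq_unit_ball_def q_def)
      show "(\<integral>t. f t * h t \<partial>U01) = Lp_norm01 p h"
        unfolding fh using hp N by (simp add: N_def[symmetric] powr_diff)
      fix g D assume g: "bdd_borel g" and D: "0 < D" "Lp_norm01 p g \<le> D"
      have [measurable]: "g \<in> borel_measurable borel" using g by (rule bdd_borel_measurable)
      have "(\<integral>t. \<bar>g t\<bar> powr p \<partial>U01) = Lp_norm01 p g powr p"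
        using p by (simp add: Lp_norm01_eq powr_powr)
      also have "\<dots> \<le> D powr p" using D p by (intro powr_mono2) (auto simp: Lp_norm01_nonneg)
      finally have gp: "(\<integral>t. \<bar>g t\<bar> powr p \<partial>U01) \<le> D powr p" .
      have int_g: "integrable U01 (\<lambda>t. \<bar>g t\<bar> powr p)"
        using g p by (intro integrable_bdd_borel bdd_borel_abs_powr) auto
      \<comment> \<open>Young's inequality for \<bar>f\<bar> and \<bar>g\<bar> / D. The integrals of
        their q-th and p-th powers are at most 1, so the weights 1 / q and 1 / p add up to
        1.\<close>
      have "(\<integral>t. f t * g t \<partial>U01) \<le> (\<integral>t. D * (\<bar>f t\<bar> powr q / q + (\<bar>g t\<bar> powr p) / (D powr p * p)) \<partial>U01)"
      proof (rule integral_mono)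
        show "integrable U01 (\<lambda>t. f t * g t)" using f g by (intro integrable_bdd_borel bdd_borel_mult)
        show "integrable U01 (\<lambda>t. D * (\<bar>f t\<bar> powr q / q + (\<bar>g t\<bar> powr p) / (D powr p * p)))"
          using int_fq int_g by auto
        fix t
        have "f t * g t \<le> D * (\<bar>f t\<bar> * (\<bar>g t\<bar> / D))"
          using D by (simp add: abs_mult[symmetric])
        also have "\<bar>f t\<bar> * (\<bar>g t\<bar> / D) \<le> \<bar>f t\<bar> powr q / q + (\<bar>g t\<bar> / D) powr p / p"
          using 3 q D by (intro Youngs_inequality) auto
        finally show "f t * g t \<le> D * (\<bar>f t\<bar> powr q / q + (\<bar>g t\<bar> powr p) / (D powr p * p))"
          using D by (simp add: powr_divide mult_left_mono)
      qed
      also have "\<dots> = D * (1 / q + (\<integral>t. \<bar>g t\<bar> powr p \<partial>U01) / (D powr p * p))"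
        using int_fq int_g fq1 by simp
      also have "\<dots> \<le> D * (1 / q + 1 / p)"
        using gp D p by (intro mult_left_mono add_left_mono) (auto simp: field_simps)
      also have "\<dots> = D" using q by (simp add: add.commute)
      finally show "(\<integral>t. f t * g t \<partial>U01) \<le> D" .
    qed
  qed
qed

text \<open>From x \<le> 1 + x^q. The constant only serves to bound the set whose supremum is
  \<open>A_norm\<close>, so its size is immaterial.\<close>

lemma Lq_unit_ball_L1:
  assumes p: "1 \<le> p" and f: "f \<in> Lq_unit_ball p"
  shows "integrable U01 f" "(\<integral>t. \<bar>f t\<bar> \<partial>U01) \<le> 2"
proof -
  have [measurable]: "f \<in> borel_measurable borel"
    using f by (auto simp: Lq_unit_ball_def split: if_splits)
  obtain b where b: "integrable U01 b" "AE t in U01. \<bar>f t\<bar> \<le> b t" "(\<integral>t. b t \<partial>U01) \<le> 2"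
  proof (cases "p = 1")
    case True
    then have "AE t in lborel. t \<in> {0..1} \<longrightarrow> \<bar>f t\<bar> \<le> 1" using f by (auto simp: Lq_unit_ball_def)
    then show ?thesis by (intro that[of "\<lambda>_. 1"] AE_U01_I) auto
  next
    case False
    define q where "q = p / (p - 1)"
    have q: "q > 1" using False p by (auto simp: q_def field_simps)
    have i: "integrable U01 (\<lambda>t. \<bar>f t\<bar> powr q)" "(\<integral>t. \<bar>f t\<bar> powr q \<partial>U01) \<le> 1"
      using False f integrable_U01_iff[of "\<lambda>t. \<bar>f t\<bar> powr q"] integral_U01[of "\<lambda>t. \<bar>f t\<bar> powr q"]
      by (auto simp: Lq_unit_ball_def q_def)
    have "\<bar>f t\<bar> \<le> 1 + \<bar>f t\<bar> powr q" for t
    proof (cases "\<bar>f t\<bar> \<le> 1")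
      case True
      then show ?thesis by (meson add_increasing2 powr_ge_zero)
    next
      case False
      then have "\<bar>f t\<bar> powr 1 \<le> \<bar>f t\<bar> powr q" using q by (intro powr_mono) auto
      then show ?thesis using False by simp
    qed
    then show ?thesis using i by (intro that[of "\<lambda>t. 1 + \<bar>f t\<bar> powr q"]) auto
  qed
  show i: "integrable U01 f"
    by (rule Bochner_Integration.integrable_bound[OF b(1)]) (use b(2) in auto)
  have "(\<integral>t. \<bar>f t\<bar> \<partial>U01) \<le> (\<integral>t. b t \<partial>U01)"
    by (intro integral_mono_AE integrable_abs i b)
  then show "(\<integral>t. \<bar>f t\<bar> \<partial>U01) \<le> 2" using b(3) by simp
qed

section \<open>The covariance operator as a bounded bilinear form\<close>

definition Kint :: "nat \<Rightarrow> real \<Rightarrow> real \<Rightarrow> real" where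
  "Kint m s t = (\<integral>u. kern m s u * kern m t u \<partial>U01)"

lemma K_cov_eq_Kint:
  assumes "s \<in> {0..1}" "t \<in> {0..1}"
  shows "K_cov m s t = Kint m s t"
proof -
  have "Kint m s t = (LINT u:{0..1}|lborel. kern m s u * kern m t u)"
    unfolding Kint_def by (rule integral_U01) measurable
  also have "\<dots> = (LINT u:{0..min s t}|lborel. (s - u) ^ m * (t - u) ^ m / (fact m)\<^sup>2)"
    unfolding set_lebesgue_integral_def using assms
    by (intro Bochner_Integration.integral_cong)
       (auto simp: kern_def power2_eq_square split: split_indicator)
  also have "\<dots> = K_cov m s t"
    unfolding K_cov_def by (simp add: set_lebesgue_integral_def)
  finally show ?thesis by simp
qed

lemma Kint_measurable [measurable]:
  assumes [measurable]: "f \<in> borel_measurable L" "g \<in> borel_measurable L"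
  shows "(\<lambda>x. Kint m (f x) (g x)) \<in> borel_measurable L"
  unfolding Kint_def by (rule U01.borel_measurable_lebesgue_integral) (simp add: case_prod_beta)

lemma abs_Kint_le: "\<bar>Kint m s t\<bar> \<le> 1"
proof -
  have "\<bar>Kint m s t\<bar> \<le> (\<integral>u. \<bar>kern m s u * kern m t u\<bar> \<partial>U01)"
    unfolding Kint_def by (rule integral_abs_bound)
  also have "\<dots> \<le> (\<integral>u. 1 \<partial>U01)"
  proof (intro integral_mono integrable_abs integrable_bdd_borel bdd_borel_mult bdd_borel_kern)
    show "\<bar>kern m s x * kern m t x\<bar> \<le> 1" for x
      using abs_kern_mult_le[of m s x "kern m t x"] kern_nonneg[of m t x] kern_le_1[of m t x] by simp
  qed auto
  finally show ?thesis by simp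
qed

lemma bilinear_eq:
  assumes [measurable]: "f \<in> borel_measurable borel" "g \<in> borel_measurable borel"
  shows "(LINT s:{0..1}|lborel. (LINT t:{0..1}|lborel. K_cov m t s * f t * g s)) =
         (\<integral>s. (\<integral>t. Kint m t s * f t * g s \<partial>U01) \<partial>U01)"
proof -
  have "(LINT t:{0..1}|lborel. K_cov m t s * f t * g s) = (\<integral>t. Kint m t s * f t * g s \<partial>U01)"
    if s: "s \<in> {0..1}" for s
  proof -
    have "(LINT t:{0..1}|lborel. K_cov m t s * f t * g s) = (LINT t:{0..1}|lborel. Kint m t s * f t * g s)"
      using s by (intro set_lebesgue_integral_cong) (auto simp: K_cov_eq_Kint)
    also have "\<dots> = (\<integral>t. Kint m t s * f t * g s \<partial>U01)"
      by (rule integral_U01[symmetric]) measurable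
    finally show ?thesis .
  qed
  then have "(LINT s:{0..1}|lborel. (LINT t:{0..1}|lborel. K_cov m t s * f t * g s)) =
      (LINT s:{0..1}|lborel. (\<integral>t. Kint m t s * f t * g s \<partial>U01))"
    by (intro set_lebesgue_integral_cong) auto
  also have "\<dots> = (\<integral>s. (\<integral>t. Kint m t s * f t * g s \<partial>U01) \<partial>U01)"
    by (rule integral_U01[symmetric], rule U01.borel_measurable_lebesgue_integral)
       (simp add: case_prod_beta)
  finally show ?thesis .
qed

text \<open>A supremum of reals is meaningful only for a set that is bounded above. The 4 is the
  product of the two L1 bounds, since the kernel is at most 1.\<close>

lemma abs_bilinear_le:
  assumes p: "1 \<le> p" and f: "f \<in> Lq_unit_ball p" and g: "g \<in> Lq_unit_ball p"
  shows "\<bar>\<integral>s. (\<integral>t. Kint m t s * f t * g s \<partial>U01) \<partial>U01\<bar> \<le> 4"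
proof -
  have [measurable]: "f \<in> borel_measurable borel" "g \<in> borel_measurable borel"
    using f g by (auto simp: Lq_unit_ball_def split: if_splits)
  note F = Lq_unit_ball_L1[OF p f] and G = Lq_unit_ball_L1[OF p g]
  have le: "\<bar>Kint m t s * f t * g s\<bar> \<le> \<bar>f t\<bar> * \<bar>g s\<bar>" for s t
    unfolding abs_mult using abs_Kint_le[of m t s]
    by (intro mult_right_mono) (auto simp: mult_left_le_one_le)
  have in_le: "\<bar>\<integral>t. Kint m t s * f t * g s \<partial>U01\<bar> \<le> 2 * \<bar>g s\<bar>" for s
  proof -
    have "\<bar>\<integral>t. Kint m t s * f t * g s \<partial>U01\<bar> \<le> (\<integral>t. \<bar>Kint m t s * f t * g s\<bar> \<partial>U01)"
      by (rule integral_abs_bound)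
    also have "\<dots> \<le> (\<integral>t. \<bar>f t\<bar> * \<bar>g s\<bar> \<partial>U01)"
      using F(1) le by (intro integral_mono' ) auto
    also have "\<dots> = (\<integral>t. \<bar>f t\<bar> \<partial>U01) * \<bar>g s\<bar>" by simp
    also have "\<dots> \<le> 2 * \<bar>g s\<bar>" using F(2) by (intro mult_right_mono) auto
    finally show ?thesis .
  qed
  have "\<bar>\<integral>s. (\<integral>t. Kint m t s * f t * g s \<partial>U01) \<partial>U01\<bar> \<le> (\<integral>s. \<bar>\<integral>t. Kint m t s * f t * g s \<partial>U01\<bar> \<partial>U01)"
    by (rule integral_abs_bound)
  also have "\<dots> \<le> (\<integral>s. 2 * \<bar>g s\<bar> \<partial>U01)"
    using G(1) in_le by (intro integral_mono') auto
  also have "\<dots> \<le> 4" using G(2) by simp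
  finally show ?thesis .
qed

lemma A_norm_upper:
  assumes p: "1 \<le> p" and f: "f \<in> Lq_unit_ball p" and g: "g \<in> Lq_unit_ball p"
  shows "(\<integral>s. (\<integral>t. Kint m t s * f t * g s \<partial>U01) \<partial>U01) \<le> A_norm m p"
proof -
  have meas: "f \<in> borel_measurable borel" if "f \<in> Lq_unit_ball p" for f
    using that by (auto simp: Lq_unit_ball_def split: if_splits)
  show ?thesis
    unfolding A_norm_def
  proof (rule cSup_upper)
    show "(\<integral>s. (\<integral>t. Kint m t s * f t * g s \<partial>U01) \<partial>U01) \<in>
      {(LINT s:{0..1}|lborel. (LINT t:{0..1}|lborel. K_cov m t s * f t * g s))
                     | f g. f \<in> Lq_unit_ball p \<and> g \<in> Lq_unit_ball p}"
      using f g bilinear_eq[OF meas meas, OF f g, of m] by (intro CollectI exI[of _ f] exI[of _ g]) auto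
    show "bdd_above {(LINT s:{0..1}|lborel. (LINT t:{0..1}|lborel. K_cov m t s * f t * g s))
                     | f g. f \<in> Lq_unit_ball p \<and> g \<in> Lq_unit_ball p}"
    proof (rule bdd_aboveI[of _ 4], elim CollectE exE conjE)
      fix x f g assume x: "x = (LINT s:{0..1}|lborel. (LINT t:{0..1}|lborel. K_cov m t s * f t * g s))"
        and fg: "f \<in> Lq_unit_ball p" "g \<in> Lq_unit_ball p"
      show "x \<le> 4"
        using abs_bilinear_le[OF p fg, of m] unfolding x bilinear_eq[OF meas meas, OF fg] by linarith
    qed
  qed
qed

lemma A_norm_nonneg:
  assumes "1 \<le> p"
  shows "0 \<le> A_norm m p"
proof -
  have "(\<lambda>t. 0::real) \<in> Lq_unit_ball p"
    by (auto simp: Lq_unit_ball_def set_lebesgue_integral_def set_integrable_def)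
  from A_norm_upper[OF assms this this, of m] show ?thesis by simp
qed

lemma U01_swap:
  assumes "(\<lambda>(x, y). F x y) \<in> borel_measurable (borel \<Otimes>\<^sub>M borel)" and "\<And>x y. \<bar>F x y\<bar> \<le> B"
  shows "(\<integral>y. (\<integral>x. F x y \<partial>U01) \<partial>U01) = (\<integral>x. (\<integral>y. F x y \<partial>U01) \<partial>U01 :: real)"
proof (rule UU.Fubini_integral)
  interpret P: pair_prob_space U01 U01 ..
  have "case_prod F \<in> borel_measurable (U01 \<Otimes>\<^sub>M U01)"
    using assms(1) by (subst measurable_cong_sets[OF sets_pair_measure_cong[OF sets_U01 sets_U01] refl])
  then show "integrable (U01 \<Otimes>\<^sub>M U01) (case_prod F)"
    by (intro P.integrable_const_bound[of _ B]) (auto simp: assms(2))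
qed

text \<open>The functional of \<open>X\<close> given by \<open>f\<close> is the Wiener integral of
  the inner function of \<open>u\<close>, and the left side is its variance. Fubini turns it into
  the quadratic form of the covariance operator at \<open>f\<close>, one of the numbers under the
  supremum.\<close>

lemma variance_le_A_norm:
  assumes p: "1 \<le> p" and f: "f \<in> Lq_unit_ball p" and bf: "bdd_borel f"
  shows "(\<integral>u. (\<integral>t. kern m t u * f t \<partial>U01)\<^sup>2 \<partial>U01) \<le> A_norm m p"
proof -
  have [measurable]: "f \<in> borel_measurable borel" using bf by (rule bdd_borel_measurable)
  obtain B where B: "\<And>t. \<bar>f t\<bar> \<le> B" "B > 0" using bf by (meson bdd_borelE)
  define G where "G u = (\<integral>t. kern m t u * f t \<partial>U01)" for u
  have [measurable]: "G \<in> borel_measurable borel"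
    unfolding G_def by (rule U01.borel_measurable_lebesgue_integral) (simp add: case_prod_beta)
  have bk: "bdd_borel (\<lambda>t. kern m t u)" for u
    by (rule bdd_borelI[of _ 1]) (auto simp: kern_nonneg kern_le_1)
  have GB: "\<bar>G u\<bar> \<le> B" for u
  proof -
    have "\<bar>G u\<bar> \<le> (\<integral>t. \<bar>kern m t u * f t\<bar> \<partial>U01)" unfolding G_def by (rule integral_abs_bound)
    also have "\<dots> \<le> (\<integral>t. B \<partial>U01)"
      using abs_kern_mult_le[of m _ u] B
      by (intro integral_mono integrable_abs integrable_bdd_borel bdd_borel_mult bk bf) (auto intro: order_trans)
    finally show ?thesis by simp
  qed
  have b1: "\<bar>kern m s u * f s * G u\<bar> \<le> B * B" for s u
  proof -
    have "\<bar>kern m s u * f s\<bar> * \<bar>G u\<bar> \<le> B * B"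
      using abs_kern_mult_le[of m s u "f s"] B(1)[of s] GB[of u] by (intro mult_mono) linarith+
    then show ?thesis by (simp add: abs_mult)
  qed
  have b2: "\<bar>kern m t u * f t * kern m s u\<bar> \<le> B" for s t u
  proof -
    have "\<bar>kern m s u * (kern m t u * f t)\<bar> \<le> \<bar>kern m t u * f t\<bar>" by (rule abs_kern_mult_le)
    also have "\<dots> \<le> B" using abs_kern_mult_le[of m t u "f t"] B(1)[of t] by linarith
    finally show ?thesis by (simp add: mult_ac)
  qed
  have "(\<integral>u. (G u)\<^sup>2 \<partial>U01) = (\<integral>u. (\<integral>s. kern m s u * f s * G u \<partial>U01) \<partial>U01)"
    by (simp add: G_def power2_eq_square)
  also have "\<dots> = (\<integral>s. (\<integral>u. kern m s u * f s * G u \<partial>U01) \<partial>U01)"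
    by (rule U01_swap[where B = "B * B"]) (use b1 in \<open>auto simp: case_prod_beta\<close>)
  also have "\<dots> = (\<integral>s. (\<integral>t. Kint m t s * f t * f s \<partial>U01) \<partial>U01)"
  proof (rule Bochner_Integration.integral_cong[OF refl])
    fix s
    have "(\<integral>u. kern m s u * f s * G u \<partial>U01) = f s * (\<integral>u. (\<integral>t. kern m t u * f t * kern m s u \<partial>U01) \<partial>U01)"
    proof -
      have "(\<integral>t. kern m t u * f t * kern m s u \<partial>U01) = G u * kern m s u" for u
        by (simp add: G_def)
      moreover have "(\<integral>u. kern m s u * f s * G u \<partial>U01) = (\<integral>u. f s * (G u * kern m s u) \<partial>U01)"
        by (simp add: mult_ac)
      ultimately show ?thesis by (simp only: Bochner_Integration.integral_mult_right_zero)
    qed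
    also have "(\<integral>u. (\<integral>t. kern m t u * f t * kern m s u \<partial>U01) \<partial>U01) =
        (\<integral>t. (\<integral>u. kern m t u * f t * kern m s u \<partial>U01) \<partial>U01)"
      by (rule U01_swap[where B = B]) (use b2 in \<open>auto simp: case_prod_beta\<close>)
    also have "\<dots> = (\<integral>t. Kint m t s * f t \<partial>U01)"
      unfolding Kint_def by (simp add: mult_ac)
    also have "f s * (\<integral>t. Kint m t s * f t \<partial>U01) = (\<integral>t. Kint m t s * f t * f s \<partial>U01)"
      unfolding Bochner_Integration.integral_mult_left_zero by (rule mult.commute)
    finally show "(\<integral>u. kern m s u * f s * G u \<partial>U01) = (\<integral>t. Kint m t s * f t * f s \<partial>U01)" .
  qed
  also have "\<dots> \<le> A_norm m p" by (rule A_norm_upper[OF p f f])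
  finally show ?thesis by (simp add: G_def)
qed

subsection \<open>Rotation invariance of Gaussian product measures\<close>

text \<open>The product of the two densities is a function of the sum of squares, which the rotation
  preserves. Lebesgue measure is treated by two affine substitutions on the line,
  \<open>y = - s a + c b\<close> for fixed \<open>a\<close> and then
  \<open>x = (a + s y) / c\<close> for fixed \<open>y\<close>. Their factors 1 / \<bar>c\<bar> and
  \<bar>c\<bar> cancel; this is where \<open>c \<noteq> 0\<close> enters.\<close>

lemma nn_integral_gauss_rotation:
  fixes h :: "real \<times> real \<Rightarrow> ennreal" and c s \<sigma> :: real
  assumes [measurable]: "h \<in> borel_measurable borel" and c: "c \<noteq> 0" and cs: "c\<^sup>2 + s\<^sup>2 = 1"
  defines "g \<equiv> density lborel (\<lambda>x. ennreal (normal_density 0 \<sigma> x))"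
  shows "(\<integral>\<^sup>+a. (\<integral>\<^sup>+b. h (c * a + s * b, - s * a + c * b) \<partial>g) \<partial>g) = (\<integral>\<^sup>+a. (\<integral>\<^sup>+b. h (a, b) \<partial>g) \<partial>g)"
proof -
  define \<phi> where "\<phi> x = ennreal (normal_density 0 \<sigma> x)" for x
  have [measurable]: "\<phi> \<in> borel_measurable borel" unfolding \<phi>_def by measurable
  define H where "H x y = \<phi> x * \<phi> y * h (x, y)" for x y
  have [measurable]: "(\<lambda>x. H (u x) (v x)) \<in> borel_measurable L"
    if [measurable]: "u \<in> borel_measurable L" "v \<in> borel_measurable L" for u v and L :: "'c measure"
    unfolding H_def by measurable
  have sq: "(c * a + s * b)\<^sup>2 + (- s * a + c * b)\<^sup>2 = a\<^sup>2 + b\<^sup>2" for a b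
  proof -
    have "(c * a + s * b)\<^sup>2 + (- s * a + c * b)\<^sup>2 = (c\<^sup>2 + s\<^sup>2) * (a\<^sup>2 + b\<^sup>2)"
      by (simp add: power2_eq_square algebra_simps)
    then show ?thesis by (simp add: cs)
  qed
  have prod: "\<phi> x * \<phi> y = ennreal (exp (-(x\<^sup>2 + y\<^sup>2) / (2 * \<sigma>\<^sup>2)) / (2 * pi * \<sigma>\<^sup>2))" for x y
    unfolding \<phi>_def normal_density_def
    by (subst ennreal_mult[symmetric])
       (simp_all add: mult_exp_exp diff_divide_distrib)
  have \<phi>: "\<phi> (c * a + s * b) * \<phi> (- s * a + c * b) = \<phi> a * \<phi> b" for a b
    unfolding prod sq ..
  have L: "(\<integral>\<^sup>+a. (\<integral>\<^sup>+b. k a b \<partial>g) \<partial>g) = (\<integral>\<^sup>+a. (\<integral>\<^sup>+b. \<phi> a * \<phi> b * k a b \<partial>lborel) \<partial>lborel)"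
    if [measurable]: "(\<lambda>(a, b). k a b) \<in> borel_measurable (borel \<Otimes>\<^sub>M borel)" for k
  proof -
    have [measurable]: "(\<lambda>b. k a b) \<in> borel_measurable borel" for a
      using measurable_compose_Pair1[OF _ that, of a] by simp
    have [measurable]: "(\<lambda>a. \<integral>\<^sup>+b. \<phi> b * k a b \<partial>lborel) \<in> borel_measurable borel"
    proof (rule lborel.borel_measurable_nn_integral)
      have "(\<lambda>z. \<phi> (snd z) * (\<lambda>(a, b). k a b) z) \<in> borel_measurable (borel \<Otimes>\<^sub>M lborel)"
        by measurable
      then show "(\<lambda>(a, b). \<phi> b * k a b) \<in> borel_measurable (borel \<Otimes>\<^sub>M lborel)"
        by (simp add: case_prod_beta')
    qed
    have "(\<integral>\<^sup>+a. (\<integral>\<^sup>+b. k a b \<partial>g) \<partial>g) = (\<integral>\<^sup>+a. \<phi> a * (\<integral>\<^sup>+b. \<phi> b * k a b \<partial>lborel) \<partial>lborel)"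
      unfolding g_def \<phi>_def[symmetric] by (simp add: nn_integral_density)
    then show ?thesis by (simp add: nn_integral_cmult[symmetric] mult.assoc)
  qed
  have "ennreal \<bar>c\<bar> * (\<integral>\<^sup>+a. (\<integral>\<^sup>+b. h (c * a + s * b, - s * a + c * b) \<partial>g) \<partial>g) =
      (\<integral>\<^sup>+a. ennreal \<bar>c\<bar> * (\<integral>\<^sup>+b. H (c * a + s * b) (- s * a + c * b) \<partial>lborel) \<partial>lborel)"
    by (subst L) (simp_all add: H_def \<phi>[simplified] nn_integral_cmult)
  also have "\<dots> = (\<integral>\<^sup>+a. (\<integral>\<^sup>+y. H ((a + s * y) / c) y \<partial>lborel) \<partial>lborel)"
  proof (rule nn_integral_cong)
    fix a
    have "(a + s * (- s * a + c * b)) / c = c * a + s * b" for b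
    proof -
      have "a + s * (- s * a + c * b) = (1 - s\<^sup>2) * a + s * c * b"
        by (simp add: power2_eq_square algebra_simps)
      also have "1 - s\<^sup>2 = c\<^sup>2" using cs by simp
      finally show ?thesis using c by (simp add: power2_eq_square field_simps)
    qed
    then show "ennreal \<bar>c\<bar> * (\<integral>\<^sup>+b. H (c * a + s * b) (- s * a + c * b) \<partial>lborel) =
        (\<integral>\<^sup>+y. H ((a + s * y) / c) y \<partial>lborel)"
      by (subst nn_integral_real_affine[where t = "- s * a", OF _ c]) simp_all
  qed
  also have "\<dots> = (\<integral>\<^sup>+y. (\<integral>\<^sup>+a. H ((a + s * y) / c) y \<partial>lborel) \<partial>lborel)"
    by (rule lborel_pair.Fubini'[symmetric]) (simp add: case_prod_beta)
  also have "\<dots> = (\<integral>\<^sup>+y. ennreal \<bar>c\<bar> * (\<integral>\<^sup>+x. H x y \<partial>lborel) \<partial>lborel)"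
  proof (rule nn_integral_cong)
    fix y
    show "(\<integral>\<^sup>+a. H ((a + s * y) / c) y \<partial>lborel) = ennreal \<bar>c\<bar> * (\<integral>\<^sup>+x. H x y \<partial>lborel)"
      by (subst nn_integral_real_affine[where t = "- s * y", OF _ c]) (use c in simp_all)
  qed
  also have "\<dots> = ennreal \<bar>c\<bar> * (\<integral>\<^sup>+y. (\<integral>\<^sup>+x. H x y \<partial>lborel) \<partial>lborel)"
    by (rule nn_integral_cmult) (rule lborel.borel_measurable_nn_integral, simp add: case_prod_beta)
  also have "(\<integral>\<^sup>+y. (\<integral>\<^sup>+x. H x y \<partial>lborel) \<partial>lborel) = (\<integral>\<^sup>+x. (\<integral>\<^sup>+y. H x y \<partial>lborel) \<partial>lborel)"
    by (rule lborel_pair.Fubini') (simp add: case_prod_beta)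
  also have "\<dots> = (\<integral>\<^sup>+a. (\<integral>\<^sup>+b. h (a, b) \<partial>g) \<partial>g)"
    using L[of "\<lambda>a b. h (a, b)"] by (simp add: H_def[abs_def] borel_prod)
  finally show ?thesis
    using c by (simp add: ennreal_mult_cancel_left)
qed

text \<open>The pairs \<open>(x i, y i)\<close> rotate separately, so one coordinate is handled by
  the planar case and the others by induction on the index set.\<close>

lemma nn_integral_PiM_rotation:
  fixes c s \<sigma> :: real and I :: "'i set"
  assumes c: "c \<noteq> 0" and cs: "c\<^sup>2 + s\<^sup>2 = 1" and \<sigma>: "\<sigma> > 0"
  defines "g \<equiv> density lborel (\<lambda>x. ennreal (normal_density 0 \<sigma> x))"
  assumes "finite I" and "h \<in> borel_measurable (PiM I (\<lambda>_. g) \<Otimes>\<^sub>M PiM I (\<lambda>_. g))"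
  shows "(\<integral>\<^sup>+x. (\<integral>\<^sup>+y. h (\<lambda>i\<in>I. c * x i + s * y i, \<lambda>i\<in>I. - s * x i + c * y i) \<partial>PiM I (\<lambda>_. g)) \<partial>PiM I (\<lambda>_. g))
    = (\<integral>\<^sup>+x. (\<integral>\<^sup>+y. h (x, y) \<partial>PiM I (\<lambda>_. g)) \<partial>PiM I (\<lambda>_. g))"
proof -
  interpret g: prob_space g unfolding g_def using \<sigma> by (rule prob_space_normal_density)
  interpret G: product_sigma_finite "\<lambda>_::'i. g" ..
  have [measurable_cong]: "sets g = sets borel" by (simp add: g_def)
  \<comment> \<open>Tonelli: both copies of the new coordinate are moved innermost, where the planar
    rotation can act on them.\<close>
  have ins: "(\<integral>\<^sup>+x. (\<integral>\<^sup>+y. k (x, y) \<partial>PiM (insert i J) (\<lambda>_. g)) \<partial>PiM (insert i J) (\<lambda>_. g)) =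
      (\<integral>\<^sup>+x. (\<integral>\<^sup>+y. (\<integral>\<^sup>+a. (\<integral>\<^sup>+b. k (x(i := a), y(i := b)) \<partial>g) \<partial>g) \<partial>PiM J (\<lambda>_. g)) \<partial>PiM J (\<lambda>_. g))"
    if J: "finite J" "i \<notin> J"
      and [measurable]: "k \<in> borel_measurable (PiM (insert i J) (\<lambda>_. g) \<Otimes>\<^sub>M PiM (insert i J) (\<lambda>_. g))"
    for k :: "('i \<Rightarrow> real) \<times> ('i \<Rightarrow> real) \<Rightarrow> ennreal" and i J
  proof -
    interpret S: sigma_finite_measure "PiM (insert i J) (\<lambda>_. g)" using J by (intro G.sigma_finite) auto
    interpret S': sigma_finite_measure "PiM J (\<lambda>_. g)" using J by (intro G.sigma_finite) auto
    interpret G2: pair_sigma_finite g "PiM J (\<lambda>_. g)" ..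
    have "(\<integral>\<^sup>+x. (\<integral>\<^sup>+y. k (x, y) \<partial>PiM (insert i J) (\<lambda>_. g)) \<partial>PiM (insert i J) (\<lambda>_. g)) =
      (\<integral>\<^sup>+x. (\<integral>\<^sup>+a. (\<integral>\<^sup>+y. k (x(i := a), y) \<partial>PiM (insert i J) (\<lambda>_. g)) \<partial>g) \<partial>PiM J (\<lambda>_. g))"
      using J by (intro G.product_nn_integral_insert) measurable
    also have "\<dots> = (\<integral>\<^sup>+x. (\<integral>\<^sup>+a. (\<integral>\<^sup>+y. (\<integral>\<^sup>+b. k (x(i := a), y(i := b)) \<partial>g) \<partial>PiM J (\<lambda>_. g)) \<partial>g) \<partial>PiM J (\<lambda>_. g))"
    proof (intro nn_integral_cong G.product_nn_integral_insert J)
      fix x a assume [measurable]: "x \<in> space (PiM J (\<lambda>_. g))" "a \<in> space g"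
      have [measurable]: "x(i := a) \<in> space (PiM (insert i J) (\<lambda>_. g))"
        using \<open>x \<in> _\<close> \<open>a \<in> _\<close> by (auto simp: space_PiM PiE_def extensional_def)
      show "(\<lambda>y. k (x(i := a), y)) \<in> borel_measurable (PiM (insert i J) (\<lambda>_. g))"
        by measurable
    qed
    also have "\<dots> = (\<integral>\<^sup>+x. (\<integral>\<^sup>+y. (\<integral>\<^sup>+a. (\<integral>\<^sup>+b. k (x(i := a), y(i := b)) \<partial>g) \<partial>g) \<partial>PiM J (\<lambda>_. g)) \<partial>PiM J (\<lambda>_. g))"
    proof (rule nn_integral_cong, rule G2.Fubini'[symmetric])
      fix x assume [measurable]: "x \<in> space (PiM J (\<lambda>_. g))"
      show "(\<lambda>(a, y). \<integral>\<^sup>+b. k (x(i := a), y(i := b)) \<partial>g) \<in> borel_measurable (g \<Otimes>\<^sub>M PiM J (\<lambda>_. g))"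
        by measurable
    qed
    finally show ?thesis .
  qed
  from \<open>finite I\<close> \<open>h \<in> _\<close> show ?thesis
  proof (induction I arbitrary: h)
    case empty
    show ?case
    proof (intro nn_integral_cong)
      fix x y assume "x \<in> space (PiM {} (\<lambda>_::'i. g))" "y \<in> space (PiM {} (\<lambda>_::'i. g))"
      then have "x = (\<lambda>_. undefined)" "y = (\<lambda>_. undefined)" by (auto simp: space_PiM)
      then show "h (\<lambda>i\<in>{}. c * x i + s * y i, \<lambda>i\<in>{}. - s * x i + c * y i) = h (x, y)"
        by (simp add: restrict_def)
    qed
  next
    case (insert i I)
    note hm [measurable] = insert.prems
    interpret S: sigma_finite_measure "PiM I (\<lambda>_. g)" using insert by (intro G.sigma_finite) auto
    let ?r = "\<lambda>J x y. (\<lambda>i\<in>J. c * x i + s * y i, \<lambda>i\<in>J. - s * x i + c * y i)"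
    have upd: "?r (insert i I) (x(i := a)) (y(i := b)) =
       ((\<lambda>i\<in>I. c * x i + s * y i)(i := c * a + s * b), (\<lambda>i\<in>I. - s * x i + c * y i)(i := - s * a + c * b))"
      for x y :: "'i \<Rightarrow> real" and a b
      using insert.hyps by (auto simp: fun_eq_iff restrict_def)
    have "(\<integral>\<^sup>+x. (\<integral>\<^sup>+y. h (?r (insert i I) x y) \<partial>PiM (insert i I) (\<lambda>_. g)) \<partial>PiM (insert i I) (\<lambda>_. g)) =
       (\<integral>\<^sup>+x. (\<integral>\<^sup>+y. (\<lambda>z. h (?r (insert i I) (fst z) (snd z))) (x, y) \<partial>PiM (insert i I) (\<lambda>_. g)) \<partial>PiM (insert i I) (\<lambda>_. g))"
      by simp
    also have "\<dots> = (\<integral>\<^sup>+x. (\<integral>\<^sup>+y. (\<integral>\<^sup>+a. (\<integral>\<^sup>+b. h (?r (insert i I) (x(i := a)) (y(i := b))) \<partial>g) \<partial>g) \<partial>PiM I (\<lambda>_. g)) \<partial>PiM I (\<lambda>_. g))"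
      by (subst ins) (use insert.hyps in \<open>simp_all\<close>)
    also have "\<dots> = (\<integral>\<^sup>+x. (\<integral>\<^sup>+y. (\<integral>\<^sup>+a. (\<integral>\<^sup>+b. h ((\<lambda>i\<in>I. c * x i + s * y i)(i := a), (\<lambda>i\<in>I. - s * x i + c * y i)(i := b)) \<partial>g) \<partial>g) \<partial>PiM I (\<lambda>_. g)) \<partial>PiM I (\<lambda>_. g))"
    proof (rule nn_integral_cong, rule nn_integral_cong)
      fix x y assume "x \<in> space (PiM I (\<lambda>_. g))" "y \<in> space (PiM I (\<lambda>_. g))"
      have [measurable]: "(\<lambda>i\<in>I. c * x i + s * y i) \<in> space (PiM I (\<lambda>_. g))"
        "(\<lambda>i\<in>I. - s * x i + c * y i) \<in> space (PiM I (\<lambda>_. g))"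
        by (auto simp: space_PiM g_def)
      define k where "k z = h ((\<lambda>i\<in>I. c * x i + s * y i)(i := fst z), (\<lambda>i\<in>I. - s * x i + c * y i)(i := snd z))" for z
      have "k \<in> borel_measurable (borel \<Otimes>\<^sub>M borel)" unfolding k_def by measurable
      then have "k \<in> borel_measurable borel" by (simp add: borel_prod)
      from nn_integral_gauss_rotation[OF this c cs, of \<sigma>]
      show "(\<integral>\<^sup>+a. (\<integral>\<^sup>+b. h (?r (insert i I) (x(i := a)) (y(i := b))) \<partial>g) \<partial>g) =
         (\<integral>\<^sup>+a. (\<integral>\<^sup>+b. h ((\<lambda>i\<in>I. c * x i + s * y i)(i := a), (\<lambda>i\<in>I. - s * x i + c * y i)(i := b)) \<partial>g) \<partial>g)"
        unfolding upd k_def g_def[symmetric] by simp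
    qed
    also have "\<dots> = (\<integral>\<^sup>+x. (\<integral>\<^sup>+y. (\<integral>\<^sup>+a. (\<integral>\<^sup>+b. h (x(i := a), y(i := b)) \<partial>g) \<partial>g) \<partial>PiM I (\<lambda>_. g)) \<partial>PiM I (\<lambda>_. g))"
    proof -
      \<comment> \<open>With the new coordinate integrated out, the induction hypothesis applies to
        a function of the old ones.\<close>
      define k where "k z = (\<integral>\<^sup>+a. (\<integral>\<^sup>+b. h ((fst z)(i := a), (snd z)(i := b)) \<partial>g) \<partial>g)" for z
      have "k \<in> borel_measurable (PiM I (\<lambda>_. g) \<Otimes>\<^sub>M PiM I (\<lambda>_. g))"
        unfolding k_def by measurable
      from insert.IH[OF this] show ?thesis unfolding k_def fst_conv snd_conv .
    qed
    also have "\<dots> = (\<integral>\<^sup>+x. (\<integral>\<^sup>+y. h (x, y) \<partial>PiM (insert i I) (\<lambda>_. g)) \<partial>PiM (insert i I) (\<lambda>_. g))"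
      using insert.hyps by (intro ins[symmetric]) auto
    finally show ?case .
  qed
qed

subsection \<open>Brownian paths and their discretization\<close>

text \<open>The norm of \<open>X\<close> as a seminorm of the driving path. Integration is linear,
  so rotating two copies of \<open>X\<close> amounts to rotating their paths.\<close>

definition int_norm :: "real \<Rightarrow> nat \<Rightarrow> (real \<Rightarrow> real) \<Rightarrow> real" where
  "int_norm p m w = Lp_norm01 p (iter_int m w)"

lemma int_norm_measurable:
  assumes "(\<lambda>(s, x). w s x) \<in> borel_measurable (borel \<Otimes>\<^sub>M N)"
  shows "(\<lambda>x. int_norm p m (\<lambda>s. w s x)) \<in> borel_measurable N"
proof -
  have "(\<lambda>z. iter_int m (\<lambda>s. w s (snd z)) (fst z)) \<in> borel_measurable (borel \<Otimes>\<^sub>M N)"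
    by (rule iter_int_measurable[OF assms]) measurable
  then show ?thesis unfolding int_norm_def by (intro Lp_norm01_measurable) (simp add: case_prod_beta')
qed

lemma int_norm_tendsto:
  assumes "1 \<le> p" and w: "\<And>N. w N \<in> borel_measurable borel" "\<And>N t. \<bar>w N t\<bar> \<le> B"
    and "\<And>t. t \<in> {0..1} \<Longrightarrow> (\<lambda>N. w N t) \<longlonglongrightarrow> v t" "bdd_borel v"
  shows "(\<lambda>N. int_norm p m (w N)) \<longlonglongrightarrow> int_norm p m v"
  unfolding int_norm_def
proof (rule Lp_norm01_tendsto[where B = B])
  have bw: "bdd_borel (w N)" for N using w by (intro bdd_borelI)
  show "iter_int m (w N) \<in> borel_measurable borel" for N
    by (intro bdd_borel_measurable bdd_borel_iter_int bw)
  show "\<bar>iter_int m (w N) t\<bar> \<le> B" for N t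
    by (rule iter_int_bound[OF bw w(2)])
  show "iter_int m v \<in> borel_measurable borel"
    by (intro bdd_borel_measurable bdd_borel_iter_int assms)
  show "(\<lambda>N. iter_int m (w N) t) \<longlonglongrightarrow> iter_int m v t" if "t \<in> {0..1}" for t
    using w assms(4) bdd_borel_measurable[OF assms(5)] that by (rule iter_int_tendsto)
qed (rule assms)

text \<open>Jumps \<open>x j\<close> at the right ends of the cells. If they are the increments of a
  path started at 0, this is the path sampled at the last grid point before \<open>s\<close>. It is
  linear in the jumps, so a rotation of Gaussian vectors becomes one of step functions.\<close>

definition step_fn :: "nat \<Rightarrow> (nat \<Rightarrow> real) \<Rightarrow> real \<Rightarrow> real" where
  "step_fn N x s = (\<Sum>j<N. x j * (if real (Suc j) / real N \<le> s then 1 else 0))"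

lemma step_fn_measurable:
  assumes [measurable]: "\<And>j. j < N \<Longrightarrow> (\<lambda>x. f x j) \<in> borel_measurable L"
  shows "(\<lambda>(s, x). step_fn N (f x) s) \<in> borel_measurable (borel \<Otimes>\<^sub>M L)"
proof -
  have "(\<lambda>z. f (snd z) j) \<in> borel_measurable (borel \<Otimes>\<^sub>M L)" if "j < N" for j
    using measurable_compose[OF measurable_snd assms[OF that]] .
  then have "(\<lambda>z. \<Sum>j<N. f (snd z) j * (if real (Suc j) / real N \<le> fst z then 1 else 0)) \<in> borel_measurable (borel \<Otimes>\<^sub>M L)"
    by (intro borel_measurable_sum borel_measurable_times) auto
  then show ?thesis by (simp add: step_fn_def case_prod_beta')
qed

lemma step_fn_lincomb:
  "step_fn N (\<lambda>j\<in>{..<N}. a * x j + b * y j) s = a * step_fn N x s + b * step_fn N y s"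
  unfolding step_fn_def sum_distrib_left sum.distrib[symmetric]
  by (intro sum.cong) (auto simp: algebra_simps)

lemma bdd_borel_step_fn: "bdd_borel (step_fn N x)"
proof (rule bdd_borelI)
  show "step_fn N x \<in> borel_measurable borel" unfolding step_fn_def[abs_def] by measurable
  show "\<bar>step_fn N x t\<bar> \<le> (\<Sum>j<N. \<bar>x j\<bar>)" for t
    unfolding step_fn_def by (rule order_trans[OF sum_abs]) (intro sum_mono, auto)
qed

definition clamp01 :: "real \<Rightarrow> real" where "clamp01 s = max 0 (min 1 s)"

lemma clamp01 [simp]: "0 \<le> clamp01 s" "clamp01 s \<le> 1"
  by (auto simp: clamp01_def)

lemma clamp01_id: "s \<in> {0..1} \<Longrightarrow> clamp01 s = s"
  by (auto simp: clamp01_def)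

lemma clamp01_measurable [measurable]: "clamp01 \<in> borel_measurable borel"
  unfolding clamp01_def[abs_def] by measurable

lemma step_fn_telescope:
  assumes N: "N > 0"
  shows "step_fn N (\<lambda>j\<in>{..<N}. f (real (Suc j) / real N) - f (real j / real N)) s =
    f (real_of_int \<lfloor>real N * clamp01 s\<rfloor> / real N) - f 0"
proof -
  define k where "k = nat \<lfloor>real N * clamp01 s\<rfloor>"
  have k: "real_of_int \<lfloor>real N * clamp01 s\<rfloor> = real k" by (simp add: k_def)
  have "real N * clamp01 s \<le> real N * 1" by (intro mult_left_mono) auto
  then have kN: "k \<le> N" by (simp add: k_def floor_le_iff nat_le_iff)
  have iff: "real (Suc j) / real N \<le> s \<longleftrightarrow> j < k" if "j < N" for j
  proof -
    \<comment> \<open>The threshold lies in (0, 1], hence clamping \<open>s\<close> to the unit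
      interval does not change the comparison.\<close>
    have "real (Suc j) / real N \<le> s \<longleftrightarrow> real (Suc j) / real N \<le> clamp01 s"
    proof -
      have "0 < real (Suc j) / real N" "real (Suc j) / real N \<le> 1" using that by (auto simp: field_simps)
      then show ?thesis unfolding clamp01_def by linarith
    qed
    also have "\<dots> \<longleftrightarrow> real (Suc j) \<le> real N * clamp01 s"
      using N by (simp add: field_simps)
    also have "\<dots> \<longleftrightarrow> int (Suc j) \<le> \<lfloor>real N * clamp01 s\<rfloor>" by (simp add: le_floor_iff)
    also have "\<dots> \<longleftrightarrow> j < k" by (auto simp: k_def)
    finally show ?thesis .
  qed
  have "step_fn N (\<lambda>j\<in>{..<N}. f (real (Suc j) / real N) - f (real j / real N)) s =
    (\<Sum>j<N. if j < k then f (real (Suc j) / real N) - f (real j / real N) else 0)"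
    unfolding step_fn_def by (intro sum.cong refl) (simp add: iff del: of_nat_Suc)
  also have "\<dots> = (\<Sum>j<k. f (real (Suc j) / real N) - f (real j / real N))"
    using kN by (intro sum.mono_neutral_cong_right) auto
  also have "\<dots> = f (real k / real N) - f 0"
    using sum_lessThan_telescope[of "\<lambda>j. f (real j / real N)" k] by simp
  finally show ?thesis unfolding k .
qed

lemma floor_grid_tendsto: "(\<lambda>N. real_of_int \<lfloor>real (Suc N) * s\<rfloor> / real (Suc N)) \<longlonglongrightarrow> s"
proof (rule tendsto_sandwich)
  show "\<forall>\<^sub>F N in sequentially. s - 1 / real (Suc N) \<le> real_of_int \<lfloor>real (Suc N) * s\<rfloor> / real (Suc N)"
  proof (rule always_eventually, rule allI)
    fix N
    have "(real (Suc N) * s - 1) / real (Suc N) \<le> real_of_int \<lfloor>real (Suc N) * s\<rfloor> / real (Suc N)"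
      by (intro divide_right_mono) linarith+
    then show "s - 1 / real (Suc N) \<le> real_of_int \<lfloor>real (Suc N) * s\<rfloor> / real (Suc N)"
      by (simp add: diff_divide_distrib)
  qed
  show "\<forall>\<^sub>F N in sequentially. real_of_int \<lfloor>real (Suc N) * s\<rfloor> / real (Suc N) \<le> s"
    by (rule always_eventually) (auto simp: divide_le_eq mult.commute)
  have "(\<lambda>N. s - 1 / real (Suc N)) \<longlonglongrightarrow> s - 0"
    by (intro tendsto_diff tendsto_const LIMSEQ_Suc lim_1_over_n)
  then show "(\<lambda>N. s - 1 / real (Suc N)) \<longlonglongrightarrow> s" by simp
qed simp

locale brownian =
  fixes M :: "'a measure" and W :: "real \<Rightarrow> 'a \<Rightarrow> real"
  assumes bm: "std_brownian_motion M W"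
begin

sublocale prob_space M
  using bm by (simp add: std_brownian_motion_def)

sublocale pair: pair_prob_space M M ..

text \<open>Clamping the time avoids \<open>W t\<close> for negative \<open>t\<close>, about which nothing is assumed.\<close>

definition path01 :: "'a \<Rightarrow> real \<Rightarrow> real" where
  "path01 \<omega> s = W (clamp01 s) \<omega>"

lemma W_measurable: "t \<ge> 0 \<Longrightarrow> W t \<in> borel_measurable M"
  using bm by (simp add: std_brownian_motion_def)

lemma path01_0: "\<omega> \<in> space M \<Longrightarrow> path01 \<omega> 0 = 0"
  using bm by (simp add: std_brownian_motion_def path01_def clamp01_def)

lemma continuous_path01:
  assumes "\<omega> \<in> space M"
  shows "continuous_on UNIV (path01 \<omega>)"
proof -
  have "continuous_on {0..} (\<lambda>t. W t \<omega>)" using bm assms by (simp add: std_brownian_motion_def)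
  then show ?thesis unfolding path01_def[abs_def]
    by (rule continuous_on_compose2) (auto simp: clamp01_def intro!: continuous_intros)
qed

lemma bdd_borel_path01:
  assumes "\<omega> \<in> space M"
  shows "bdd_borel (path01 \<omega>)"
proof -
  have "compact (path01 \<omega> ` {0..1})"
    using continuous_path01[OF assms] by (intro compact_continuous_image) (auto intro: continuous_on_subset)
  then have "bounded (path01 \<omega> ` {0..1})" by (rule compact_imp_bounded)
  then obtain B where "\<forall>x\<in>path01 \<omega> ` {0..1}. norm x \<le> B" unfolding bounded_iff ..
  then have B: "\<bar>path01 \<omega> s\<bar> \<le> B" if "s \<in> {0..1}" for s using that by simp
  have "path01 \<omega> s = path01 \<omega> (clamp01 s)" for s by (simp add: path01_def clamp01_def)
  then have "\<bar>path01 \<omega> s\<bar> \<le> B" for s using B[of "clamp01 s"] by simp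
  then show ?thesis
    using continuous_path01[OF assms] by (intro bdd_borelI[of _ B] borel_measurable_continuous_onI)
qed

lemma path01_grid_tendsto:
  assumes "\<omega> \<in> space M" "s \<in> {0..1}"
  shows "(\<lambda>N. path01 \<omega> (real_of_int \<lfloor>real (Suc N) * clamp01 s\<rfloor> / real (Suc N))) \<longlonglongrightarrow> path01 \<omega> s"
  using continuous_on_tendsto_compose[OF continuous_path01[OF assms(1)] floor_grid_tendsto[of s]]
  by (simp add: clamp01_id[OF assms(2)])

text \<open>A function continuous in \<open>s\<close> and measurable in \<omega> is jointly
  measurable, being the limit of its samples on finer and finer grids. The applications of Fubini to
  the path rest on this.\<close>

lemma path01_measurable: "(\<lambda>(s, \<omega>). path01 \<omega> s) \<in> borel_measurable (borel \<Otimes>\<^sub>M M)"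
proof (rule borel_measurable_LIMSEQ_real)
  show "(\<lambda>N. (\<lambda>z. path01 (snd z) (real_of_int \<lfloor>real (Suc N) * clamp01 (fst z)\<rfloor> / real (Suc N))) z) \<longlonglongrightarrow> (case z of (s, \<omega>) \<Rightarrow> path01 \<omega> s)"
    if "z \<in> space (borel \<Otimes>\<^sub>M M)" for z
  proof -
    have "snd z \<in> space M" using that by (auto simp: space_pair_measure)
    from continuous_on_tendsto_compose[OF continuous_path01[OF this] floor_grid_tendsto[of "clamp01 (fst z)"]]
    show ?thesis by (simp add: case_prod_beta path01_def clamp01_def)
  qed
  \<comment> \<open>The sampling time takes countably many values, and at each of them the path is a
    single random variable.\<close>
  show "(\<lambda>z. path01 (snd z) (real_of_int \<lfloor>real (Suc N) * clamp01 (fst z)\<rfloor> / real (Suc N))) \<in> borel_measurable (borel \<Otimes>\<^sub>M M)" for N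
  proof (rule measurable_compose_countable[where f = "\<lambda>i z. path01 (snd z) (real_of_int i / real (Suc N))"])
    show "(\<lambda>z. path01 (snd z) (real_of_int i / real (Suc N))) \<in> borel_measurable (borel \<Otimes>\<^sub>M M)" for i
      unfolding path01_def by (rule measurable_compose[OF measurable_snd W_measurable]) simp
    show "(\<lambda>z. \<lfloor>real (Suc N) * clamp01 (fst z)\<rfloor>) \<in> measurable (borel \<Otimes>\<^sub>M M) (count_space UNIV)"
      by measurable
  qed
qed

lemma X_proc_eq:
  assumes "1 \<le> m" "t \<in> {0..1}" "\<omega> \<in> space M"
  shows "X_proc m W t \<omega> = iter_int m (path01 \<omega>) t"
proof -
  obtain i where i: "m = Suc i" using assms by (cases m) auto
  have [measurable]: "path01 \<omega> \<in> borel_measurable borel" by (intro bdd_borel_measurable bdd_borel_path01 assms)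
  have "iter_int m (path01 \<omega>) t = (LINT s:{0..1}|lborel. kern i t s * path01 \<omega> s)"
    unfolding i iter_int_Suc by (rule integral_U01) measurable
  also have "\<dots> = X_proc m W t \<omega>"
    unfolding X_proc_def set_lebesgue_integral_def using assms(2)
    by (intro Bochner_Integration.integral_cong)
       (auto simp: kern_def i path01_def clamp01_def split: split_indicator)
  finally show ?thesis by simp
qed

lemma Lp_norm01_X_proc:
  assumes "1 \<le> m" "\<omega> \<in> space M"
  shows "Lp_norm01 p (\<lambda>t. X_proc m W t \<omega>) = int_norm p m (path01 \<omega>)"
proof -
  have "(LINT t:{0..1}|lborel. \<bar>X_proc m W t \<omega>\<bar> powr p) = (LINT t:{0..1}|lborel. \<bar>iter_int m (path01 \<omega>) t\<bar> powr p)"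
    using assms by (intro set_lebesgue_integral_cong) (auto simp: X_proc_eq)
  then show ?thesis by (simp add: int_norm_def Lp_norm01_def)
qed

definition incrs :: "nat \<Rightarrow> 'a \<Rightarrow> nat \<Rightarrow> real" where
  "incrs N \<omega> = (\<lambda>j\<in>{..<N}. W (real (Suc j) / real N) \<omega> - W (real j / real N) \<omega>)"

lemma step_fn_incrs:
  assumes "N > 0" "\<omega> \<in> space M"
  shows "step_fn N (incrs N \<omega>) s = path01 \<omega> (real_of_int \<lfloor>real N * clamp01 s\<rfloor> / real N)"
proof -
  have "incrs N \<omega> = (\<lambda>j\<in>{..<N}. path01 \<omega> (real (Suc j) / real N) - path01 \<omega> (real j / real N))"
    unfolding incrs_def path01_def using assms(1) by (intro restrict_ext) (simp add: clamp01_id)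
  then show ?thesis using step_fn_telescope[OF assms(1), of "path01 \<omega>" s] path01_0[OF assms(2)] by simp
qed

text \<open>Samples of a path obey the bound of the path, so one constant dominates all the step
  functions and their norms converge.\<close>

lemma int_norm_grid_tendsto:
  assumes "1 \<le> p" "\<omega> \<in> space M" "\<omega>' \<in> space M"
  shows "(\<lambda>N. int_norm p m (\<lambda>s. a * step_fn (Suc N) (incrs (Suc N) \<omega>) s + b * step_fn (Suc N) (incrs (Suc N) \<omega>') s))
    \<longlonglongrightarrow> int_norm p m (\<lambda>s. a * path01 \<omega> s + b * path01 \<omega>' s)"
proof -
  have "bdd_borel (\<lambda>s. a * path01 \<omega> s + b * path01 \<omega>' s)" by (intro bdd_borel_lincomb bdd_borel_path01 assms)
  obtain B where B: "\<And>s. \<bar>path01 \<omega> s\<bar> \<le> B" "B > 0" using bdd_borel_path01[OF assms(2)] by (meson bdd_borelE)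
  obtain C where C: "\<And>s. \<bar>path01 \<omega>' s\<bar> \<le> C" "C > 0" using bdd_borel_path01[OF assms(3)] by (meson bdd_borelE)
  show ?thesis
  proof (rule int_norm_tendsto[OF assms(1), where B = "\<bar>a\<bar> * B + \<bar>b\<bar> * C"])
    show "(\<lambda>s. a * step_fn (Suc N) (incrs (Suc N) \<omega>) s + b * step_fn (Suc N) (incrs (Suc N) \<omega>') s) \<in> borel_measurable borel" for N
      by (intro bdd_borel_measurable bdd_borel_lincomb bdd_borel_step_fn)
    show "\<bar>a * step_fn (Suc N) (incrs (Suc N) \<omega>) s + b * step_fn (Suc N) (incrs (Suc N) \<omega>') s\<bar> \<le> \<bar>a\<bar> * B + \<bar>b\<bar> * C" for N s
    proof -
      have "\<bar>a * step_fn (Suc N) (incrs (Suc N) \<omega>) s + b * step_fn (Suc N) (incrs (Suc N) \<omega>') s\<bar>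
        \<le> \<bar>a\<bar> * \<bar>step_fn (Suc N) (incrs (Suc N) \<omega>) s\<bar> + \<bar>b\<bar> * \<bar>step_fn (Suc N) (incrs (Suc N) \<omega>') s\<bar>"
        by (metis abs_mult abs_triangle_ineq)
      also have "\<dots> \<le> \<bar>a\<bar> * B + \<bar>b\<bar> * C"
        using assms by (intro add_mono mult_left_mono) (auto simp: step_fn_incrs B C)
      finally show ?thesis .
    qed
    show "(\<lambda>N. a * step_fn (Suc N) (incrs (Suc N) \<omega>) s + b * step_fn (Suc N) (incrs (Suc N) \<omega>') s) \<longlonglongrightarrow> a * path01 \<omega> s + b * path01 \<omega>' s"
      if "s \<in> {0..1}" for s
      using assms by (intro tendsto_add tendsto_mult tendsto_const)
        (simp_all only: step_fn_incrs zero_less_Suc path01_grid_tendsto[OF _ that])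
  qed (fact)
qed

lemma indep_incrs:
  assumes "N > 0"
  shows "indep_vars (\<lambda>_. borel) (\<lambda>j \<omega>. W (real (Suc j) / real N) \<omega> - W (real j / real N) \<omega>) {..<N}"
proof -
  have "\<forall>i<N. real i / real N \<le> real (Suc i) / real N"
    by (intro allI impI divide_right_mono) auto
  then have "0 \<le> real 0 / real N \<and> (\<forall>i<N. real i / real N \<le> real (Suc i) / real N)" by simp
  moreover have "\<forall>(n::nat) (\<tau>::nat \<Rightarrow> real). 0 \<le> \<tau> 0 \<and> (\<forall>i<n. \<tau> i \<le> \<tau> (Suc i)) \<longrightarrow>
        indep_vars (\<lambda>_. borel) (\<lambda>i \<omega>. W (\<tau> (Suc i)) \<omega> - W (\<tau> i) \<omega>) {..<n}"
    using bm unfolding std_brownian_motion_def by (elim conjE)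
  ultimately show ?thesis by (elim allE[of _ N] allE[of _ "\<lambda>j. real j / real N"] impE)
qed

lemma distributed_incrs:
  assumes "0 \<le> s" "s < t"
  shows "distributed M lborel (\<lambda>\<omega>. W t \<omega> - W s \<omega>) (normal_density 0 (sqrt (t - s)))"
  using bm assms by (simp add: std_brownian_motion_def)

lemma distr_incrs:
  assumes "0 \<le> s" "s < t"
  shows "distr M borel (\<lambda>\<omega>. W t \<omega> - W s \<omega>) = density lborel (normal_density 0 (sqrt (t - s)))"
proof -
  have "distr M borel (\<lambda>\<omega>. W t \<omega> - W s \<omega>) = distr M lborel (\<lambda>\<omega>. W t \<omega> - W s \<omega>)"
    by (rule distr_cong) auto
  then show ?thesis using distributed_distr_eq_density[OF distributed_incrs[OF assms]] by simp
qed

lemma incrs_measurable [measurable]: "incrs N \<in> measurable M (PiM {..<N} (\<lambda>_. borel))"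
  unfolding incrs_def by (intro measurable_restrict borel_measurable_diff W_measurable) auto

lemma distr_incrs_PiM:
  assumes N: "N > 0"
  shows "distr M (PiM {..<N} (\<lambda>_. borel)) (incrs N) =
    PiM {..<N} (\<lambda>_. density lborel (normal_density 0 (sqrt (1 / real N))))"
proof -
  have "distr M (PiM {..<N} (\<lambda>_. borel)) (incrs N) =
    PiM {..<N} (\<lambda>j. distr M borel (\<lambda>\<omega>. W (real (Suc j) / real N) \<omega> - W (real j / real N) \<omega>))"
    unfolding incrs_def
    using N indep_incrs[OF N] by (subst (asm) indep_vars_iff_distr_eq_PiM')
       (auto intro!: borel_measurable_diff W_measurable)
  also have "\<dots> = PiM {..<N} (\<lambda>_. density lborel (normal_density 0 (sqrt (1 / real N))))"
  proof (rule PiM_cong[OF refl])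
    fix j
    have "real (Suc j) / real N - real j / real N = 1 / real N"
      by (simp add: diff_divide_distrib[symmetric])
    then show "distr M borel (\<lambda>\<omega>. W (real (Suc j) / real N) \<omega> - W (real j / real N) \<omega>) =
        density lborel (normal_density 0 (sqrt (1 / real N)))"
      using distr_incrs[of "real j / real N" "real (Suc j) / real N"] N by (simp add: divide_strict_right_mono)
  qed
  finally show ?thesis .
qed

lemma nn_integral_incrs_rotation:
  assumes N: "N > 0" and cs: "c \<noteq> 0" "c\<^sup>2 + s\<^sup>2 = 1"
    and [measurable]: "h \<in> borel_measurable (PiM {..<N} (\<lambda>_. borel) \<Otimes>\<^sub>M PiM {..<N} (\<lambda>_. borel))"
  shows "(\<integral>\<^sup>+z. h (\<lambda>i\<in>{..<N}. c * incrs N (fst z) i + s * incrs N (snd z) i,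
                    \<lambda>i\<in>{..<N}. - s * incrs N (fst z) i + c * incrs N (snd z) i) \<partial>(M \<Otimes>\<^sub>M M))
    = (\<integral>\<^sup>+z. h (incrs N (fst z), incrs N (snd z)) \<partial>(M \<Otimes>\<^sub>M M))"
proof -
  define g where "g = density lborel (\<lambda>x. ennreal (normal_density 0 (sqrt (1 / real N)) x))"
  let ?P = "PiM {..<N} (\<lambda>_. borel) :: (nat \<Rightarrow> real) measure"
  have [measurable_cong]: "sets (PiM {..<N} (\<lambda>_. g)) = sets ?P"
    by (rule sets_PiM_cong) (auto simp: g_def)
  interpret sg: sigma_finite_measure "PiM {..<N} (\<lambda>_. g)"
  proof -
    interpret g: prob_space g unfolding g_def using N by (intro prob_space_normal_density) auto
    interpret G: product_sigma_finite "\<lambda>_::nat. g" ..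
    show "sigma_finite_measure (PiM {..<N} (\<lambda>_. g))" by (intro G.sigma_finite) auto
  qed
  have law: "(\<integral>\<^sup>+z. k (incrs N (fst z), incrs N (snd z)) \<partial>(M \<Otimes>\<^sub>M M)) =
      (\<integral>\<^sup>+x. (\<integral>\<^sup>+y. k (x, y) \<partial>PiM {..<N} (\<lambda>_. g)) \<partial>PiM {..<N} (\<lambda>_. g))"
    if [measurable]: "k \<in> borel_measurable (?P \<Otimes>\<^sub>M ?P)" for k
  proof -
    have "(\<integral>\<^sup>+z. k (incrs N (fst z), incrs N (snd z)) \<partial>(M \<Otimes>\<^sub>M M)) =
        (\<integral>\<^sup>+\<omega>. (\<integral>\<^sup>+\<omega>'. k (incrs N \<omega>, incrs N \<omega>') \<partial>M) \<partial>M)"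
      by (subst nn_integral_fst[symmetric]) simp_all
    also have "\<dots> = (\<integral>\<^sup>+\<omega>. (\<integral>\<^sup>+y. k (incrs N \<omega>, y) \<partial>distr M ?P (incrs N)) \<partial>M)"
      by (intro nn_integral_cong, subst nn_integral_distr) auto
    also have "\<dots> = (\<integral>\<^sup>+\<omega>. (\<integral>\<^sup>+y. k (incrs N \<omega>, y) \<partial>PiM {..<N} (\<lambda>_. g)) \<partial>M)"
      unfolding distr_incrs_PiM[OF N] g_def ..
    also have "\<dots> = (\<integral>\<^sup>+x. (\<integral>\<^sup>+y. k (x, y) \<partial>PiM {..<N} (\<lambda>_. g)) \<partial>distr M ?P (incrs N))"
      by (subst nn_integral_distr) auto
    finally show ?thesis unfolding distr_incrs_PiM[OF N] g_def .
  qed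
  let ?r = "\<lambda>z::(nat \<Rightarrow> real) \<times> (nat \<Rightarrow> real). (\<lambda>i\<in>{..<N}. c * fst z i + s * snd z i, \<lambda>i\<in>{..<N}. - s * fst z i + c * snd z i)"
  have "?r \<in> measurable (?P \<Otimes>\<^sub>M ?P) (?P \<Otimes>\<^sub>M ?P)" by measurable
  then have "(\<lambda>z. h (?r z)) \<in> borel_measurable (?P \<Otimes>\<^sub>M ?P)"
    by (rule measurable_compose) measurable
  from law[OF this] law[OF assms(4)] show ?thesis
    using nn_integral_PiM_rotation[OF cs, of "sqrt (1 / real N)" "{..<N}" h] N
    by (simp add: g_def[symmetric])
qed

lemma int_norm_pair_measurable:
  "(\<lambda>z. int_norm p m (\<lambda>t. a * path01 (fst z) t + b * path01 (snd z) t)) \<in> borel_measurable (M \<Otimes>\<^sub>M M)"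
proof (rule int_norm_measurable)
  have "(\<lambda>y. path01 (fst (snd y)) (fst y)) \<in> borel_measurable (borel \<Otimes>\<^sub>M (M \<Otimes>\<^sub>M M))"
    using measurable_compose[OF _ path01_measurable, of "\<lambda>y. (fst y, fst (snd y))" "borel \<Otimes>\<^sub>M (M \<Otimes>\<^sub>M M)"] by simp
  moreover have "(\<lambda>y. path01 (snd (snd y)) (fst y)) \<in> borel_measurable (borel \<Otimes>\<^sub>M (M \<Otimes>\<^sub>M M))"
    using measurable_compose[OF _ path01_measurable, of "\<lambda>y. (fst y, snd (snd y))" "borel \<Otimes>\<^sub>M (M \<Otimes>\<^sub>M M)"] by simp
  ultimately show "(\<lambda>(t, z). a * path01 (fst z) t + b * path01 (snd z) t) \<in> borel_measurable (borel \<Otimes>\<^sub>M (M \<Otimes>\<^sub>M M))"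
    unfolding case_prod_beta' by measurable
qed

text \<open>With \<open>U = c X + s Y\<close> and \<open>V = - s X + c Y\<close> the second argument
  on the left is the norm of \<open>\<kappa> U + V\<close>; on the right \<open>U\<close>,
  \<open>V\<close> are replaced by \<open>X\<close>, \<open>Y\<close>. The identity is exact for
  sampled paths. Continuity of \<psi> carries it to the limit, and \<psi> \<le> 1 supplies the
  dominating function.\<close>

theorem rotation_invariance:
  fixes \<psi> :: "real \<Rightarrow> real \<Rightarrow> real"
  assumes p: "1 \<le> p" and cs: "c \<noteq> 0" "c\<^sup>2 + s\<^sup>2 = 1"
    and \<psi>: "continuous_on UNIV (\<lambda>(x, y). \<psi> x y)" "\<And>x y. \<psi> x y \<le> 1"
  shows "(\<integral>\<^sup>+z. \<psi> (int_norm p m (\<lambda>t. c * path01 (fst z) t + s * path01 (snd z) t))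
                 (int_norm p m (\<lambda>t. (\<kappa> * c - s) * path01 (fst z) t + (\<kappa> * s + c) * path01 (snd z) t)) \<partial>(M \<Otimes>\<^sub>M M))
    = (\<integral>\<^sup>+z. \<psi> (int_norm p m (path01 (fst z))) (int_norm p m (\<lambda>t. \<kappa> * path01 (fst z) t + path01 (snd z) t)) \<partial>(M \<Otimes>\<^sub>M M))"
proof -
  define S where "S N \<omega> = step_fn (Suc N) (incrs (Suc N) \<omega>)" for N \<omega>
  define F where "F a b a' b' z = ennreal (\<psi> (int_norm p m (\<lambda>t. a * path01 (fst z) t + b * path01 (snd z) t))
      (int_norm p m (\<lambda>t. a' * path01 (fst z) t + b' * path01 (snd z) t)))" for a b a' b' z
  define FN where "FN a b a' b' N z = ennreal (\<psi> (int_norm p m (\<lambda>t. a * S N (fst z) t + b * S N (snd z) t))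
      (int_norm p m (\<lambda>t. a' * S N (fst z) t + b' * S N (snd z) t)))" for a b a' b' N z
  have [measurable]: "(\<lambda>x. \<psi> (f x) (g x)) \<in> borel_measurable L"
    if "f \<in> borel_measurable L" "g \<in> borel_measurable L" for f g and L :: "'c measure"
  proof -
    have "continuous_on UNIV (\<lambda>x. \<psi> (fst x) (snd x))" using \<psi>(1) by (simp add: case_prod_beta')
    from borel_measurable_continuous_Pair[OF that this] show ?thesis .
  qed
  have S_meas: "(\<lambda>(t, z). S N (f z) t) \<in> borel_measurable (borel \<Otimes>\<^sub>M L)"
    if "f \<in> measurable L M" for f N and L :: "'c measure"
    unfolding S_def using that
    by (intro step_fn_measurable) (auto intro!: measurable_compose[OF that] measurable_compose[OF incrs_measurable measurable_component_singleton])
  have nS: "(\<lambda>z. int_norm p m (\<lambda>t. a * S N (fst z) t + b * S N (snd z) t)) \<in> borel_measurable (M \<Otimes>\<^sub>M M)" for a b N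
    using S_meas[OF measurable_fst, of N M] S_meas[OF measurable_snd, of N M]
    by (intro int_norm_measurable) (auto simp: case_prod_beta' intro!: borel_measurable_add borel_measurable_times)
  note [measurable] = int_norm_pair_measurable nS
  have lim: "(\<lambda>N. \<integral>\<^sup>+z. FN a b a' b' N z \<partial>(M \<Otimes>\<^sub>M M)) \<longlonglongrightarrow> (\<integral>\<^sup>+z. F a b a' b' z \<partial>(M \<Otimes>\<^sub>M M))" for a b a' b'
  proof (rule nn_integral_dominated_convergence[where w = "\<lambda>_. 1"])
    show "AE z in M \<Otimes>\<^sub>M M. (\<lambda>N. FN a b a' b' N z) \<longlonglongrightarrow> F a b a' b' z"
    proof (rule AE_I2)
      fix z assume "z \<in> space (M \<Otimes>\<^sub>M M)"
      then have z: "fst z \<in> space M" "snd z \<in> space M" by (auto simp: space_pair_measure)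
      have "(\<lambda>N. (\<lambda>(x, y). \<psi> x y) (int_norm p m (\<lambda>t. a * S N (fst z) t + b * S N (snd z) t),
          int_norm p m (\<lambda>t. a' * S N (fst z) t + b' * S N (snd z) t)))
        \<longlonglongrightarrow> (\<lambda>(x, y). \<psi> x y) (int_norm p m (\<lambda>t. a * path01 (fst z) t + b * path01 (snd z) t),
          int_norm p m (\<lambda>t. a' * path01 (fst z) t + b' * path01 (snd z) t))"
        unfolding S_def
        by (rule continuous_on_tendsto_compose[OF \<psi>(1)]) (auto intro!: tendsto_Pair int_norm_grid_tendsto p z)
      then show "(\<lambda>N. FN a b a' b' N z) \<longlonglongrightarrow> F a b a' b' z"
        unfolding FN_def F_def by (intro tendsto_ennrealI) simp
    qed
    show "(\<integral>\<^sup>+z. 1 \<partial>(M \<Otimes>\<^sub>M M)) < \<infinity>" by (simp add: pair.emeasure_space_1)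
  qed (auto simp: FN_def F_def \<psi>(2))
  have "(\<integral>\<^sup>+z. FN c s (\<kappa> * c - s) (\<kappa> * s + c) N z \<partial>(M \<Otimes>\<^sub>M M)) = (\<integral>\<^sup>+z. FN 1 0 \<kappa> 1 N z \<partial>(M \<Otimes>\<^sub>M M))" for N
  proof -
    let ?P = "PiM {..<Suc N} (\<lambda>_. borel) :: (nat \<Rightarrow> real) measure"
    define h where "h y = ennreal (\<psi> (int_norm p m (\<lambda>t. step_fn (Suc N) (fst y) t))
       (int_norm p m (\<lambda>t. \<kappa> * step_fn (Suc N) (fst y) t + step_fn (Suc N) (snd y) t)))" for y
    have st: "(\<lambda>(t, y). step_fn (Suc N) (f y) t) \<in> borel_measurable (borel \<Otimes>\<^sub>M L)"
      if [measurable]: "f \<in> measurable L ?P" for f and L :: "'c measure"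
      by (intro step_fn_measurable) (rule measurable_compose[OF that measurable_component_singleton], simp)
    have [measurable]: "(\<lambda>y. int_norm p m (\<lambda>t. step_fn (Suc N) (fst y) t)) \<in> borel_measurable (?P \<Otimes>\<^sub>M ?P)"
      by (intro int_norm_measurable st measurable_fst)
    have [measurable]: "(\<lambda>y. int_norm p m (\<lambda>t. \<kappa> * step_fn (Suc N) (fst y) t + step_fn (Suc N) (snd y) t)) \<in> borel_measurable (?P \<Otimes>\<^sub>M ?P)"
      using st[OF measurable_fst, of ?P] st[OF measurable_snd, of ?P]
      by (intro int_norm_measurable) (auto simp: case_prod_beta' intro!: borel_measurable_add borel_measurable_times)
    have "h \<in> borel_measurable (?P \<Otimes>\<^sub>M ?P)" unfolding h_def by measurable
    from nn_integral_incrs_rotation[OF _ cs this] show ?thesis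
      unfolding h_def FN_def S_def fst_conv snd_conv step_fn_lincomb by (simp add: algebra_simps)
  qed
  then have "(\<lambda>N. \<integral>\<^sup>+z. FN 1 0 \<kappa> 1 N z \<partial>(M \<Otimes>\<^sub>M M)) \<longlonglongrightarrow> (\<integral>\<^sup>+z. F c s (\<kappa> * c - s) (\<kappa> * s + c) z \<partial>(M \<Otimes>\<^sub>M M))"
    using lim[of c s "\<kappa> * c - s" "\<kappa> * s + c"] by simp
  from LIMSEQ_unique[OF this lim] show ?thesis by (simp add: F_def)
qed

end

subsection \<open>Exponential moments of linear functionals\<close>

lemma nn_integral_exp_normal:
  fixes l \<sigma> :: real
  assumes "\<sigma> > 0"
  shows "(\<integral>\<^sup>+x. ennreal (exp (l * x)) \<partial>density lborel (\<lambda>x. ennreal (normal_density 0 \<sigma> x))) = ennreal (exp (l\<^sup>2 * \<sigma>\<^sup>2 / 2))"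
proof -
  have eq: "normal_density 0 \<sigma> x * exp (l * x) = exp (l\<^sup>2 * \<sigma>\<^sup>2 / 2) * normal_density (l * \<sigma>\<^sup>2) \<sigma> x" for x
  proof -
    have "- x\<^sup>2 / (2 * \<sigma>\<^sup>2) + l * x = l\<^sup>2 * \<sigma>\<^sup>2 / 2 - (x - l * \<sigma>\<^sup>2)\<^sup>2 / (2 * \<sigma>\<^sup>2)"
      using assms by (simp add: field_simps power2_eq_square)
    then have "exp (- x\<^sup>2 / (2 * \<sigma>\<^sup>2)) * exp (l * x) = exp (l\<^sup>2 * \<sigma>\<^sup>2 / 2) * exp (- ((x - l * \<sigma>\<^sup>2)\<^sup>2 / (2 * \<sigma>\<^sup>2)))"
      by (simp add: mult_exp_exp)
    then show ?thesis by (simp add: normal_density_def)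
  qed
  interpret N: prob_space "density lborel (\<lambda>x. ennreal (normal_density (l * \<sigma>\<^sup>2) \<sigma> x))"
    using assms by (rule prob_space_normal_density)
  have "(\<integral>\<^sup>+x. ennreal (exp (l * x)) \<partial>density lborel (\<lambda>x. ennreal (normal_density 0 \<sigma> x))) =
    (\<integral>\<^sup>+x. ennreal (exp (l\<^sup>2 * \<sigma>\<^sup>2 / 2)) * ennreal (normal_density (l * \<sigma>\<^sup>2) \<sigma> x) \<partial>lborel)"
    by (subst nn_integral_density) (auto simp: ennreal_mult[symmetric] eq)
  also have "\<dots> = ennreal (exp (l\<^sup>2 * \<sigma>\<^sup>2 / 2)) * (\<integral>\<^sup>+x. ennreal (normal_density (l * \<sigma>\<^sup>2) \<sigma> x) \<partial>lborel)"
    by (rule nn_integral_cmult) measurable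
  also have "(\<integral>\<^sup>+x. ennreal (normal_density (l * \<sigma>\<^sup>2) \<sigma> x) \<partial>lborel) = 1"
    using N.emeasure_space_1 by (simp add: emeasure_density)
  finally show ?thesis by simp
qed

text \<open>Integrating a unit jump at \<open>a\<close> raises the order of the kernel by one; the
  integral of a step function is thus a finite sum of kernels at its jumps.\<close>

lemma integral_kern_step:
  assumes "a \<in> {0..1}"
  shows "(\<integral>s. kern i t s * (if a \<le> s then 1 else 0) \<partial>U01) = kern (Suc i) t a"
proof (cases "a \<le> t \<and> t \<le> 1")
  case True
  have "(\<integral>s. kern i t s * (if a \<le> s then 1 else 0) \<partial>U01) = (LINT s:{0..1}|lborel. kern i t s * (if a \<le> s then 1 else 0))"
    by (rule integral_U01) measurable
  also have "\<dots> = (\<integral>s. ((t - s) ^ i / fact i) * indicator {a..t} s \<partial>lborel)"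
    unfolding set_lebesgue_integral_def using True assms
    by (intro Bochner_Integration.integral_cong) (auto simp: kern_def split: split_indicator)
  also have "\<dots> = - ((t - t) ^ Suc i) / fact (Suc i) - (- ((t - a) ^ Suc i) / fact (Suc i))"
  proof (rule integral_FTC_Icc_real)
    fix x
    show "((\<lambda>s. - ((t - s) ^ Suc i) / fact (Suc i)) has_real_derivative (t - x) ^ i / fact i) (at x)"
      by (rule derivative_eq_intros refl | simp del: power_Suc)+
  qed (use True in \<open>auto intro!: continuous_intros\<close>)
  finally show ?thesis using True assms by (simp add: kern_def)
next
  case False
  then have "kern i t s * (if a \<le> s then 1 else 0) = 0" for s by (auto simp: kern_def)
  moreover have "kern (Suc i) t a = 0" using False by (auto simp: kern_def)
  ultimately show ?thesis by (simp only: Bochner_Integration.integral_zero)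
qed

lemma iter_int_step_fn:
  assumes "1 \<le> m"
  shows "iter_int m (step_fn N x) t = (\<Sum>j<N. x j * kern m t (real (Suc j) / real N))"
proof -
  obtain i where i: "m = Suc i" using assms by (cases m) auto
  have "bdd_borel (\<lambda>s. if a \<le> s then 1 else 0)" for a :: real
    by (rule bdd_borelI[of _ 1]) auto
  then have int: "integrable U01 (\<lambda>s. kern i t s * (if a \<le> s then 1 else 0))" for a :: real
    by (intro integrable_bdd_borel bdd_borel_mult bdd_borel_kern)
  have "iter_int m (step_fn N x) t = (\<integral>s. (\<Sum>j<N. x j * (kern i t s * (if real (Suc j) / real N \<le> s then 1 else 0))) \<partial>U01)"
    unfolding i iter_int_Suc step_fn_def sum_distrib_left by (simp add: mult_ac)
  also have "\<dots> = (\<Sum>j<N. x j * (\<integral>s. kern i t s * (if real (Suc j) / real N \<le> s then 1 else 0) \<partial>U01))"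
    by (subst Bochner_Integration.integral_sum) (simp_all only: integrable_mult_right int Bochner_Integration.integral_mult_right_zero)
  also have "\<dots> = (\<Sum>j<N. x j * kern m t (real (Suc j) / real N))"
  proof (intro sum.cong refl)
    fix j assume "j \<in> {..<N}"
    then have "real (Suc j) / real N \<in> {0..1}" by (auto simp: field_simps)
    from integral_kern_step[OF this, of i t]
    show "x j * (\<integral>s. kern i t s * (if real (Suc j) / real N \<le> s then 1 else 0) \<partial>U01) = x j * kern m t (real (Suc j) / real N)"
      by (simp only: i)
  qed
  finally show ?thesis .
qed

text \<open>For \<open>m \<ge> 1\<close> the kernel vanishes on the diagonal, so cutting it off
  there keeps it continuous; the kernel of order 0 jumps.\<close>

lemma kern_tendsto:
  assumes "1 \<le> m" "u \<longlonglongrightarrow> v" "\<And>n. u n \<in> {0..1}"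
  shows "(\<lambda>n. kern m t (u n)) \<longlonglongrightarrow> kern m t v"
proof (cases "t \<le> 1")
  case True
  have "v \<in> {0..1}" using closed_sequentially[OF closed_atLeastAtMost, of u 0 1 v] assms by auto
  moreover have "kern m t x = (max 0 (t - x)) ^ m / fact m" if "x \<in> {0..1}" for x
    using that True assms(1) by (auto simp: kern_def max_def)
  ultimately show ?thesis using assms
    by (simp add: tendsto_divide tendsto_power tendsto_max tendsto_diff)
qed (auto simp: kern_def)

text \<open>Right-endpoint Riemann sums are integrals of step functions, and dominated convergence
  applies. Continuity is asked along sequences because this is how dominated convergence yields it
  for kernel integrals.\<close>

lemma riemann_sum_tendsto:
  assumes G: "\<And>u v. u \<longlonglongrightarrow> v \<Longrightarrow> (\<And>n. u n \<in> {0..1}) \<Longrightarrow> (\<lambda>n. G (u n)) \<longlonglongrightarrow> G v"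
    and bG: "bdd_borel G"
  shows "(\<lambda>N. (\<Sum>j<Suc N. G (real (Suc j) / real (Suc N))) / real (Suc N)) \<longlonglongrightarrow> (\<integral>u. G u \<partial>U01)"
proof -
  obtain B where B: "\<And>t. \<bar>G t\<bar> \<le> B" "B > 0" using bG by (meson bdd_borelE)
  have Gm [measurable]: "G \<in> borel_measurable borel" using bG by (rule bdd_borel_measurable)
  \<comment> \<open>The value of \<open>G\<close> at the right end of the cell containing
    \<open>u\<close>. At \<open>u = 1\<close> that point would leave the unit interval; outside
    \<open>{0..<1}\<close>, a null set of \<open>U01\<close>, the value is set to 0.\<close>
  define R where "R N u = (if u \<in> {0..<1} then G (real_of_int (\<lfloor>real (Suc N) * u\<rfloor> + 1) / real (Suc N)) else 0)" for N u
  have Rm [measurable]: "R N \<in> borel_measurable borel" for N unfolding R_def by measurable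
  have "AE t in lborel. t \<noteq> (1::real)" by (rule AE_lborel_singleton)
  then have AE1: "AE u in U01. u \<in> {0..<1}" by (intro AE_U01_I) auto
  have lim: "(\<lambda>N. \<integral>u. R N u \<partial>U01) \<longlonglongrightarrow> (\<integral>u. G u \<partial>U01)"
  proof (rule integral_dominated_convergence[where w = "\<lambda>_. B"])
    show "AE u in U01. (\<lambda>N. R N u) \<longlonglongrightarrow> G u"
      using AE1
    proof eventually_elim
      case (elim u)
      have "(\<lambda>N. real_of_int \<lfloor>real (Suc N) * u\<rfloor> / real (Suc N) + 1 / real (Suc N)) \<longlonglongrightarrow> u + 0"
        by (intro tendsto_add floor_grid_tendsto LIMSEQ_Suc lim_1_over_n)
      then have "(\<lambda>N. real_of_int (\<lfloor>real (Suc N) * u\<rfloor> + 1) / real (Suc N)) \<longlonglongrightarrow> u"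
        by (simp add: add_divide_distrib)
      moreover have "real_of_int (\<lfloor>real (Suc N) * u\<rfloor> + 1) / real (Suc N) \<in> {0..1}" for N
      proof -
        have "real (Suc N) * u < real (Suc N) * 1" using elim by (intro mult_strict_left_mono) auto
        then have "\<lfloor>real (Suc N) * u\<rfloor> < int (Suc N)" by (simp add: floor_less_iff)
        moreover have "0 \<le> real (Suc N) * u" using elim by auto
        then have "0 \<le> \<lfloor>real (Suc N) * u\<rfloor>" by simp
        ultimately show ?thesis by (auto simp: divide_le_eq)
      qed
      ultimately show ?case using G elim by (simp add: R_def)
    qed
    show "AE u in U01. norm (R N u) \<le> B" for N using B by (auto simp: R_def less_imp_le)
  qed auto
  have "(\<integral>u. R N u \<partial>U01) = (\<Sum>j<Suc N. G (real (Suc j) / real (Suc N))) / real (Suc N)" for N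
  proof -
    let ?I = "\<lambda>j. {real j / real (Suc N)..<real (Suc j) / real (Suc N)}"
    have Req: "R N u = (\<Sum>j<Suc N. G (real (Suc j) / real (Suc N)) * indicator (?I j) u)" if u: "u \<in> {0..<1}" for u
    proof -
      define k where "k = nat \<lfloor>real (Suc N) * u\<rfloor>"
      have 0: "0 \<le> \<lfloor>real (Suc N) * u\<rfloor>" using u by simp
      have "real (Suc N) * u < real (Suc N) * 1" using u by (intro mult_strict_left_mono) auto
      then have kN: "k < Suc N" unfolding k_def using 0 by (simp add: floor_less_iff nat_less_iff)
      have iff: "u \<in> ?I j \<longleftrightarrow> j = k" for j
      proof -
        have "u \<in> ?I j \<longleftrightarrow> real j \<le> real (Suc N) * u \<and> real (Suc N) * u < real (Suc j)"
          by (simp add: field_simps)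
        also have "\<dots> \<longleftrightarrow> \<lfloor>real (Suc N) * u\<rfloor> = int j" by (simp add: floor_eq_iff add.commute)
        also have "\<dots> \<longleftrightarrow> j = k" using 0 by (auto simp: k_def)
        finally show ?thesis .
      qed
      have "(\<Sum>j<Suc N. G (real (Suc j) / real (Suc N)) * indicator (?I j) u) =
        (\<Sum>j<Suc N. if j = k then G (real (Suc j) / real (Suc N)) else 0)"
        by (intro sum.cong refl) (simp add: indicator_def iff del: of_nat_Suc atLeastLessThan_iff)
      also have "\<dots> = G (real (Suc k) / real (Suc N))"
        using kN by (subst sum.delta) auto
      also have "real (Suc k) = real_of_int (\<lfloor>real (Suc N) * u\<rfloor> + 1)" using 0 by (simp add: k_def)
      finally show ?thesis using u by (simp add: R_def)
    qed
    have "(\<integral>u. R N u \<partial>U01) = (\<integral>u. (\<Sum>j<Suc N. G (real (Suc j) / real (Suc N)) * indicator (?I j) u) \<partial>U01)"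
    proof (rule integral_cong_AE)
      show "AE u in U01. R N u = (\<Sum>j<Suc N. G (real (Suc j) / real (Suc N)) * indicator (?I j) u)"
        using AE1 by eventually_elim (rule Req)
    qed measurable
    also have "\<dots> = (\<Sum>j<Suc N. G (real (Suc j) / real (Suc N)) * (\<integral>u. indicator (?I j) u \<partial>U01))"
    proof -
      have "integrable U01 (indicator (?I j) :: real \<Rightarrow> real)" for j
        by (intro integrable_bdd_borel bdd_borelI[of _ 1]) auto
      then show ?thesis
        by (subst Bochner_Integration.integral_sum) (simp_all only: integrable_mult_right Bochner_Integration.integral_mult_right_zero)
    qed
    also have "\<dots> = (\<Sum>j<Suc N. G (real (Suc j) / real (Suc N)) * (1 / real (Suc N)))"
    proof (intro sum.cong refl)
      fix j assume j: "j \<in> {..<Suc N}"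
      have "(\<integral>u. indicator (?I j) u \<partial>U01) = measure U01 (?I j)" by simp
      also have "\<dots> = measure lborel ({0..1} \<inter> ?I j)"
        unfolding U01_def by (subst measure_uniform_measure) auto
      also have "{0..1} \<inter> ?I j = ?I j"
      proof (rule Int_absorb1, rule subsetI)
        fix x assume "x \<in> ?I j"
        moreover have "real (Suc j) / real (Suc N) \<le> 1" "0 \<le> real j / real (Suc N)"
          using j by (auto simp: divide_le_eq)
        ultimately show "x \<in> {0..1}" unfolding atLeastLessThan_iff atLeastAtMost_iff by linarith
      qed
      also have "measure lborel (?I j) = real (Suc j) / real (Suc N) - real j / real (Suc N)"
        by (intro measure_lborel_Ico divide_right_mono) auto
      also have "\<dots> = 1 / real (Suc N)" by (simp add: diff_divide_distrib[symmetric])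
      finally show "G (real (Suc j) / real (Suc N)) * (\<integral>u. indicator (?I j) u \<partial>U01) = G (real (Suc j) / real (Suc N)) * (1 / real (Suc N))"
        by simp
    qed
    finally show ?thesis
      by (simp only: sum_divide_distrib times_divide_eq_right mult_1_right)
  qed
  with lim show ?thesis by (simp only:)
qed

section \<open>Seminorm properties on paths\<close>

lemma int_norm_cmult:
  assumes "1 \<le> p" "bdd_borel v"
  shows "int_norm p m (\<lambda>t. a * v t) = \<bar>a\<bar> * int_norm p m v"
proof -
  have eq: "iter_int m (\<lambda>t. a * v t) t = a * iter_int m v t" for t
    using iter_int_lincomb[OF assms(2,2), of m a 0 t] by simp
  have [measurable]: "iter_int m v \<in> borel_measurable borel"
    by (intro bdd_borel_measurable bdd_borel_iter_int assms)
  have "(\<integral>t. \<bar>a * iter_int m v t\<bar> powr p \<partial>U01) = \<bar>a\<bar> powr p * (\<integral>t. \<bar>iter_int m v t\<bar> powr p \<partial>U01)"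
    by (simp add: abs_mult powr_mult)
  then show ?thesis
    unfolding int_norm_def eq[abs_def] using assms(1)
    by (simp add: Lp_norm01_eq powr_mult powr_powr)
qed

text \<open>Minkowski's inequality by duality: the functional norming the sum is tested on each
  summand. The extra \<open>e\<close> is there because \<open>Lp_dual\<close> asks for strictly
  positive bounds.\<close>

lemma int_norm_triangle:
  assumes p: "1 \<le> p" and v: "bdd_borel v" and w: "bdd_borel w"
  shows "int_norm p m (\<lambda>t. v t + w t) \<le> int_norm p m v + int_norm p m w"
proof (rule field_le_epsilon)
  fix e :: real assume e: "e > 0"
  have vw: "bdd_borel (\<lambda>t. v t + w t)" using bdd_borel_lincomb[OF v w, of 1 1] by simp
  obtain f where f: "bdd_borel f" "f \<in> Lq_unit_ball p"
    "(\<integral>t. f t * iter_int m (\<lambda>t. v t + w t) t \<partial>U01) = Lp_norm01 p (iter_int m (\<lambda>t. v t + w t))"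
    "\<And>g D. bdd_borel g \<Longrightarrow> 0 < D \<Longrightarrow> Lp_norm01 p g \<le> D \<Longrightarrow> (\<integral>t. f t * g t \<partial>U01) \<le> D"
    using Lp_dual[OF p bdd_borel_iter_int[OF vw, of m]] by metis
  have int: "integrable U01 (\<lambda>t. f t * iter_int m v t)" "integrable U01 (\<lambda>t. f t * iter_int m w t)"
    by (intro integrable_bdd_borel bdd_borel_mult f bdd_borel_iter_int v w)+
  have "int_norm p m (\<lambda>t. v t + w t) = (\<integral>t. f t * iter_int m v t + f t * iter_int m w t \<partial>U01)"
    unfolding int_norm_def f(3)[symmetric] using iter_int_lincomb[OF v w, of m 1 1]
    by (simp add: distrib_left)
  also have "\<dots> = (\<integral>t. f t * iter_int m v t \<partial>U01) + (\<integral>t. f t * iter_int m w t \<partial>U01)"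
    using int by simp
  also have "\<dots> \<le> (int_norm p m v + e / 2) + (int_norm p m w + e / 2)"
    using e Lp_norm01_nonneg[of p "iter_int m v"] Lp_norm01_nonneg[of p "iter_int m w"] unfolding int_norm_def
    by (intro add_mono f(4) bdd_borel_iter_int v w) auto
  finally show "int_norm p m (\<lambda>t. v t + w t) \<le> int_norm p m v + int_norm p m w + e" by simp
qed

lemma int_norm_nonneg: "0 \<le> int_norm p m v"
  by (simp add: int_norm_def Lp_norm01_nonneg)

context brownian
begin

lemma nn_integral_exp_incrs_sum:
  assumes N: "N > 0"
  shows "(\<integral>\<^sup>+\<omega>. ennreal (exp (l * (\<Sum>j<N. incrs N \<omega> j * a j))) \<partial>M) = ennreal (exp (l\<^sup>2 / 2 * ((\<Sum>j<N. (a j)\<^sup>2) / real N)))"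
proof -
  let ?d = "\<lambda>j \<omega>. W (real (Suc j) / real N) \<omega> - W (real j / real N) \<omega>"
  have ind: "indep_vars (\<lambda>_. borel) (\<lambda>j \<omega>. ennreal (exp (l * a j * ?d j \<omega>))) {..<N}"
    by (rule indep_vars_compose2[OF indep_incrs[OF N], where Y = "\<lambda>j x. ennreal (exp (l * a j * x))"]) measurable
  have "(\<integral>\<^sup>+\<omega>. ennreal (exp (l * (\<Sum>j<N. incrs N \<omega> j * a j))) \<partial>M) = (\<integral>\<^sup>+\<omega>. (\<Prod>j<N. ennreal (exp (l * a j * ?d j \<omega>))) \<partial>M)"
  proof (rule nn_integral_cong)
    fix \<omega>
    have "exp (l * (\<Sum>j<N. incrs N \<omega> j * a j)) = (\<Prod>j<N. exp (l * a j * ?d j \<omega>))"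
      by (subst exp_sum[symmetric]) (auto simp: sum_distrib_left incrs_def mult_ac intro!: sum.cong)
    then show "ennreal (exp (l * (\<Sum>j<N. incrs N \<omega> j * a j))) = (\<Prod>j<N. ennreal (exp (l * a j * ?d j \<omega>)))"
      by (simp add: prod_ennreal)
  qed
  also have "\<dots> = (\<Prod>j<N. \<integral>\<^sup>+\<omega>. ennreal (exp (l * a j * ?d j \<omega>)) \<partial>M)"
    by (rule indep_vars_nn_integral[OF _ ind]) auto
  also have "\<dots> = (\<Prod>j<N. ennreal (exp (l\<^sup>2 / 2 * ((a j)\<^sup>2 / real N))))"
  proof (intro prod.cong refl)
    fix j assume "j \<in> {..<N}"
    have dm: "?d j \<in> borel_measurable M" by (intro borel_measurable_diff W_measurable) auto
    have "real (Suc j) / real N - real j / real N = 1 / real N" by (simp add: diff_divide_distrib[symmetric])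
    then have di: "distr M borel (?d j) = density lborel (normal_density 0 (sqrt (1 / real N)))"
      using distr_incrs[of "real j / real N" "real (Suc j) / real N"] N by (simp add: divide_strict_right_mono)
    have "(\<integral>\<^sup>+\<omega>. ennreal (exp (l * a j * ?d j \<omega>)) \<partial>M) = (\<integral>\<^sup>+x. ennreal (exp (l * a j * x)) \<partial>distr M borel (?d j))"
      using dm by (subst nn_integral_distr) auto
    also have "\<dots> = ennreal (exp ((l * a j)\<^sup>2 * (sqrt (1 / real N))\<^sup>2 / 2))"
      unfolding di using N by (intro nn_integral_exp_normal) auto
    finally show "(\<integral>\<^sup>+\<omega>. ennreal (exp (l * a j * ?d j \<omega>)) \<partial>M) = ennreal (exp (l\<^sup>2 / 2 * ((a j)\<^sup>2 / real N)))"
      by (simp add: power_mult_distrib)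
  qed
  also have "\<dots> = ennreal (exp (\<Sum>j<N. l\<^sup>2 / 2 * ((a j)\<^sup>2 / real N)))"
    by (simp add: prod_ennreal exp_sum)
  finally show ?thesis by (simp only: sum_distrib_left[symmetric] sum_divide_distrib)
qed

text \<open>The functional is a limit of Gaussian sums whose variances are Riemann sums of the
  integral on the right. Fatou's lemma gives an inequality, in the direction that Chernoff's bound
  uses.\<close>

lemma exp_functional_le:
  assumes m: "1 \<le> m" and f: "bdd_borel f"
  shows "(\<integral>\<^sup>+\<omega>. ennreal (exp (l * (\<integral>t. f t * iter_int m (path01 \<omega>) t \<partial>U01))) \<partial>M)
    \<le> ennreal (exp (l\<^sup>2 / 2 * (\<integral>u. (\<integral>t. kern m t u * f t \<partial>U01)\<^sup>2 \<partial>U01)))"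
proof -
  have fm [measurable]: "f \<in> borel_measurable borel" using f by (rule bdd_borel_measurable)
  obtain B where B: "\<And>t. \<bar>f t\<bar> \<le> B" "B > 0" using f by (meson bdd_borelE)
  define G where "G u = (\<integral>t. kern m t u * f t \<partial>U01)" for u
  have bk: "bdd_borel (\<lambda>t. kern m t u * f t)" for u
    by (intro bdd_borel_mult f bdd_borelI[of _ 1]) (auto simp: kern_nonneg kern_le_1)
  have Gm [measurable]: "G \<in> borel_measurable borel"
    unfolding G_def by (rule U01.borel_measurable_lebesgue_integral) (simp add: case_prod_beta)
  have kfB: "\<bar>kern m t u * f t\<bar> \<le> B" for t u
    using abs_kern_mult_le[of m t u "f t"] B(1)[of t] by linarith
  have GB: "\<bar>G u\<bar> \<le> B" for u
  proof -
    have "\<bar>G u\<bar> \<le> (\<integral>t. \<bar>kern m t u * f t\<bar> \<partial>U01)" unfolding G_def by (rule integral_abs_bound)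
    also have "\<dots> \<le> (\<integral>t. B \<partial>U01)"
      using kfB by (intro integral_mono integrable_abs integrable_bdd_borel bk) auto
    finally show ?thesis by simp
  qed
  have bG: "bdd_borel G" using Gm GB by (rule bdd_borelI)
  then have bG2: "bdd_borel (\<lambda>u. (G u)\<^sup>2)" unfolding power2_eq_square by (intro bdd_borel_mult)
  have Gcont: "(\<lambda>n. G (u n)) \<longlonglongrightarrow> G v" if "u \<longlonglongrightarrow> v" "\<And>n. u n \<in> {0..1}" for u v
    unfolding G_def
  proof (rule integral_dominated_convergence[where w = "\<lambda>_. B"])
    show "AE t in U01. (\<lambda>n. kern m t (u n) * f t) \<longlonglongrightarrow> kern m t v * f t"
      by (intro AE_I2 tendsto_mult tendsto_const kern_tendsto m that)
  qed (use kfB in auto)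
  define L where "L \<omega> = (\<integral>t. f t * iter_int m (path01 \<omega>) t \<partial>U01)" for \<omega>
  define LN where "LN N \<omega> = (\<integral>t. f t * iter_int m (step_fn (Suc N) (incrs (Suc N) \<omega>)) t \<partial>U01)" for N \<omega>
  have LN: "LN N \<omega> = (\<Sum>j<Suc N. incrs (Suc N) \<omega> j * G (real (Suc j) / real (Suc N)))" for N \<omega>
  proof -
    have "LN N \<omega> = (\<integral>t. (\<Sum>j<Suc N. incrs (Suc N) \<omega> j * (kern m t (real (Suc j) / real (Suc N)) * f t)) \<partial>U01)"
      unfolding LN_def iter_int_step_fn[OF m] sum_distrib_left by (simp only: mult_ac)
    also have "\<dots> = (\<Sum>j<Suc N. incrs (Suc N) \<omega> j * G (real (Suc j) / real (Suc N)))"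
      unfolding G_def using integrable_bdd_borel[OF bk]
      by (subst Bochner_Integration.integral_sum) (simp_all only: integrable_mult_right Bochner_Integration.integral_mult_right_zero)
    finally show ?thesis .
  qed
  have LNm: "LN N \<in> borel_measurable M" for N
    unfolding LN[abs_def]
    by (intro borel_measurable_sum borel_measurable_times measurable_compose[OF incrs_measurable measurable_component_singleton]) auto
  have lim: "(\<lambda>N. LN N \<omega>) \<longlonglongrightarrow> L \<omega>" if \<omega>: "\<omega> \<in> space M" for \<omega>
  proof -
    obtain C where C: "\<And>s. \<bar>path01 \<omega> s\<bar> \<le> C" "C > 0" using bdd_borel_path01[OF \<omega>] by (meson bdd_borelE)
    have S: "\<bar>step_fn (Suc N) (incrs (Suc N) \<omega>) s\<bar> \<le> C" for N s
      using C \<omega> by (simp add: step_fn_incrs)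
    have I: "\<bar>iter_int m (step_fn (Suc N) (incrs (Suc N) \<omega>)) t\<bar> \<le> C" for N t
      by (rule iter_int_bound[OF bdd_borel_step_fn S])
    show ?thesis unfolding L_def LN_def
    proof (rule integral_dominated_convergence[where w = "\<lambda>_. B * C"])
      show "AE t in U01. (\<lambda>N. f t * iter_int m (step_fn (Suc N) (incrs (Suc N) \<omega>)) t) \<longlonglongrightarrow> f t * iter_int m (path01 \<omega>) t"
        using AE_U01
      proof eventually_elim
        case (elim t)
        show ?case
        proof (intro tendsto_mult tendsto_const iter_int_tendsto[where B = C])
          fix s :: real assume s: "s \<in> {0..1}"
          show "(\<lambda>N. step_fn (Suc N) (incrs (Suc N) \<omega>) s) \<longlonglongrightarrow> path01 \<omega> s"
            using path01_grid_tendsto[OF \<omega> s] \<omega> by (simp add: step_fn_incrs)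
        qed (use S elim in \<open>auto intro: bdd_borel_measurable bdd_borel_step_fn bdd_borel_path01 \<omega>\<close>)
      qed
      show "AE t in U01. norm (f t * iter_int m (step_fn (Suc N) (incrs (Suc N) \<omega>)) t) \<le> B * C" for N
        using B C I by (auto simp: abs_mult intro!: mult_mono AE_I2)
      show "(\<lambda>t. f t * iter_int m (step_fn (Suc N) (incrs (Suc N) \<omega>)) t) \<in> borel_measurable U01" for N
        unfolding borel_measurable_U01 by (intro bdd_borel_measurable bdd_borel_mult f bdd_borel_iter_int bdd_borel_step_fn)
      show "(\<lambda>t. f t * iter_int m (path01 \<omega>) t) \<in> borel_measurable U01"
        unfolding borel_measurable_U01 by (intro bdd_borel_measurable bdd_borel_mult f bdd_borel_iter_int bdd_borel_path01 \<omega>)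
    qed auto
  qed
  have "(\<integral>\<^sup>+\<omega>. ennreal (exp (l * L \<omega>)) \<partial>M) = (\<integral>\<^sup>+\<omega>. liminf (\<lambda>N. ennreal (exp (l * LN N \<omega>))) \<partial>M)"
  proof (rule nn_integral_cong)
    fix \<omega> assume "\<omega> \<in> space M"
    have "(\<lambda>N. ennreal (exp (l * LN N \<omega>))) \<longlonglongrightarrow> ennreal (exp (l * L \<omega>))"
      by (intro tendsto_ennrealI tendsto_exp tendsto_mult tendsto_const lim) fact
    from lim_imp_Liminf[OF _ this] show "ennreal (exp (l * L \<omega>)) = liminf (\<lambda>N. ennreal (exp (l * LN N \<omega>)))"
      by simp
  qed
  also have "\<dots> \<le> liminf (\<lambda>N. \<integral>\<^sup>+\<omega>. ennreal (exp (l * LN N \<omega>)) \<partial>M)"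
    using LNm by (intro nn_integral_liminf) auto
  also have "\<dots> = ennreal (exp (l\<^sup>2 / 2 * (\<integral>u. (G u)\<^sup>2 \<partial>U01)))"
  proof (rule lim_imp_Liminf)
    have "(\<lambda>N. (\<Sum>j<Suc N. (G (real (Suc j) / real (Suc N)))\<^sup>2) / real (Suc N)) \<longlonglongrightarrow> (\<integral>u. (G u)\<^sup>2 \<partial>U01)"
      by (rule riemann_sum_tendsto[OF _ bG2]) (intro tendsto_power Gcont)
    then show "(\<lambda>N. \<integral>\<^sup>+\<omega>. ennreal (exp (l * LN N \<omega>)) \<partial>M) \<longlonglongrightarrow> ennreal (exp (l\<^sup>2 / 2 * (\<integral>u. (G u)\<^sup>2 \<partial>U01)))"
      unfolding LN nn_integral_exp_incrs_sum[OF zero_less_Suc]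
      by (intro tendsto_ennrealI tendsto_exp tendsto_mult tendsto_const)
  qed simp
  finally show ?thesis by (simp add: L_def G_def)
qed

end

subsection \<open>The tail recursion\<close>

context brownian
begin

lemma int_norm_shift_measurable:
  assumes "bdd_borel v"
  shows "(\<lambda>\<omega>. int_norm p m (\<lambda>t. v t + path01 \<omega> t)) \<in> borel_measurable M"
proof (rule int_norm_measurable)
  have [measurable]: "v \<in> borel_measurable borel" using assms by (rule bdd_borel_measurable)
  have "(\<lambda>z. v (fst z) + (\<lambda>(s, \<omega>). path01 \<omega> s) z) \<in> borel_measurable (borel \<Otimes>\<^sub>M M)"
    using path01_measurable by measurable
  then show "(\<lambda>(t, \<omega>). v t + path01 \<omega> t) \<in> borel_measurable (borel \<Otimes>\<^sub>M M)"
    by (simp add: case_prod_beta')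
qed

lemma int_norm_path01_measurable: "(\<lambda>\<omega>. int_norm p m (path01 \<omega>)) \<in> borel_measurable M"
  using int_norm_shift_measurable[of "\<lambda>_. 0" p m] by simp

lemma functional_measurable:
  assumes "bdd_borel f"
  shows "(\<lambda>\<omega>. \<integral>t. f t * iter_int m (path01 \<omega>) t \<partial>U01) \<in> borel_measurable M"
proof -
  have [measurable]: "f \<in> borel_measurable borel" using assms by (rule bdd_borel_measurable)
  have [measurable]: "(\<lambda>z. iter_int m (\<lambda>s. path01 (fst z) s) (snd z)) \<in> borel_measurable (M \<Otimes>\<^sub>M U01)"
    by (rule iter_int_measurable[OF path01_measurable]) measurable
  show ?thesis
    by (rule U01.borel_measurable_lebesgue_integral) (simp add: case_prod_beta')
qed

text \<open>A functional norming the centre of the ball sees a centred Gaussian of variance at most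
  \<open>A_norm m p\<close>, so Chernoff's bound applies.\<close>

lemma shifted_ball_le:
  assumes p: "1 \<le> p" and m: "1 \<le> m" and A: "A_norm m p > 0" and v: "bdd_borel v"
    and d: "0 < d" "d \<le> int_norm p m v"
  shows "measure M {\<omega> \<in> space M. int_norm p m (\<lambda>t. v t + path01 \<omega> t) \<le> d}
    \<le> exp (- ((int_norm p m v - d)\<^sup>2 / (2 * A_norm m p)))"
proof -
  define A where "A = A_norm m p"
  define a where "a = int_norm p m v - d"
  have A0: "A > 0" and a0: "a \<ge> 0" using A d by (auto simp: A_def a_def)
  obtain f where f: "bdd_borel f" "f \<in> Lq_unit_ball p" "(\<integral>t. f t * iter_int m v t \<partial>U01) = Lp_norm01 p (iter_int m v)"
    and fle: "\<forall>g D. bdd_borel g \<longrightarrow> 0 < D \<longrightarrow> Lp_norm01 p g \<le> D \<longrightarrow> (\<integral>t. f t * g t \<partial>U01) \<le> D"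
    using Lp_dual[OF p bdd_borel_iter_int[OF v, of m]] by metis
  define L where "L \<omega> = (\<integral>t. f t * iter_int m (path01 \<omega>) t \<partial>U01)" for \<omega>
  have Lm [measurable]: "L \<in> borel_measurable M"
    unfolding L_def using f(1) by (rule functional_measurable)
  have sub: "L \<omega> \<le> - a" if \<omega>: "\<omega> \<in> space M" "int_norm p m (\<lambda>t. v t + path01 \<omega> t) \<le> d" for \<omega>
  proof -
    have b: "bdd_borel (\<lambda>t. v t + path01 \<omega> t)" using bdd_borel_lincomb[OF v bdd_borel_path01[OF \<omega>(1)], of 1 1] by simp
    have int: "integrable U01 (\<lambda>t. f t * iter_int m v t)" "integrable U01 (\<lambda>t. f t * iter_int m (path01 \<omega>) t)"
      by (intro integrable_bdd_borel bdd_borel_mult f bdd_borel_iter_int v bdd_borel_path01 \<omega>)+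
    have "int_norm p m v + L \<omega> = (\<integral>t. f t * iter_int m v t + f t * iter_int m (path01 \<omega>) t \<partial>U01)"
      using int f(3) by (simp add: L_def int_norm_def)
    also have "\<dots> = (\<integral>t. f t * iter_int m (\<lambda>t. v t + path01 \<omega> t) t \<partial>U01)"
      using iter_int_lincomb[OF v bdd_borel_path01[OF \<omega>(1)], of m 1 1] by (simp add: distrib_left)
    also have "\<dots> \<le> d" using fle bdd_borel_iter_int[OF b, of m] d(1) \<omega>(2) by (auto simp: int_norm_def)
    finally show ?thesis by (simp add: a_def)
  qed
  let ?E = "{\<omega> \<in> space M. int_norm p m (\<lambda>t. v t + path01 \<omega> t) \<le> d}"
  have E [measurable]: "?E \<in> sets M" using int_norm_shift_measurable[OF v, of p m] by measurable
  have "ennreal (exp (a\<^sup>2 / A)) * emeasure M ?E = (\<integral>\<^sup>+\<omega>. ennreal (exp (a\<^sup>2 / A)) * indicator ?E \<omega> \<partial>M)"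
    by (simp add: nn_integral_cmult_indicator)
  \<comment> \<open>The slope \<open>l = - a / A\<close> minimizes l^2 A / 2 + l a, the logarithm of
    Chernoff's bound for the event \<open>L \<le> - a\<close>.\<close>
  also have "\<dots> \<le> (\<integral>\<^sup>+\<omega>. ennreal (exp ((- a / A) * L \<omega>)) \<partial>M)"
  proof (rule nn_integral_mono)
    fix \<omega> assume "\<omega> \<in> space M"
    show "ennreal (exp (a\<^sup>2 / A)) * indicator ?E \<omega> \<le> ennreal (exp ((- a / A) * L \<omega>))"
    proof (cases "\<omega> \<in> ?E")
      case True
      then have "L \<omega> \<le> - a" using sub by auto
      then have "(- a / A) * (- a) \<le> (- a / A) * L \<omega>" using A0 a0 by (intro mult_left_mono_neg) auto
      then show ?thesis using True by (auto simp: power2_eq_square intro!: ennreal_leI)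
    qed auto
  qed
  also have "\<dots> \<le> ennreal (exp ((- a / A)\<^sup>2 / 2 * (\<integral>u. (\<integral>t. kern m t u * f t \<partial>U01)\<^sup>2 \<partial>U01)))"
    unfolding L_def by (rule exp_functional_le[OF m f(1)])
  also have "\<dots> \<le> ennreal (exp ((- a / A)\<^sup>2 / 2 * A))"
    using variance_le_A_norm[OF p f(2,1), of m] by (intro ennreal_leI) (simp add: A_def mult_left_mono)
  also have "(- a / A)\<^sup>2 / 2 * A = a\<^sup>2 / A - a\<^sup>2 / (2 * A)"
    using A0 by (simp add: power2_eq_square field_simps)
  finally have "exp (a\<^sup>2 / A) * measure M ?E \<le> exp (a\<^sup>2 / A - a\<^sup>2 / (2 * A))"
    by (simp add: emeasure_eq_measure ennreal_mult[symmetric])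
  also have "\<dots> = exp (a\<^sup>2 / A) * exp (- (a\<^sup>2 / (2 * A)))"
    by (simp add: mult_exp_exp)
  finally show ?thesis by (simp add: a_def A_def)
qed

text \<open>Indicators are not continuous. A product of two linear ramps of width \<open>e\<close>
  lies between the indicators of the strict and of the relaxed event, and
  \<open>rotation_invariance\<close> applies to it.\<close>

lemma emeasure_pair_le:
  assumes p: "1 \<le> p" and cs: "c \<noteq> 0" "c\<^sup>2 + s\<^sup>2 = 1" and e: "e > 0"
  shows "emeasure (M \<Otimes>\<^sub>M M) {z \<in> space (M \<Otimes>\<^sub>M M). \<rho> \<le> int_norm p m (\<lambda>t. c * path01 (fst z) t + s * path01 (snd z) t)
      \<and> int_norm p m (\<lambda>t. (\<kappa> * c - s) * path01 (fst z) t + (\<kappa> * s + c) * path01 (snd z) t) \<le> d}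
    \<le> emeasure (M \<Otimes>\<^sub>M M) {z \<in> space (M \<Otimes>\<^sub>M M). \<rho> - e < int_norm p m (path01 (fst z))
      \<and> int_norm p m (\<lambda>t. \<kappa> * path01 (fst z) t + path01 (snd z) t) \<le> d + e}" (is "emeasure _ ?E \<le> emeasure _ ?F")
proof -
  define \<psi> where "\<psi> x y = clamp01 ((x - (\<rho> - e)) / e) * clamp01 ((d + e - y) / e)" for x y
  have cont: "continuous_on UNIV (\<lambda>(x, y). \<psi> x y)"
    unfolding \<psi>_def clamp01_def case_prod_beta' using e by (intro continuous_intros) auto
  have le1: "\<psi> x y \<le> 1" and ge0: "0 \<le> \<psi> x y" for x y
    unfolding \<psi>_def by (auto intro!: mult_le_one mult_nonneg_nonneg)
  have one: "\<psi> x y = 1" if "\<rho> \<le> x" "y \<le> d" for x y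
    using that e by (auto simp: \<psi>_def clamp01_def min_def max_def field_simps)
  have zero: "\<psi> x y = 0" if "\<not> (\<rho> - e < x \<and> y \<le> d + e)" for x y
    using that e by (auto simp: \<psi>_def clamp01_def min_def max_def field_simps not_le not_less)
  note [measurable] = int_norm_pair_measurable
  have [measurable]: "(\<lambda>z. int_norm p m (path01 (fst z))) \<in> borel_measurable (M \<Otimes>\<^sub>M M)"
    using int_norm_pair_measurable[of p m 1 0] by simp
  have [measurable]: "(\<lambda>z. int_norm p m (\<lambda>t. \<kappa> * path01 (fst z) t + path01 (snd z) t)) \<in> borel_measurable (M \<Otimes>\<^sub>M M)"
    using int_norm_pair_measurable[of p m \<kappa> 1] by simp
  have [measurable]: "?E \<in> sets (M \<Otimes>\<^sub>M M)" "?F \<in> sets (M \<Otimes>\<^sub>M M)" by measurable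
  have "emeasure (M \<Otimes>\<^sub>M M) ?E = (\<integral>\<^sup>+z. indicator ?E z \<partial>(M \<Otimes>\<^sub>M M))" by simp
  also have "\<dots> \<le> (\<integral>\<^sup>+z. \<psi> (int_norm p m (\<lambda>t. c * path01 (fst z) t + s * path01 (snd z) t))
                 (int_norm p m (\<lambda>t. (\<kappa> * c - s) * path01 (fst z) t + (\<kappa> * s + c) * path01 (snd z) t)) \<partial>(M \<Otimes>\<^sub>M M))"
    by (intro nn_integral_mono) (auto simp: one split: split_indicator)
  also have "\<dots> = (\<integral>\<^sup>+z. \<psi> (int_norm p m (path01 (fst z))) (int_norm p m (\<lambda>t. \<kappa> * path01 (fst z) t + path01 (snd z) t)) \<partial>(M \<Otimes>\<^sub>M M))"
    by (rule rotation_invariance[OF p cs cont le1])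
  also have "\<dots> \<le> (\<integral>\<^sup>+z. indicator ?F z \<partial>(M \<Otimes>\<^sub>M M))"
    by (rule nn_integral_mono) (auto simp: zero intro!: ennreal_leI le1 split: split_indicator)
  also have "\<dots> = emeasure (M \<Otimes>\<^sub>M M) ?F" by simp
  finally show ?thesis .
qed

text \<open>A rotation by 45 degrees shows that \<open>X - Y\<close> is distributed like
  \<open>sqrt 2 * X\<close>. The gain by sqrt 2 in the radius is spent on the slack of
  \<open>emeasure_pair_le\<close>.\<close>

lemma symmetrized_ball_le:
  assumes p: "1 \<le> p" and d: "d > 0"
  shows "measure (M \<Otimes>\<^sub>M M) {z \<in> space (M \<Otimes>\<^sub>M M). int_norm p m (\<lambda>t. path01 (fst z) t - path01 (snd z) t) \<le> d}
    \<le> measure M {\<omega> \<in> space M. int_norm p m (path01 \<omega>) \<le> d}"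
proof -
  define c where "c = 1 / sqrt 2"
  have c: "c > 0" "c\<^sup>2 + (- c)\<^sup>2 = 1" "c < 1" by (auto simp: c_def power_divide)
  have eq: "int_norm p m (\<lambda>t. - c * path01 (fst z) t + c * path01 (snd z) t) = c * int_norm p m (\<lambda>t. path01 (fst z) t - path01 (snd z) t)"
    if "z \<in> space (M \<Otimes>\<^sub>M M)" for z
  proof -
    have z: "fst z \<in> space M" "snd z \<in> space M" using that by (auto simp: space_pair_measure)
    have "bdd_borel (\<lambda>t. path01 (fst z) t - path01 (snd z) t)" using bdd_borel_lincomb[OF z[THEN bdd_borel_path01], of 1 "-1"] by simp
    from int_norm_cmult[OF p this, of m "- c"] show ?thesis using c(1) by (simp add: algebra_simps)
  qed
  have [measurable]: "(\<lambda>z. int_norm p m (\<lambda>t. path01 (fst z) t - path01 (snd z) t)) \<in> borel_measurable (M \<Otimes>\<^sub>M M)"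
    using int_norm_pair_measurable[of p m 1 "-1"] by simp
  have [measurable]: "(\<lambda>\<omega>. int_norm p m (path01 \<omega>)) \<in> borel_measurable M" by (rule int_norm_path01_measurable)
  have [measurable]: "(\<lambda>z. int_norm p m (path01 (snd z))) \<in> borel_measurable (M \<Otimes>\<^sub>M M)"
    using int_norm_pair_measurable[of p m 0 1] by simp
  have e: "d - c * d > 0" using c d by (simp add: algebra_simps)
  \<comment> \<open>With threshold 0 the condition on the first component is void, and with \<kappa>
    = 0 the second one concerns \<open>V\<close> alone.\<close>
  have "emeasure (M \<Otimes>\<^sub>M M) {z \<in> space (M \<Otimes>\<^sub>M M). int_norm p m (\<lambda>t. path01 (fst z) t - path01 (snd z) t) \<le> d}
    \<le> emeasure (M \<Otimes>\<^sub>M M) {z \<in> space (M \<Otimes>\<^sub>M M). 0 \<le> int_norm p m (\<lambda>t. c * path01 (fst z) t + c * path01 (snd z) t)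
      \<and> int_norm p m (\<lambda>t. (0 * c - c) * path01 (fst z) t + (0 * c + c) * path01 (snd z) t) \<le> c * d}"
    (is "emeasure _ ?D \<le> emeasure _ ?E")
  proof (rule emeasure_mono)
    note [measurable] = int_norm_pair_measurable
    show "?E \<in> sets (M \<Otimes>\<^sub>M M)" by measurable
    show "?D \<subseteq> ?E" using eq c(1) by (auto simp: int_norm_nonneg)
  qed
  also have "\<dots> \<le> emeasure (M \<Otimes>\<^sub>M M) {z \<in> space (M \<Otimes>\<^sub>M M). 0 - (d - c * d) < int_norm p m (path01 (fst z))
      \<and> int_norm p m (\<lambda>t. 0 * path01 (fst z) t + path01 (snd z) t) \<le> c * d + (d - c * d)}"
    using c e by (intro emeasure_pair_le p) auto
  also have "\<dots> \<le> emeasure (M \<Otimes>\<^sub>M M) (space M \<times> {\<omega> \<in> space M. int_norm p m (path01 \<omega>) \<le> d})"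
    by (intro emeasure_mono) (auto simp: space_pair_measure)
  also have "\<dots> = emeasure M {\<omega> \<in> space M. int_norm p m (path01 \<omega>) \<le> d}"
    by (subst emeasure_pair_measure_Times) (auto simp: emeasure_space_1)
  finally show ?thesis by (simp add: emeasure_eq_measure pair.emeasure_eq_measure)
qed

text \<open>The angle of the rotation is immaterial; \<open>(3/5, 4/5)\<close> keeps the constants rational.\<close>

lemma tail_recursion:
  assumes p: "1 \<le> p" and m: "1 \<le> m" and A: "A_norm m p > 0" and e: "e > 0" and r: "10 * e \<le> r"
  shows "measure M {\<omega> \<in> space M. int_norm p m (path01 \<omega>) > r} * measure M {\<omega> \<in> space M. int_norm p m (path01 \<omega>) \<le> e}
    \<le> measure M {\<omega> \<in> space M. int_norm p m (path01 \<omega>) > 3/5 * r - 2 * e} *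
      exp (- ((4/5 * r - 6 * e)\<^sup>2 / (2 * A_norm m p)))"
proof -
  let ?n = "\<lambda>\<omega>. int_norm p m (path01 \<omega>)"
  have nm [measurable]: "?n \<in> borel_measurable M" by (rule int_norm_path01_measurable)
  note [measurable] = int_norm_pair_measurable
  have [measurable]: "(\<lambda>z. int_norm p m (\<lambda>t. 4/3 * path01 (fst z) t + path01 (snd z) t)) \<in> borel_measurable (M \<Otimes>\<^sub>M M)"
    using int_norm_pair_measurable[of p m "4/3" 1] by simp
  \<comment> \<open>On the product event the triangle inequality bounds the norm of
    \<open>3/5 X + 4/5 Y\<close> from below by this number.\<close>
  let ?\<rho> = "3/5 * r - 4/5 * e"
  have "emeasure M {\<omega> \<in> space M. ?n \<omega> > r} * emeasure M {\<omega> \<in> space M. ?n \<omega> \<le> e}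
     = emeasure (M \<Otimes>\<^sub>M M) ({\<omega> \<in> space M. ?n \<omega> > r} \<times> {\<omega> \<in> space M. ?n \<omega> \<le> e})"
    by (subst emeasure_pair_measure_Times) auto
  \<comment> \<open>The choice \<kappa> = (4/5) / (3/5) = 4/3 removes \<open>X\<close> from
    \<open>\<kappa> U + V\<close> and leaves \<open>5/3 Y\<close>, hence the radius
    \<open>5/3 * e\<close>.\<close>
  also have "\<dots> \<le> emeasure (M \<Otimes>\<^sub>M M) {z \<in> space (M \<Otimes>\<^sub>M M). ?\<rho> \<le> int_norm p m (\<lambda>t. 3/5 * path01 (fst z) t + 4/5 * path01 (snd z) t)
      \<and> int_norm p m (\<lambda>t. (4/3 * (3/5) - 4/5) * path01 (fst z) t + (4/3 * (4/5) + 3/5) * path01 (snd z) t) \<le> 5/3 * e}"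
  proof (rule emeasure_mono)
    show "{\<omega> \<in> space M. ?n \<omega> > r} \<times> {\<omega> \<in> space M. ?n \<omega> \<le> e} \<subseteq> {z \<in> space (M \<Otimes>\<^sub>M M). ?\<rho> \<le> int_norm p m (\<lambda>t. 3/5 * path01 (fst z) t + 4/5 * path01 (snd z) t)
      \<and> int_norm p m (\<lambda>t. (4/3 * (3/5) - 4/5) * path01 (fst z) t + (4/3 * (4/5) + 3/5) * path01 (snd z) t) \<le> 5/3 * e}"
    proof (clarsimp simp: space_pair_measure)
      fix \<omega> \<omega>' assume w: "\<omega> \<in> space M" "\<omega>' \<in> space M" and n: "r < ?n \<omega>" "?n \<omega>' \<le> e"
      have b: "bdd_borel (\<lambda>t. 3/5 * path01 \<omega> t + 4/5 * path01 \<omega>' t)" by (intro bdd_borel_lincomb bdd_borel_path01 w)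
      have b': "bdd_borel (\<lambda>t. - (4/5) * path01 \<omega>' t)" using bdd_borel_lincomb[OF w(2,2)[THEN bdd_borel_path01], of "- (4/5)" 0] by simp
      have "int_norm p m (\<lambda>t. 3/5 * path01 \<omega> t) \<le> int_norm p m (\<lambda>t. 3/5 * path01 \<omega> t + 4/5 * path01 \<omega>' t) + int_norm p m (\<lambda>t. - (4/5) * path01 \<omega>' t)"
        using int_norm_triangle[OF p b b', of m] by simp
      then have "3/5 * ?n \<omega> \<le> int_norm p m (\<lambda>t. 3/5 * path01 \<omega> t + 4/5 * path01 \<omega>' t) + 4/5 * ?n \<omega>'"
        using int_norm_cmult[OF p bdd_borel_path01[OF w(1)], of m "3/5"] int_norm_cmult[OF p bdd_borel_path01[OF w(2)], of m "- (4/5)"] by simp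
      moreover have "int_norm p m (\<lambda>t. 5/3 * path01 \<omega>' t) = 5/3 * ?n \<omega>'"
        using int_norm_cmult[OF p bdd_borel_path01[OF w(2)], of m "5/3"] by simp
      ultimately show "3 * r / 5 - 4 * e / 5 \<le> int_norm p m (\<lambda>t. 3 * path01 \<omega> t / 5 + 4 * path01 \<omega>' t / 5) \<and>
          int_norm p m (\<lambda>t. 5 * path01 \<omega>' t / 3) * 3 \<le> 5 * e"
        using n by simp
    qed
  qed measurable
  also have "\<dots> \<le> emeasure (M \<Otimes>\<^sub>M M) {z \<in> space (M \<Otimes>\<^sub>M M). ?\<rho> - e < int_norm p m (path01 (fst z))
      \<and> int_norm p m (\<lambda>t. 4/3 * path01 (fst z) t + path01 (snd z) t) \<le> 5/3 * e + e}" (is "_ \<le> emeasure _ ?F")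
    using e by (intro emeasure_pair_le p) (auto simp: power2_eq_square)
  also have "\<dots> = (\<integral>\<^sup>+\<omega>. emeasure M (Pair \<omega> -` ?F) \<partial>M)"
  proof (rule emeasure_pair_measure_alt)
    have [measurable]: "(\<lambda>z. int_norm p m (path01 (fst z))) \<in> borel_measurable (M \<Otimes>\<^sub>M M)"
      using int_norm_pair_measurable[of p m 1 0] by simp
    show "?F \<in> sets (M \<Otimes>\<^sub>M M)" by measurable
  qed
  also have "\<dots> \<le> (\<integral>\<^sup>+\<omega>. ennreal (exp (- ((4/5 * r - 6 * e)\<^sup>2 / (2 * A_norm m p)))) *
      indicator {\<omega> \<in> space M. ?n \<omega> > 3/5 * r - 2 * e} \<omega> \<partial>M)"
  proof (rule nn_integral_mono)
    fix \<omega> assume \<omega>: "\<omega> \<in> space M"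
    show "emeasure M (Pair \<omega> -` ?F) \<le> ennreal (exp (- ((4/5 * r - 6 * e)\<^sup>2 / (2 * A_norm m p)))) *
      indicator {\<omega> \<in> space M. ?n \<omega> > 3/5 * r - 2 * e} \<omega>"
    proof (cases "?\<rho> - e < ?n \<omega>")
      case False
      then have "Pair \<omega> -` ?F = {}" by auto
      then show ?thesis by (simp only: emeasure_empty zero_le)
    next
      case True
      define v where "v t = 4/3 * path01 \<omega> t" for t
      have v: "bdd_borel v" unfolding v_def using bdd_borel_lincomb[OF \<omega>[THEN bdd_borel_path01] \<omega>[THEN bdd_borel_path01], of "4/3" 0] by simp
      have nv: "int_norm p m v = 4/3 * ?n \<omega>" unfolding v_def using int_norm_cmult[OF p bdd_borel_path01[OF \<omega>], of m "4/3"] by simp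
      \<comment> \<open>The centre has norm above 4/3 (3/5 r - 9/5 e), the radius is 8/3 e, and 12/5
        + 8/3 is below 6. The assumption \<open>10 * e \<le> r\<close> makes
        \<open>4/5 * r - 6 * e\<close> nonnegative, so that squaring preserves the
        inequality.\<close>
      have le: "4/5 * r - 6 * e \<le> int_norm p m v - 8/3 * e" using True e unfolding nv by argo
      have pos: "0 \<le> 4/5 * r - 6 * e" using r e by argo
      have "emeasure M (Pair \<omega> -` ?F) \<le> emeasure M {\<omega>' \<in> space M. int_norm p m (\<lambda>t. v t + path01 \<omega>' t) \<le> 8/3 * e}"
        using int_norm_shift_measurable[OF v, of p m]
        by (intro emeasure_mono) (auto simp: space_pair_measure v_def)
      also have "\<dots> \<le> ennreal (exp (- ((int_norm p m v - 8/3 * e)\<^sup>2 / (2 * A_norm m p))))"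
        unfolding emeasure_eq_measure using le pos e
        by (intro ennreal_leI shifted_ball_le p m A v) auto
      also have "\<dots> \<le> ennreal (exp (- ((4/5 * r - 6 * e)\<^sup>2 / (2 * A_norm m p))))"
        using le pos A by (intro ennreal_leI) (auto intro!: divide_right_mono power_mono)
      finally show ?thesis using True e \<omega> by (auto split: split_indicator)
    qed
  qed
  also have "\<dots> = ennreal (exp (- ((4/5 * r - 6 * e)\<^sup>2 / (2 * A_norm m p)))) * emeasure M {\<omega> \<in> space M. ?n \<omega> > 3/5 * r - 2 * e}"
    by (rule nn_integral_cmult_indicator) measurable
  finally show ?thesis
    by (simp add: emeasure_eq_measure ennreal_mult[symmetric] mult.commute)
qed

end

subsection \<open>Coding of paths on a grid\<close>

definition cell :: "nat \<Rightarrow> nat \<Rightarrow> real set" where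
  "cell n k = {real k / real n..real (Suc k) / real n}"

definition cell_dev :: "(real \<Rightarrow> real) \<Rightarrow> nat \<Rightarrow> nat \<Rightarrow> real" where
  "cell_dev w n k = (\<integral>s. indicator (cell n k) s * \<bar>w s - w (real k / real n)\<bar> \<partial>U01)"

text \<open>A Brownian path moves by about n^(-1/2) over a cell, and its deviation integrates there
  to about n^(-3/2); these weights make both terms of order 1. The first term controls the
  integrated path inside the cell, the second the path at its right end.\<close>

definition cell_size :: "(real \<Rightarrow> real) \<Rightarrow> nat \<Rightarrow> nat \<Rightarrow> real" where
  "cell_size w n k = real n * sqrt (real n) * cell_dev w n k +
     sqrt (real n) * \<bar>w (real (Suc k) / real n) - w (real k / real n)\<bar>"

text \<open>The i-th derivative of the j-fold integral is the (j - i)-fold integral, so this is a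
  Taylor remainder; the path itself plays the j-th derivative, frozen at \<open>a\<close>.\<close>

definition taylor_rem :: "nat \<Rightarrow> (real \<Rightarrow> real) \<Rightarrow> real \<Rightarrow> real \<Rightarrow> real" where
  "taylor_rem j w a t = iter_int j w t - (\<Sum>i\<le>j. (t - a) ^ i / fact i * iter_int (j - i) w a)"

lemma cell_measurable [measurable]: "cell n k \<in> sets borel"
  by (simp add: cell_def)

lemma cell_subset: "k < n \<Longrightarrow> cell n k \<subseteq> {0..1}"
  by (auto simp: cell_def intro: order_trans[of 0 "real k / real n"] order_trans[of _ "real (Suc k) / real n" 1])

lemma measure_cell:
  assumes "k < n"
  shows "measure U01 (cell n k) = 1 / real n"
proof -
  have "measure U01 (cell n k) = measure lborel ({0..1} \<inter> cell n k)"
    unfolding U01_def by (subst measure_uniform_measure) auto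
  also have "{0..1} \<inter> cell n k = cell n k" using cell_subset[OF assms] by auto
  also have "measure lborel (cell n k) = real (Suc k) / real n - real k / real n"
    unfolding cell_def by (intro measure_lborel_Icc divide_right_mono) auto
  finally show ?thesis by (simp add: diff_divide_distrib[symmetric])
qed

lemma bdd_borel_indicator: "A \<in> sets borel \<Longrightarrow> bdd_borel (indicator A)"
  by (rule bdd_borelI[of _ 1]) (auto simp: indicator_def)

lemma bdd_borel_cell_dev:
  assumes "bdd_borel w"
  shows "bdd_borel (\<lambda>s. indicator (cell n k) s * \<bar>w s - c\<bar>)"
proof -
  have "bdd_borel (\<lambda>s. w s - c)" using bdd_borel_lincomb[OF assms bdd_borel_const[of c], of 1 "-1"] by simp
  from bdd_borel_abs_powr[OF this, of 1] have "bdd_borel (\<lambda>s. \<bar>w s - c\<bar>)" by simp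
  then show ?thesis by (intro bdd_borel_mult bdd_borel_indicator) auto
qed

lemma cell_dev_nonneg: "0 \<le> cell_dev w n k"
  unfolding cell_dev_def by (intro integral_nonneg_AE AE_I2) auto

lemma cell_size_nonneg: "0 \<le> cell_size w n k"
  unfolding cell_size_def by (intro add_nonneg_nonneg mult_nonneg_nonneg cell_dev_nonneg) auto

lemma power_div_fact_add:
  fixes x y :: real
  shows "(x + y) ^ i / fact i = (\<Sum>l\<le>i. x ^ l / fact l * (y ^ (i - l) / fact (i - l)))"
proof -
  have "(x + y) ^ i / fact i = (\<Sum>l\<le>i. of_nat (i choose l) * x ^ l * y ^ (i - l) / fact i)"
    by (simp add: binomial_ring sum_divide_distrib)
  also have "\<dots> = (\<Sum>l\<le>i. x ^ l / fact l * (y ^ (i - l) / fact (i - l)))"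
    by (intro sum.cong refl) (simp add: binomial_fact)
  finally show ?thesis .
qed

text \<open>For \<open>s \<le> a\<close> the binomial theorem expands the kernel in powers of
  \<open>t - a\<close>, which yields the Taylor terms of order up to \<open>i\<close>. On the rest
  of the interval, subtracting the constant \<open>w a\<close> accounts for the term of order
  \<open>i + 1\<close>.\<close>

lemma taylor_rem_Suc:
  assumes w: "bdd_borel w" and a: "0 \<le> a" "a \<le> t" "t \<le> 1"
  shows "taylor_rem (Suc i) w a t = (\<integral>s. kern i t s * (if a \<le> s then w s - w a else 0) \<partial>U01)"
proof -
  define I where "I s = (if a \<le> s then 1 else 0 :: real)" for s
  define R where "R s = kern i t s * (if a \<le> s then w s - w a else 0)" for s
  define T where "T l s = (t - a) ^ l / fact l * (kern (i - l) a s * w s)" for l s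
  have bI: "bdd_borel I" unfolding I_def[abs_def] by (rule bdd_borelI[of _ 1]) auto
  have bR: "bdd_borel R"
  proof -
    have "bdd_borel (\<lambda>s. kern i t s * (I s * (1 * w s + (- w a) * 1)))"
      by (intro bdd_borel_mult bdd_borel_kern bI bdd_borel_lincomb w bdd_borel_const)
    also have "(\<lambda>s. kern i t s * (I s * (1 * w s + (- w a) * 1))) = R"
      by (auto simp: R_def I_def)
    finally show ?thesis .
  qed
  have iT: "integrable U01 (T l)" for l
    unfolding T_def by (intro integrable_mult_right integrable_bdd_borel bdd_borel_mult bdd_borel_kern w)
  have iI: "integrable U01 (\<lambda>s. kern i t s * I s)" by (intro integrable_bdd_borel bdd_borel_mult bdd_borel_kern bI)
  have "AE s in lborel. s \<noteq> a" by (rule AE_lborel_singleton)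
  then have AEa: "AE s in U01. s \<noteq> a" by (intro AE_U01_I) auto
  \<comment> \<open>At \<open>s = a\<close> both parts would count the same contribution; a single
    point is a null set.\<close>
  have pt: "kern i t s * w s = (\<Sum>l\<le>i. T l s) + R s + w a * (kern i t s * I s)" if "s \<noteq> a" for s
  proof (cases "0 \<le> s \<and> s \<le> a")
    case True
    have "kern i t s = ((t - a) + (a - s)) ^ i / fact i" using True a by (simp add: kern_def)
    also have "\<dots> = (\<Sum>l\<le>i. (t - a) ^ l / fact l * kern (i - l) a s)"
      unfolding power_div_fact_add using True a by (simp add: kern_def)
    finally have "kern i t s * w s = (\<Sum>l\<le>i. T l s)"
      unfolding T_def by (simp add: sum_distrib_right mult.assoc)
    then show ?thesis using True that by (simp add: R_def I_def)
  next
    case False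
    then have "T l s = 0" for l by (auto simp: T_def kern_def)
    then show ?thesis using False a by (auto simp: R_def I_def kern_def algebra_simps diff_divide_distrib)
  qed
  have "iter_int (Suc i) w t = (\<integral>s. (\<Sum>l\<le>i. T l s) + R s + w a * (kern i t s * I s) \<partial>U01)"
    unfolding iter_int_Suc
  proof (rule integral_cong_AE)
    show "AE s in U01. kern i t s * w s = (\<Sum>l\<le>i. T l s) + R s + w a * (kern i t s * I s)"
      using AEa by eventually_elim (rule pt)
    show "(\<lambda>s. kern i t s * w s) \<in> borel_measurable U01"
      unfolding borel_measurable_U01 by (intro bdd_borel_measurable bdd_borel_mult bdd_borel_kern w)
    show "(\<lambda>s. (\<Sum>l\<le>i. T l s) + R s + w a * (kern i t s * I s)) \<in> borel_measurable U01"
      using iT iI integrable_bdd_borel[OF bR]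
      by (intro borel_measurable_add borel_measurable_sum borel_measurable_times borel_measurable_const borel_measurable_integrable)
  qed
  also have "\<dots> = (\<Sum>l\<le>i. \<integral>s. T l s \<partial>U01) + (\<integral>s. R s \<partial>U01) + w a * (\<integral>s. kern i t s * I s \<partial>U01)"
    using iT iI integrable_bdd_borel[OF bR] by simp
  also have "(\<integral>s. kern i t s * I s \<partial>U01) = (t - a) ^ Suc i / fact (Suc i)"
    unfolding I_def using integral_kern_step[of a i t] a by (simp add: kern_def)
  also have "(\<Sum>l\<le>i. \<integral>s. T l s \<partial>U01) = (\<Sum>l\<le>i. (t - a) ^ l / fact l * iter_int (Suc i - l) w a)"
    unfolding T_def by (intro sum.cong refl) (simp add: Suc_diff_le iter_int_Suc)
  finally show ?thesis
    unfolding taylor_rem_def R_def[symmetric] by simp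
qed

lemma abs_taylor_rem_le:
  assumes w: "bdd_borel w" and k: "k < n" and t: "t \<in> cell n k"
  shows "\<bar>taylor_rem (Suc i) w (real k / real n) t\<bar> \<le> (1 / real n) ^ i * cell_dev w n k"
proof -
  define a where "a = real k / real n"
  have a: "0 \<le> a" "a \<le> t" "t \<le> 1" "t \<le> a + 1 / real n"
    using t k cell_subset[OF k] by (auto simp: a_def cell_def add_divide_distrib)
  define J where "J s = (1 / real n) ^ i * (indicator (cell n k) s * \<bar>w s - w a\<bar>)" for s
  have J: "integrable U01 J" unfolding J_def by (intro integrable_mult_right integrable_bdd_borel bdd_borel_cell_dev w)
  have le: "\<bar>kern i t s * (if a \<le> s then w s - w a else 0)\<bar> \<le> J s" for s
  proof (cases "a \<le> s \<and> s \<le> t")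
    case True
    then have s: "s \<in> cell n k" using t by (auto simp: cell_def a_def)
    have "kern i t s = (t - s) ^ i / fact i" using True a by (auto simp: kern_def)
    also have "\<dots> \<le> (t - s) ^ i / 1" using True fact_ge_1[of i] by (intro divide_left_mono) auto
    also have "\<dots> \<le> (1 / real n) ^ i" using True a by (auto intro!: power_mono)
    finally show ?thesis using True s by (simp add: J_def abs_mult kern_nonneg mult_right_mono)
  next
    case False
    then have "kern i t s * (if a \<le> s then w s - w a else 0) = 0" by (auto simp: kern_def)
    moreover have "0 \<le> J s" by (simp add: J_def)
    ultimately show ?thesis by (simp only: abs_zero)
  qed
  have "\<bar>taylor_rem (Suc i) w a t\<bar> \<le> (\<integral>s. \<bar>kern i t s * (if a \<le> s then w s - w a else 0)\<bar> \<partial>U01)"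
    unfolding taylor_rem_Suc[OF w a(1-3)] by (rule integral_abs_bound)
  also have "\<dots> \<le> (\<integral>s. J s \<partial>U01)" by (rule integral_mono'[OF J le]) (simp add: J_def)
  also have "\<dots> = (1 / real n) ^ i * cell_dev w n k" by (simp add: J_def cell_dev_def a_def)
  finally show ?thesis by (simp add: a_def)
qed

text \<open>An integrated deviation says nothing about the path at a single time. For level 0 the
  bound is therefore claimed only at the right end of the cell, where the second term of
  \<open>cell_size\<close> provides it.\<close>

lemma abs_taylor_rem_le_size:
  assumes w: "bdd_borel w" and k: "k < n" and t: "t \<in> cell n k" and j: "1 \<le> j \<or> t = real (Suc k) / real n"
  shows "real n ^ j * sqrt (real n) * \<bar>taylor_rem j w (real k / real n) t\<bar> \<le> cell_size w n k"
proof (cases j)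
  case 0
  then have t: "t = real (Suc k) / real n" using j by simp
  have "0 \<le> real n * sqrt (real n) * cell_dev w n k" by (simp add: cell_dev_nonneg)
  then show ?thesis unfolding 0 t by (simp add: taylor_rem_def cell_size_def)
next
  case (Suc i)
  have n: "real n > 0" using k by simp
  have "real n ^ j * sqrt (real n) * \<bar>taylor_rem j w (real k / real n) t\<bar> \<le>
    real n ^ j * sqrt (real n) * ((1 / real n) ^ i * cell_dev w n k)"
    unfolding Suc by (intro mult_left_mono abs_taylor_rem_le w k t) auto
  also have "\<dots> = real n * sqrt (real n) * cell_dev w n k"
    using n by (simp add: Suc power_divide)
  also have "\<dots> \<le> cell_size w n k" by (simp add: cell_size_def)
  finally show ?thesis .
qed

text \<open>In this scaling the passage to the next grid point has the coefficients 1 / i!, free of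
  \<open>n\<close>, and an error of order 1, so that rounding to integers is the right resolution at
  every level.\<close>

definition state :: "nat \<Rightarrow> nat \<Rightarrow> (real \<Rightarrow> real) \<Rightarrow> nat \<Rightarrow> real" where
  "state n j w k = real n ^ j * sqrt (real n) * iter_int j w (real k / real n)"

lemma state_step:
  assumes w: "bdd_borel w" and k: "k < n"
  shows "\<bar>state n j w (Suc k) - (\<Sum>i\<le>j. state n (j - i) w k / fact i)\<bar> \<le> cell_size w n k"
proof -
  let ?a = "real k / real n" and ?t = "real (Suc k) / real n"
  have n: "real n > 0" using k by simp
  have ta: "?t - ?a = 1 / real n" by (simp add: diff_divide_distrib[symmetric])
  have "state n (j - i) w k / fact i = real n ^ j * sqrt (real n) * ((?t - ?a) ^ i / fact i * iter_int (j - i) w ?a)"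
    if "i \<le> j" for i
  proof -
    have "real n ^ (j - i) = real n ^ j * (1 / real n) ^ i"
      using n that by (simp add: power_diff power_divide)
    then show ?thesis unfolding state_def ta by (simp add: mult_ac)
  qed
  then have "(\<Sum>i\<le>j. state n (j - i) w k / fact i) =
    real n ^ j * sqrt (real n) * (\<Sum>i\<le>j. (?t - ?a) ^ i / fact i * iter_int (j - i) w ?a)"
    unfolding sum_distrib_left by (intro sum.cong) auto
  then have "state n j w (Suc k) - (\<Sum>i\<le>j. state n (j - i) w k / fact i) =
    real n ^ j * sqrt (real n) * taylor_rem j w ?a ?t"
    unfolding taylor_rem_def state_def by (simp only: right_diff_distrib)
  then have "\<bar>state n j w (Suc k) - (\<Sum>i\<le>j. state n (j - i) w k / fact i)\<bar> =
    real n ^ j * sqrt (real n) * \<bar>taylor_rem j w ?a ?t\<bar>"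
    by (simp add: abs_mult)
  also have "\<dots> \<le> cell_size w n k"
    using k by (intro abs_taylor_rem_le_size w) (auto simp: cell_def divide_right_mono)
  finally show ?thesis .
qed

text \<open>The rounded states themselves are unbounded; their innovations are of the size of the local
  oscillation of the path, which is what makes the codes few.\<close>

definition code :: "nat \<Rightarrow> (real \<Rightarrow> real) \<Rightarrow> nat \<times> nat \<Rightarrow> int" where
  "code n w = (\<lambda>(j, k). \<lfloor>state n j w (Suc k)\<rfloor> - \<lfloor>\<Sum>i\<le>j. real_of_int \<lfloor>state n (j - i) w k\<rfloor> / fact i\<rfloor>)"

text \<open>Rounding costs at most 1 for each of the \<open>j + 1\<close> terms of the sum and 1 for
  each of the two outer floors, \<open>j + 3\<close> in total.\<close>

lemma abs_code_le:
  assumes w: "bdd_borel w" and k: "k < n"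
  shows "\<bar>real_of_int (code n w (j, k))\<bar> \<le> cell_size w n k + real j + 3"
proof -
  let ?s = "state n j w (Suc k)" and ?S = "\<Sum>i\<le>j. state n (j - i) w k / fact i"
    and ?F = "\<Sum>i\<le>j. of_int \<lfloor>state n (j - i) w k\<rfloor> / fact i :: real"
  have "\<bar>?S - ?F\<bar> \<le> (\<Sum>i\<le>j. \<bar>state n (j - i) w k / fact i - of_int \<lfloor>state n (j - i) w k\<rfloor> / fact i\<bar>)"
    unfolding sum_subtractf[symmetric] by (rule sum_abs)
  also have "\<dots> \<le> (\<Sum>i\<le>j. 1)"
  proof (rule sum_mono)
    fix i
    have "\<bar>state n (j - i) w k / fact i - of_int \<lfloor>state n (j - i) w k\<rfloor> / fact i\<bar> =
      \<bar>state n (j - i) w k - of_int \<lfloor>state n (j - i) w k\<rfloor>\<bar> / fact i"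
      by (simp add: diff_divide_distrib[symmetric])
    also have "\<dots> \<le> 1 / 1" by (intro frac_le fact_ge_1) linarith+
    finally show "\<bar>state n (j - i) w k / fact i - of_int \<lfloor>state n (j - i) w k\<rfloor> / fact i\<bar> \<le> 1" by simp
  qed
  finally have "\<bar>?S - ?F\<bar> \<le> real j + 1" by simp
  moreover have "\<bar>?s - ?S\<bar> \<le> cell_size w n k" by (rule state_step[OF w k])
  moreover have "\<bar>?s - of_int \<lfloor>?s\<rfloor>\<bar> \<le> 1" "\<bar>?F - of_int \<lfloor>?F\<rfloor>\<bar> \<le> 1" by linarith+
  moreover have "real_of_int (code n w (j, k)) = of_int \<lfloor>?s\<rfloor> - of_int \<lfloor>?F\<rfloor>" by (simp add: code_def)
  ultimately show ?thesis by linarith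
qed

lemma state_0:
  assumes "w 0 = 0"
  shows "state n j w 0 = 0"
proof (cases j)
  case (Suc i)
  have "AE s in lborel. s \<noteq> (0::real)" by (rule AE_lborel_singleton)
  then have "AE s in U01. s \<noteq> 0" by (intro AE_U01_I) auto
  then have "AE s in U01. kern i 0 s * w s = 0" by eventually_elim (auto simp: kern_def)
  then have "iter_int (Suc i) w 0 = 0" unfolding iter_int_Suc by (rule integral_eq_zero_AE)
  then show ?thesis by (simp add: state_def Suc)
qed (use assms in \<open>simp add: state_def\<close>)

text \<open>The rounded states start at 0 and satisfy a recursion whose innovations are the code, so
  they can be recovered from it.\<close>

lemma floor_state_eq:
  assumes "w 0 = 0" "w' 0 = 0" and eq: "\<And>i. i \<in> {..m} \<times> {..<n} \<Longrightarrow> code n w i = code n w' i"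
  shows "k \<le> n \<Longrightarrow> j \<le> m \<Longrightarrow> \<lfloor>state n j w k\<rfloor> = \<lfloor>state n j w' k\<rfloor>"
proof (induction k arbitrary: j)
  case 0
  then show ?case using assms by (simp add: state_0)
next
  case (Suc k)
  then have "(\<Sum>i\<le>j. real_of_int \<lfloor>state n (j - i) w k\<rfloor> / fact i) = (\<Sum>i\<le>j. of_int \<lfloor>state n (j - i) w' k\<rfloor> / fact i)"
    by (intro sum.cong refl) auto
  with eq[of "(j, k)"] Suc.prems show ?case by (simp add: code_def)
qed

text \<open>From z \<le> p exp (z / p) with z the larger of \<open>x\<close> and \<open>y\<close>.
  The p-th powers of cell sizes are thus paid for by exponentials, whose sum the good event
  bounds.\<close>

lemma powr_le_exp_add:
  fixes p a x y :: real
  assumes "1 \<le> p" "0 \<le> a" "0 \<le> x" "0 \<le> y"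
  shows "(a + x + y) powr p \<le> (a + 2 * p) powr p * (exp x + exp y)"
proof -
  define z where "z = max x y"
  have "z / p \<le> exp (z / p)" using exp_ge_add_one_self[of "z / p"] by linarith
  then have "z \<le> p * exp (z / p)" using assms by (simp add: field_simps)
  moreover have "1 \<le> exp (z / p)" using assms by (auto simp: z_def)
  then have "a * 1 \<le> a * exp (z / p)" using assms by (intro mult_left_mono) auto
  moreover have "a + x + y \<le> a + 2 * z" by (auto simp: z_def)
  ultimately have "a + x + y \<le> (a + 2 * p) * exp (z / p)" by (simp add: algebra_simps)
  then have "(a + x + y) powr p \<le> ((a + 2 * p) * exp (z / p)) powr p"
    using assms by (intro powr_mono2) auto
  also have "\<dots> = (a + 2 * p) powr p * exp z"
    using assms by (simp add: powr_mult powr_def[of "exp (z / p)"])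
  also have "\<dots> \<le> (a + 2 * p) powr p * (exp x + exp y)"
    by (intro mult_left_mono) (auto simp: z_def max_def)
  finally show ?thesis .
qed

text \<open>Both paths are expanded at the left end of the cell. States with equal floors differ by
  at most 1, so each of the \<open>m + 1\<close> Taylor terms contributes at most 1; the remainders
  are bounded by the cell sizes.\<close>

lemma iter_int_diff_le:
  assumes w: "bdd_borel w" "bdd_borel w'" and k: "k < n" and t: "t \<in> cell n k" and m: "1 \<le> m"
    and eq: "\<And>j. j \<le> m \<Longrightarrow> \<lfloor>state n j w k\<rfloor> = \<lfloor>state n j w' k\<rfloor>"
  shows "real n ^ m * sqrt (real n) * \<bar>iter_int m w t - iter_int m w' t\<bar> \<le>
    real (Suc m) + cell_size w n k + cell_size w' n k"
proof -
  let ?a = "real k / real n" and ?H = "\<lambda>j. real n ^ j * sqrt (real n)"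
  have n: "real n > 0" using k by simp
  have ta: "0 \<le> t - ?a" "t - ?a \<le> 1 / real n"
    using t by (auto simp: cell_def add_divide_distrib)
  have "?H m * (iter_int m w t - iter_int m w' t) =
    (\<Sum>i\<le>m. (t - ?a) ^ i / fact i * (?H m * (iter_int (m - i) w ?a - iter_int (m - i) w' ?a)))
    + ?H m * taylor_rem m w ?a t - ?H m * taylor_rem m w' ?a t"
    unfolding taylor_rem_def
    by (simp add: sum_subtractf algebra_simps sum_distrib_left)
  moreover have "\<bar>\<Sum>i\<le>m. (t - ?a) ^ i / fact i * (?H m * (iter_int (m - i) w ?a - iter_int (m - i) w' ?a))\<bar> \<le> (\<Sum>i\<le>m. 1)"
  proof (rule order_trans[OF sum_abs sum_mono])
    fix i assume i: "i \<in> {..m}"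
    have "\<bar>state n (m - i) w k - state n (m - i) w' k\<bar> \<le> 1"
      using eq[of "m - i"] by linarith
    then have S: "?H (m - i) * \<bar>iter_int (m - i) w ?a - iter_int (m - i) w' ?a\<bar> \<le> 1"
      unfolding state_def right_diff_distrib[symmetric] by (simp add: abs_mult)
    have H: "?H m = real n ^ i * ?H (m - i)" using i by (simp add: power_add[symmetric])
    have "(t - ?a) ^ i * real n ^ i \<le> (1 / real n) ^ i * real n ^ i"
      using ta by (intro mult_right_mono power_mono) auto
    then have T: "(t - ?a) ^ i * real n ^ i \<le> 1" using n by (simp add: power_divide)
    have "\<bar>(t - ?a) ^ i / fact i * (?H m * (iter_int (m - i) w ?a - iter_int (m - i) w' ?a))\<bar> =
      ((t - ?a) ^ i * real n ^ i) * (?H (m - i) * \<bar>iter_int (m - i) w ?a - iter_int (m - i) w' ?a\<bar>) / fact i"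
      unfolding H using ta by (simp add: abs_mult mult_ac)
    also have "\<dots> \<le> 1 * 1 / 1"
      using ta by (intro frac_le mult_mono T S fact_ge_1) auto
    finally show "\<bar>(t - ?a) ^ i / fact i * (?H m * (iter_int (m - i) w ?a - iter_int (m - i) w' ?a))\<bar> \<le> 1" by simp
  qed
  moreover have "\<bar>?H m * taylor_rem m w ?a t\<bar> \<le> cell_size w n k" "\<bar>?H m * taylor_rem m w' ?a t\<bar> \<le> cell_size w' n k"
    using abs_taylor_rem_le_size[OF w(1) k t] abs_taylor_rem_le_size[OF w(2) k t] m by (auto simp: abs_mult)
  ultimately have "\<bar>?H m * (iter_int m w t - iter_int m w' t)\<bar> \<le> real (Suc m) + cell_size w n k + cell_size w' n k"
    by simp
  then show ?thesis by (simp add: abs_mult)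
qed

text \<open>The bound on a cell is raised to the power \<open>p\<close> and summed over cells of
  measure 1 / n. Each path contributes 36, hence the 72.\<close>

lemma int_norm_diff_le:
  assumes p: "1 \<le> p" and m: "1 \<le> m" and n: "0 < n" and w: "bdd_borel w" "bdd_borel w'" "w 0 = 0" "w' 0 = 0"
    and eq: "\<And>i. i \<in> {..m} \<times> {..<n} \<Longrightarrow> code n w i = code n w' i"
    and size: "(\<Sum>k<n. exp (cell_size w n k)) \<le> 36 * real n" "(\<Sum>k<n. exp (cell_size w' n k)) \<le> 36 * real n"
  shows "int_norm p m (\<lambda>t. w t - w' t) \<le> (real (Suc m) + 2 * p) * 72 powr (1 / p) / (real n ^ m * sqrt (real n))"
proof -
  define C where "C = (real (Suc m) + 2 * p) powr p"
  define H where "H = real n ^ m * sqrt (real n)"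
  have H: "H > 0" using n by (simp add: H_def)
  have bd: "bdd_borel (\<lambda>t. w t - w' t)" using bdd_borel_lincomb[OF w(1,2), of 1 "-1"] by simp
  define \<Delta> where "\<Delta> = iter_int m (\<lambda>t. w t - w' t)"
  have b\<Delta>: "bdd_borel \<Delta>" unfolding \<Delta>_def by (rule bdd_borel_iter_int[OF bd])
  have \<Delta>: "\<Delta> t = iter_int m w t - iter_int m w' t" for t
    using iter_int_lincomb[OF w(1,2), of m 1 "-1" t] by (simp add: \<Delta>_def)
  define b where "b t = (C / H powr p) * (\<Sum>k<n. (exp (cell_size w n k) + exp (cell_size w' n k)) * indicator (cell n k) t)" for t
  have ind: "integrable U01 (indicator (cell n k) :: real \<Rightarrow> real)" for k
    by (intro integrable_bdd_borel bdd_borel_indicator) measurable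
  have ib: "integrable U01 b" unfolding b_def
    by (intro integrable_mult_right Bochner_Integration.integrable_sum ind)
  \<comment> \<open>Rounding \<open>n * t\<close> down names one of the \<open>n\<close> cells only
    for \<open>t < 1\<close>; the end point is a null set.\<close>
  have le: "\<bar>\<Delta> t\<bar> powr p \<le> b t" if t: "t \<in> {0..<1}" for t
  proof -
    define k where "k = nat \<lfloor>real n * t\<rfloor>"
    have "real n * t < real n * 1" using t n by (intro mult_strict_left_mono) auto
    then have k: "k < n" using n t by (simp add: k_def floor_less_iff nat_less_iff)
    have rk: "real k = of_int \<lfloor>real n * t\<rfloor>" using t by (simp add: k_def)
    have "real k \<le> real n * t" "real n * t \<le> real k + 1" unfolding rk by linarith+
    then have tk: "t \<in> cell n k"
      using n by (simp add: cell_def pos_divide_le_eq pos_le_divide_eq mult.commute)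
    have "H * \<bar>\<Delta> t\<bar> \<le> real (Suc m) + cell_size w n k + cell_size w' n k"
      unfolding H_def \<Delta>
      using k by (intro iter_int_diff_le w tk m floor_state_eq[OF w(3,4) eq]) auto
    then have "(H * \<bar>\<Delta> t\<bar>) powr p \<le> (real (Suc m) + cell_size w n k + cell_size w' n k) powr p"
      using H p by (intro powr_mono2) auto
    also have "\<dots> \<le> C * (exp (cell_size w n k) + exp (cell_size w' n k))"
      unfolding C_def by (intro powr_le_exp_add p cell_size_nonneg) auto
    also have "\<dots> = C * (\<Sum>l\<in>{k}. (exp (cell_size w n l) + exp (cell_size w' n l)) * indicator (cell n l) t)"
      using tk by simp
    also have "\<dots> \<le> C * (\<Sum>l<n. (exp (cell_size w n l) + exp (cell_size w' n l)) * indicator (cell n l) t)"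
      using k by (intro mult_left_mono sum_mono2) (auto simp: C_def intro!: add_nonneg_nonneg mult_nonneg_nonneg)
    finally have "H powr p * \<bar>\<Delta> t\<bar> powr p \<le> C * (\<Sum>l<n. (exp (cell_size w n l) + exp (cell_size w' n l)) * indicator (cell n l) t)"
      using H by (simp add: powr_mult)
    then show ?thesis using H by (simp add: b_def field_simps)
  qed
  have "AE t in lborel. t \<noteq> (1::real)" by (rule AE_lborel_singleton)
  then have AE1: "AE t in U01. t \<in> {0..<1}" by (intro AE_U01_I) auto
  have "(\<integral>t. \<bar>\<Delta> t\<bar> powr p \<partial>U01) \<le> (\<integral>t. b t \<partial>U01)"
  proof (rule integral_mono_AE)
    show "integrable U01 (\<lambda>t. \<bar>\<Delta> t\<bar> powr p)" using p by (intro integrable_bdd_borel bdd_borel_abs_powr b\<Delta>) auto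
    show "AE t in U01. \<bar>\<Delta> t\<bar> powr p \<le> b t" using AE1 by eventually_elim (rule le)
  qed (rule ib)
  also have "\<dots> = (C / H powr p) * (\<Sum>k<n. (exp (cell_size w n k) + exp (cell_size w' n k)) * measure U01 (cell n k))"
  proof -
    have "(\<integral>t. indicator (cell n k) t \<partial>U01) = measure U01 (cell n k)" for k by simp
    then show ?thesis
      unfolding b_def Bochner_Integration.integral_mult_right_zero using ind
      by (subst Bochner_Integration.integral_sum)
         (simp_all only: integrable_mult_right Bochner_Integration.integral_mult_right_zero)
  qed
  also have "(\<Sum>k<n. (exp (cell_size w n k) + exp (cell_size w' n k)) * measure U01 (cell n k)) =
    ((\<Sum>k<n. exp (cell_size w n k)) + (\<Sum>k<n. exp (cell_size w' n k))) / real n"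
    by (simp add: measure_cell sum_divide_distrib[symmetric] sum.distrib add_divide_distrib)
  also have "(C / H powr p) * \<dots> \<le> (C / H powr p) * 72"
    using size n by (intro mult_left_mono) (auto simp: C_def field_simps)
  finally have I: "(\<integral>t. \<bar>\<Delta> t\<bar> powr p \<partial>U01) \<le> C / H powr p * 72" .
  have "int_norm p m (\<lambda>t. w t - w' t) = (\<integral>t. \<bar>\<Delta> t\<bar> powr p \<partial>U01) powr (1 / p)"
    unfolding int_norm_def \<Delta>_def[symmetric] by (rule Lp_norm01_eq[OF bdd_borel_measurable[OF b\<Delta>]])
  also have "\<dots> \<le> (C / H powr p * 72) powr (1 / p)"
    using I p by (intro powr_mono2) auto
  also have "\<dots> = (real (Suc m) + 2 * p) * 72 powr (1 / p) / H"
    using p H by (simp add: C_def powr_mult powr_divide powr_powr)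
  finally show ?thesis by (simp add: H_def)
qed

section \<open>Counting integer sequences of bounded total size\<close>

lemma sum_half_powr_abs_le:
  "(\<Sum>v\<in>{- int K..int K}. (1 / 2 :: real) ^ nat \<bar>v\<bar>) \<le> 3 - 2 * (1 / 2) ^ K"
proof (induction K)
  case (Suc K)
  have "{- int (Suc K)..int (Suc K)} = insert (int (Suc K)) (insert (- int (Suc K)) {- int K..int K})"
    by auto
  then have "(\<Sum>v\<in>{- int (Suc K)..int (Suc K)}. (1 / 2 :: real) ^ nat \<bar>v\<bar>) =
    2 * (1 / 2) ^ Suc K + (\<Sum>v\<in>{- int K..int K}. (1 / 2 :: real) ^ nat \<bar>v\<bar>)"
    by (simp del: of_nat_Suc)
  then show ?case using Suc by simp
qed simp

text \<open>A generating function bound. With the weight 2^(-\<bar>v\<bar>) on each entry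
  \<open>v\<close>, every counted sequence weighs at least 2^(-L), while the total weight factorizes
  over \<open>I\<close> into geometric sums of at most 3.\<close>

lemma card_bounded_codes_le:
  fixes I :: "'i set" and L :: nat
  assumes I: "finite I"
  defines "Z \<equiv> {z \<in> I \<rightarrow>\<^sub>E UNIV. (\<Sum>i\<in>I. nat \<bar>z i :: int\<bar>) \<le> L}"
  shows "finite Z" "real (card Z) \<le> 2 ^ L * 3 ^ card I"
proof -
  let ?P = "I \<rightarrow>\<^sub>E {- int L..int L}"
  have fin: "finite ?P" using I by (intro finite_PiE) auto
  have sub: "Z \<subseteq> ?P"
  proof
    fix z assume z: "z \<in> Z"
    show "z \<in> ?P"
    proof (rule PiE_I)
      fix i assume i: "i \<in> I"
      have "nat \<bar>z i\<bar> \<le> (\<Sum>i\<in>I. nat \<bar>z i\<bar>)" using I i by (intro member_le_sum) auto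
      also have "\<dots> \<le> L" using z by (simp add: Z_def)
      finally show "z i \<in> {- int L..int L}" by auto
    next
      fix i assume "i \<notin> I"
      then show "z i = undefined" using z by (auto simp: Z_def PiE_def extensional_def)
    qed
  qed
  then show finZ: "finite Z" using fin by (rule finite_subset)
  have "real (card Z) = (\<Sum>z\<in>Z. 1)" by simp
  also have "\<dots> \<le> (\<Sum>z\<in>Z. 2 ^ L * (\<Prod>i\<in>I. (1 / 2) ^ nat \<bar>z i\<bar>))"
  proof (rule sum_mono)
    fix z assume "z \<in> Z"
    then have "(2::real) ^ (\<Sum>i\<in>I. nat \<bar>z i\<bar>) \<le> 2 ^ L" by (intro power_increasing) (auto simp: Z_def)
    then show "1 \<le> 2 ^ L * (\<Prod>i\<in>I. (1 / 2 :: real) ^ nat \<bar>z i\<bar>)"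
      unfolding power_sum[symmetric] by (simp add: power_one_over field_simps)
  qed
  also have "\<dots> \<le> (\<Sum>z\<in>?P. 2 ^ L * (\<Prod>i\<in>I. (1 / 2) ^ nat \<bar>z i\<bar>))"
    using fin sub by (intro sum_mono2 mult_nonneg_nonneg prod_nonneg) auto
  also have "\<dots> = 2 ^ L * (\<Prod>i\<in>I. \<Sum>v\<in>{- int L..int L}. (1 / 2) ^ nat \<bar>v\<bar>)"
    unfolding sum_distrib_left[symmetric] using I by (subst prod_sum_PiE) auto
  also have "\<dots> \<le> 2 ^ L * (\<Prod>i\<in>I. 3)"
  proof (intro mult_left_mono prod_mono conjI)
    show "(\<Sum>v\<in>{- int L..int L}. (1 / 2 :: real) ^ nat \<bar>v\<bar>) \<le> 3"
      using sum_half_powr_abs_le[of L] by (rule order_trans) simp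
  qed (auto intro!: sum_nonneg)
  finally show "real (card Z) \<le> 2 ^ L * 3 ^ card I" by simp
qed

subsection \<open>Small balls and the tail estimate\<close>

text \<open>Jensen's inequality for the average over a cell, through the tangent of \<open>exp\<close> at the average.\<close>

lemma exp_cell_size_le:
  assumes w: "bdd_borel w" and k: "k < n"
  defines "g \<equiv> \<lambda>s. sqrt (real n) * \<bar>w s - w (real k / real n)\<bar>"
  shows "exp (cell_size w n k) \<le>
    (real n * (\<integral>s. indicator (cell n k) s * exp (2 * g s) \<partial>U01) + exp (2 * g (real (Suc k) / real n))) / 2"
proof -
  have n: "real n > 0" using k by simp
  define G where "G = real n * sqrt (real n) * cell_dev w n k"
  define b where "b = g (real (Suc k) / real n)"
  have bg: "bdd_borel g"
  proof -
    have "bdd_borel (\<lambda>s. w s - w (real k / real n))" using bdd_borel_lincomb[OF w bdd_borel_const, of 1 "-1"] by simp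
    from bdd_borel_abs_powr[OF this, of 1] show ?thesis unfolding g_def by (intro bdd_borel_mult bdd_borel_const) simp
  qed
  have be: "bdd_borel (\<lambda>s. exp (2 * g s))"
  proof -
    obtain B where B: "\<And>t. \<bar>g t\<bar> \<le> B" using bg by (meson bdd_borelE)
    have [measurable]: "g \<in> borel_measurable borel" using bg by (rule bdd_borel_measurable)
    show ?thesis
    proof (rule bdd_borelI)
      show "\<bar>exp (2 * g t)\<bar> \<le> exp (2 * B)" for t using B[of t] by simp
    qed measurable
  qed
  have ic: "bdd_borel (indicator (cell n k))" by (intro bdd_borel_indicator) measurable
  have i1: "integrable U01 (indicator (cell n k) :: real \<Rightarrow> real)" by (rule integrable_bdd_borel[OF ic])
  have i2: "integrable U01 (\<lambda>s. indicator (cell n k) s * g s)" by (intro integrable_bdd_borel bdd_borel_mult ic bg)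
  have i3: "integrable U01 (\<lambda>s. indicator (cell n k) s * exp (2 * g s))" by (intro integrable_bdd_borel bdd_borel_mult ic be)
  have m1: "(\<integral>s. indicator (cell n k) s \<partial>U01) = 1 / real n" using measure_cell[OF k] by simp
  have "(\<integral>s. indicator (cell n k) s * g s \<partial>U01) = (\<integral>s. sqrt (real n) * (indicator (cell n k) s * \<bar>w s - w (real k / real n)\<bar>) \<partial>U01)"
    by (simp add: g_def mult_ac)
  then have m2: "real n * (\<integral>s. indicator (cell n k) s * g s \<partial>U01) = G"
    by (simp add: G_def cell_dev_def)
  have size: "cell_size w n k = G + b" by (simp add: cell_size_def G_def b_def g_def)
  \<comment> \<open>Everything is written as an integral over the cell, where the mean of
    \<open>g\<close> is \<open>G\<close>, so that the tangent inequality can be applied under the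
    integral.\<close>
  have "exp (G + b) = real n * (exp (G + b) * (1 - G) * (1 / real n)) + exp (G + b) * G"
    using n by (simp add: algebra_simps)
  also have "\<dots> = real n * (\<integral>s. exp (G + b) * (1 - G) * indicator (cell n k) s + exp (G + b) * (indicator (cell n k) s * g s) \<partial>U01)"
    using i1 i2 m1 m2[symmetric] by (simp add: distrib_left)
  also have "\<dots> \<le> real n * (\<integral>s. (1 / 2) * (indicator (cell n k) s * exp (2 * g s)) + (exp (2 * b) / 2) * indicator (cell n k) s \<partial>U01)"
  proof (intro mult_left_mono integral_mono)
    fix s
    have "exp (G + b) * (1 - G) + exp (G + b) * g s = exp (G + b) * (1 + (g s - G))" by (simp add: algebra_simps)
    also have "\<dots> \<le> exp (G + b) * exp (g s - G)"
      by (intro mult_left_mono) auto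
    also have "\<dots> = exp (g s) * exp b" by (simp add: mult_exp_exp)
    \<comment> \<open>The two terms of \<open>cell_size\<close> are dependent. The
      arithmetic-geometric mean inequality separates them at the price of doubling the
      exponents.\<close>
    also have "\<dots> \<le> ((exp (g s))\<^sup>2 + (exp b)\<^sup>2) / 2" using sum_squares_bound[of "exp (g s)" "exp b"] by simp
    also have "\<dots> = (1 / 2) * exp (2 * g s) + exp (2 * b) / 2"
      by (simp add: exp_double)
    finally show "exp (G + b) * (1 - G) * indicator (cell n k) s + exp (G + b) * (indicator (cell n k) s * g s)
        \<le> (1 / 2) * (indicator (cell n k) s * exp (2 * g s)) + (exp (2 * b) / 2) * indicator (cell n k) s"
      by (auto split: split_indicator)
  qed (use i1 i2 i3 in auto)
  also have "\<dots> = (real n * (\<integral>s. indicator (cell n k) s * exp (2 * g s) \<partial>U01) + exp (2 * b)) / 2"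
  proof -
    have "(\<integral>s. (1 / 2) * (indicator (cell n k) s * exp (2 * g s)) + (exp (2 * b) / 2) * indicator (cell n k) s \<partial>U01) =
      (1 / 2) * (\<integral>s. indicator (cell n k) s * exp (2 * g s) \<partial>U01) + (exp (2 * b) / 2) * (\<integral>s. indicator (cell n k) s \<partial>U01)"
      using i1 i3 by simp
    then show ?thesis unfolding m1 using n by (simp add: algebra_simps)
  qed
  finally show ?thesis unfolding size b_def .
qed

section \<open>Exponential moments of cell fluctuations and the small ball bound\<close>

context brownian
begin

text \<open>The Gaussian moment is exp (c^2 (t - s) / 2), at most exp 2 and so at most 9; it is
  taken once for each sign of the increment.\<close>

lemma nn_integral_exp_abs_increment_le:
  assumes st: "0 \<le> s" "s \<le> t" and c: "c\<^sup>2 * (t - s) \<le> 4"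
  shows "(\<integral>\<^sup>+\<omega>. ennreal (exp (c * \<bar>W t \<omega> - W s \<omega>\<bar>)) \<partial>M) \<le> 18"
proof (cases "s = t")
  case True
  then show ?thesis by (simp add: emeasure_space_1)
next
  case False
  then have lt: "s < t" using st by simp
  let ?d = "\<lambda>\<omega>. W t \<omega> - W s \<omega>"
  have dm: "?d \<in> borel_measurable M" using st by (intro borel_measurable_diff W_measurable) auto
  have E: "(\<integral>\<^sup>+\<omega>. ennreal (exp (l * ?d \<omega>)) \<partial>M) \<le> 9" if l: "l\<^sup>2 = c\<^sup>2" for l
  proof -
    have "(\<integral>\<^sup>+\<omega>. ennreal (exp (l * ?d \<omega>)) \<partial>M) = (\<integral>\<^sup>+x. ennreal (exp (l * x)) \<partial>distr M borel ?d)"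
      using dm by (subst nn_integral_distr) auto
    also have "\<dots> = ennreal (exp (l\<^sup>2 * (sqrt (t - s))\<^sup>2 / 2))"
      unfolding distr_incrs[OF st(1) lt] using lt by (intro nn_integral_exp_normal) auto
    also have "l\<^sup>2 * (sqrt (t - s))\<^sup>2 / 2 \<le> 2" using c lt l by simp
    then have "exp (l\<^sup>2 * (sqrt (t - s))\<^sup>2 / 2) \<le> exp (1 + 1)" by simp
    also have "exp (1 + 1 :: real) \<le> 3 * 3" unfolding exp_add by (intro mult_mono exp_le) auto
    finally show ?thesis by (simp add: ennreal_leI)
  qed
  have "(\<integral>\<^sup>+\<omega>. ennreal (exp (c * \<bar>?d \<omega>\<bar>)) \<partial>M) \<le> (\<integral>\<^sup>+\<omega>. ennreal (exp (c * ?d \<omega>)) + ennreal (exp ((- c) * ?d \<omega>)) \<partial>M)"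
  proof (rule nn_integral_mono)
    fix \<omega>
    have "exp (c * \<bar>x\<bar>) \<le> exp (c * x) + exp ((- c) * x)" for x
      by (cases "0 \<le> x") simp_all
    then show "ennreal (exp (c * \<bar>?d \<omega>\<bar>)) \<le> ennreal (exp (c * ?d \<omega>)) + ennreal (exp ((- c) * ?d \<omega>))"
      by (simp add: ennreal_plus[symmetric] ennreal_leI del: ennreal_plus)
  qed
  also have "\<dots> = (\<integral>\<^sup>+\<omega>. ennreal (exp (c * ?d \<omega>)) \<partial>M) + (\<integral>\<^sup>+\<omega>. ennreal (exp ((- c) * ?d \<omega>)) \<partial>M)"
    using dm by (intro nn_integral_add) auto
  also have "\<dots> \<le> 9 + 9" by (intro add_mono E) auto
  finally show ?thesis by simp
qed

lemma path01_measurable_at: "(\<lambda>\<omega>. path01 \<omega> s) \<in> borel_measurable M"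
  unfolding path01_def by (rule W_measurable) simp

lemma path01_measurable_swap: "(\<lambda>z. path01 (fst z) (snd z)) \<in> borel_measurable (M \<Otimes>\<^sub>M U01)"
  using measurable_compose[OF _ path01_measurable, of "\<lambda>z. (snd z, fst z)" "M \<Otimes>\<^sub>M U01"] by simp

lemma cell_size_measurable: "(\<lambda>\<omega>. cell_size (path01 \<omega>) n k) \<in> borel_measurable M"
proof -
  note [measurable] = path01_measurable_at path01_measurable_swap
  have [measurable]: "(\<lambda>\<omega>. cell_dev (path01 \<omega>) n k) \<in> borel_measurable M"
    unfolding cell_dev_def
    by (rule U01.borel_measurable_lebesgue_integral) (simp add: case_prod_beta')
  show ?thesis unfolding cell_size_def by measurable
qed

text \<open>The average over the cell and the end point in \<open>exp_cell_size_le\<close> each have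
  expectation at most 18 and enter with weight 1 / 2.\<close>

lemma nn_integral_exp_cell_size_le:
  assumes k: "k < n"
  shows "(\<integral>\<^sup>+\<omega>. ennreal (exp (cell_size (path01 \<omega>) n k)) \<partial>M) \<le> 18"
proof -
  note [measurable] = path01_measurable_at path01_measurable_swap
  have n: "real n > 0" using k by simp
  let ?a = "real k / real n" and ?b = "real (Suc k) / real n"
  define g where "g \<omega> s = sqrt (real n) * \<bar>path01 \<omega> s - path01 \<omega> ?a\<bar>" for \<omega> s
  have gm [measurable]: "(\<lambda>\<omega>. g \<omega> s) \<in> borel_measurable M" for s unfolding g_def by measurable
  have gm2 [measurable]: "(\<lambda>z. g (fst z) (snd z)) \<in> borel_measurable (M \<Otimes>\<^sub>M U01)" unfolding g_def by measurable
  have E: "(\<integral>\<^sup>+\<omega>. ennreal (exp (2 * g \<omega> s)) \<partial>M) \<le> 18" if s: "s \<in> cell n k" for s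
  proof -
    have sa: "?a \<le> s" "s \<le> ?a + 1 / real n" using s by (auto simp: cell_def add_divide_distrib)
    \<comment> \<open>The doubled exponent 2 sqrt n times the cell length: (2 sqrt n)^2 / n = 4 is
      the origin of the bound 4 in \<open>nn_integral_exp_abs_increment_le\<close>.\<close>
    have "real n * (s - ?a) \<le> real n * (1 / real n)" using sa n by (intro mult_left_mono) auto
    then have "(2 * sqrt (real n))\<^sup>2 * (s - ?a) \<le> 4" using n by (simp add: power_mult_distrib)
    moreover have "0 \<le> ?a" by simp
    moreover have "path01 \<omega> s = W s \<omega>" "path01 \<omega> ?a = W ?a \<omega>" for \<omega>
      using s cell_subset[OF k] sa by (auto simp: path01_def clamp01_id subset_iff cell_def)
    ultimately show ?thesis
      using nn_integral_exp_abs_increment_le[of ?a s "2 * sqrt (real n)"] sa by (simp add: g_def mult.assoc)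
  qed
  have bC: "?b \<in> cell n k" by (auto simp: cell_def divide_right_mono)
  have "(\<integral>\<^sup>+\<omega>. ennreal (exp (cell_size (path01 \<omega>) n k)) \<partial>M) \<le>
    (\<integral>\<^sup>+\<omega>. ennreal (real n / 2) * (\<integral>\<^sup>+s. ennreal (exp (2 * g \<omega> s)) * indicator (cell n k) s \<partial>U01) + ennreal (1 / 2) * ennreal (exp (2 * g \<omega> ?b)) \<partial>M)"
  proof (rule nn_integral_mono)
    fix \<omega> assume \<omega>: "\<omega> \<in> space M"
    have w: "bdd_borel (path01 \<omega>)" by (rule bdd_borel_path01[OF \<omega>])
    have bg: "bdd_borel (g \<omega>)"
    proof -
      have "bdd_borel (\<lambda>s. path01 \<omega> s - path01 \<omega> ?a)" using bdd_borel_lincomb[OF w bdd_borel_const, of 1 "-1"] by simp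
      from bdd_borel_abs_powr[OF this, of 1] show ?thesis unfolding g_def[abs_def] by (intro bdd_borel_mult bdd_borel_const) simp
    qed
    obtain B where B: "\<And>t. \<bar>g \<omega> t\<bar> \<le> B" using bg by (meson bdd_borelE)
    have [measurable]: "g \<omega> \<in> borel_measurable borel" using bg by (rule bdd_borel_measurable)
    have int: "integrable U01 (\<lambda>s. indicator (cell n k) s * exp (2 * g \<omega> s))"
    proof (intro integrable_bdd_borel bdd_borelI)
      show "\<bar>indicator (cell n k) s * exp (2 * g \<omega> s)\<bar> \<le> exp (2 * B)" for s
        using B[of s] by (auto split: split_indicator)
    qed measurable
    have "ennreal (\<integral>s. indicator (cell n k) s * exp (2 * g \<omega> s) \<partial>U01) =
        (\<integral>\<^sup>+s. ennreal (indicator (cell n k) s * exp (2 * g \<omega> s)) \<partial>U01)"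
      by (rule nn_integral_eq_integral[symmetric, OF int]) auto
    also have "\<dots> = (\<integral>\<^sup>+s. ennreal (exp (2 * g \<omega> s)) * indicator (cell n k) s \<partial>U01)"
      by (intro nn_integral_cong) (auto split: split_indicator)
    finally have eq: "ennreal (\<integral>s. indicator (cell n k) s * exp (2 * g \<omega> s) \<partial>U01) = \<dots>" .
    have nn: "0 \<le> (\<integral>s. indicator (cell n k) s * exp (2 * g \<omega> s) \<partial>U01)" by (intro integral_nonneg_AE AE_I2) auto
    have "exp (cell_size (path01 \<omega>) n k) \<le> real n / 2 * (\<integral>s. indicator (cell n k) s * exp (2 * g \<omega> s) \<partial>U01) + 1 / 2 * exp (2 * g \<omega> ?b)"
      using exp_cell_size_le[OF w k] unfolding g_def by (simp add: add_divide_distrib)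
    then have "ennreal (exp (cell_size (path01 \<omega>) n k)) \<le>
      ennreal (real n / 2 * (\<integral>s. indicator (cell n k) s * exp (2 * g \<omega> s) \<partial>U01) + 1 / 2 * exp (2 * g \<omega> ?b))"
      by (rule ennreal_leI)
    also have "\<dots> = ennreal (real n / 2) * ennreal (\<integral>s. indicator (cell n k) s * exp (2 * g \<omega> s) \<partial>U01) + ennreal (1 / 2) * ennreal (exp (2 * g \<omega> ?b))"
    proof -
      have "ennreal (x * u + y * v) = ennreal x * ennreal u + ennreal y * ennreal v"
        if "0 \<le> x" "0 \<le> u" "0 \<le> y" "0 \<le> v" for x u y v :: real
        using that by (simp add: ennreal_mult)
      from this[OF _ nn, of "real n / 2" "1 / 2" "exp (2 * g \<omega> ?b)"] show ?thesis by simp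
    qed
    finally show "ennreal (exp (cell_size (path01 \<omega>) n k)) \<le> ennreal (real n / 2) * (\<integral>\<^sup>+s. ennreal (exp (2 * g \<omega> s)) * indicator (cell n k) s \<partial>U01) + ennreal (1 / 2) * ennreal (exp (2 * g \<omega> ?b))"
      unfolding eq .
  qed
  also have "\<dots> = ennreal (real n / 2) * (\<integral>\<^sup>+\<omega>. (\<integral>\<^sup>+s. ennreal (exp (2 * g \<omega> s)) * indicator (cell n k) s \<partial>U01) \<partial>M)
      + ennreal (1 / 2) * (\<integral>\<^sup>+\<omega>. ennreal (exp (2 * g \<omega> ?b)) \<partial>M)"
  proof -
    have [measurable]: "(\<lambda>\<omega>. \<integral>\<^sup>+s. ennreal (exp (2 * g \<omega> s)) * indicator (cell n k) s \<partial>U01) \<in> borel_measurable M"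
      by (rule U01.borel_measurable_nn_integral) (simp add: case_prod_beta')
    show ?thesis by (subst nn_integral_add) (auto simp: nn_integral_cmult)
  qed
  also have "(\<integral>\<^sup>+\<omega>. (\<integral>\<^sup>+s. ennreal (exp (2 * g \<omega> s)) * indicator (cell n k) s \<partial>U01) \<partial>M) =
      (\<integral>\<^sup>+s. (\<integral>\<^sup>+\<omega>. ennreal (exp (2 * g \<omega> s)) * indicator (cell n k) s \<partial>M) \<partial>U01)"
  proof -
    interpret Q: pair_sigma_finite M U01 ..
    show ?thesis by (rule Q.Fubini'[symmetric]) (simp add: case_prod_beta')
  qed
  also have "\<dots> \<le> (\<integral>\<^sup>+s. 18 * indicator (cell n k) s \<partial>U01)"
  proof (rule nn_integral_mono)
    fix s
    show "(\<integral>\<^sup>+\<omega>. ennreal (exp (2 * g \<omega> s)) * indicator (cell n k) s \<partial>M) \<le> 18 * indicator (cell n k) s"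
      using E[of s] by (cases "s \<in> cell n k") auto
  qed
  also have "\<dots> = 18 * ennreal (1 / real n)"
    using measure_cell[OF k] by (simp add: nn_integral_cmult_indicator sets_U01 U01.emeasure_eq_measure)
  also have "ennreal (real n / 2) * (18 * ennreal (1 / real n)) + ennreal (1 / 2) * (\<integral>\<^sup>+\<omega>. ennreal (exp (2 * g \<omega> ?b)) \<partial>M)
    \<le> ennreal (real n / 2) * (18 * ennreal (1 / real n)) + ennreal (1 / 2) * 18"
    by (intro add_left_mono mult_left_mono E bC) auto
  also have "\<dots> = 18"
  proof -
    have n2: "0 \<le> real n / 2" and e18: "(0::real) \<le> 18" and half: "(0::real) \<le> 1 / 2" by simp_all
    have "ennreal 9 = ennreal (real n / 2 * (18 * (1 / real n)))" using n by simp
    then have 1: "ennreal (real n / 2) * (18 * ennreal (1 / real n)) = 9"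
      unfolding ennreal_mult'[OF n2] ennreal_mult'[OF e18] by simp
    have "ennreal 9 = ennreal (1 / 2 * 18)" by simp
    then have 2: "ennreal (1 / 2) * 18 = 9" unfolding ennreal_mult'[OF half] by simp
    show ?thesis unfolding 1 2 by simp
  qed
  finally show ?thesis by (simp add: add_mono mult_left_mono)
qed

text \<open>Markov's inequality: the sum has mean at most \<open>18 * n\<close>, so it exceeds twice
  that with probability at most 1 / 2.\<close>

lemma good_event:
  assumes n: "0 < n"
  shows "1 / 2 \<le> measure M {\<omega> \<in> space M. (\<Sum>k<n. exp (cell_size (path01 \<omega>) n k)) \<le> 36 * real n}"
proof -
  note [measurable] = cell_size_measurable
  let ?S = "\<lambda>\<omega>. \<Sum>k<n. exp (cell_size (path01 \<omega>) n k)"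
  let ?B = "{\<omega> \<in> space M. 36 * real n < ?S \<omega>}"
  have "ennreal (36 * real n) * emeasure M ?B = (\<integral>\<^sup>+\<omega>. ennreal (36 * real n) * indicator ?B \<omega> \<partial>M)"
    by (simp add: nn_integral_cmult_indicator)
  also have "\<dots> \<le> (\<integral>\<^sup>+\<omega>. ennreal (?S \<omega>) \<partial>M)"
    by (intro nn_integral_mono) (auto split: split_indicator intro!: ennreal_leI)
  also have "\<dots> = (\<Sum>k<n. \<integral>\<^sup>+\<omega>. ennreal (exp (cell_size (path01 \<omega>) n k)) \<partial>M)"
    by (subst nn_integral_sum[symmetric]) (auto intro!: nn_integral_cong simp: sum_ennreal)
  also have "\<dots> \<le> (\<Sum>k<n. 18)" by (intro sum_mono nn_integral_exp_cell_size_le) auto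
  also have "\<dots> = ennreal (18 * real n)"
    by (simp add: ennreal_mult' ennreal_of_nat_eq_real_of_nat mult.commute)
  finally have "36 * real n * measure M ?B \<le> 18 * real n"
    by (simp add: emeasure_eq_measure ennreal_mult'[symmetric])
  then have "measure M ?B \<le> 1 / 2" using n by (simp add: field_simps)
  moreover have "measure M ?B = 1 - measure M {\<omega> \<in> space M. ?S \<omega> \<le> 36 * real n}"
  proof -
    have "?B = space M - {\<omega> \<in> space M. ?S \<omega> \<le> 36 * real n}" by auto
    then show ?thesis by (simp add: prob_compl)
  qed
  ultimately show ?thesis by simp
qed

text \<open>Two independent paths with the same code are close; by the Cauchy--Schwarz inequality this
  happens with probability at least the reciprocal of the number of codes.\<close>

lemma small_ball_grid:
  assumes p: "1 \<le> p" and m: "1 \<le> m" and n: "0 < n"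
  shows "1 / 4 / (2 ^ ((m + 1) * (m + 39)) * 3 ^ (m + 1)) ^ n \<le>
    measure M {\<omega> \<in> space M. int_norm p m (path01 \<omega>) \<le> (real (Suc m) + 2 * p) * 72 powr (1 / p) / (real n ^ m * sqrt (real n))}"
proof -
  define d where "d = (real (Suc m) + 2 * p) * 72 powr (1 / p) / (real n ^ m * sqrt (real n))"
  have d: "d > 0" using p n unfolding d_def by (intro divide_pos_pos mult_pos_pos) auto
  \<comment> \<open>On the good event each of the \<open>m + 1\<close> levels has codes of total
    size at most 36 n + (m + 3) n, by \<open>abs_code_le\<close> and x \<le> exp x.\<close>
  define L where "L = (m + 1) * (m + 39) * n"
  define I where "I = {..m} \<times> {..<n}"
  have I: "finite I" "card I = (m + 1) * n" by (simp_all add: I_def)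
  define Z where "Z = {z \<in> I \<rightarrow>\<^sub>E UNIV. (\<Sum>i\<in>I. nat \<bar>z i :: int\<bar>) \<le> L}"
  have Z: "finite Z" "real (card Z) \<le> 2 ^ L * 3 ^ card I"
    unfolding Z_def by (rule card_bounded_codes_le[OF I(1)])+
  define G where "G = {\<omega> \<in> space M. (\<Sum>k<n. exp (cell_size (path01 \<omega>) n k)) \<le> 36 * real n}"
  define A where "A z = {\<omega> \<in> G. \<forall>i\<in>I. code n (path01 \<omega>) i = z i}" for z
  note [measurable] = cell_size_measurable path01_measurable_at
  have [measurable]: "G \<in> sets M" unfolding G_def by measurable
  have [measurable]: "(\<lambda>\<omega>. state n j (path01 \<omega>) k) \<in> borel_measurable M" for j k
    unfolding state_def using iter_int_measurable[OF path01_measurable, of "\<lambda>_. real k / real n" M "\<lambda>\<omega>. \<omega>" j]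
    by (intro borel_measurable_times) auto
  have [measurable]: "(\<lambda>\<omega>. code n (path01 \<omega>) i) \<in> measurable M (count_space UNIV)" for i
    unfolding code_def case_prod_beta' by measurable
  have Am [measurable]: "A z \<in> sets M" for z
  proof -
    have "A z = G \<inter> {\<omega> \<in> space M. \<forall>i\<in>I. code n (path01 \<omega>) i = z i}" by (auto simp: A_def G_def)
    also have "\<dots> \<in> sets M" using I(1) by (intro sets.Int sets.sets_Collect_finite_All) measurable
    finally show ?thesis .
  qed
  have codeZ: "restrict (code n (path01 \<omega>)) I \<in> Z" if \<omega>: "\<omega> \<in> G" for \<omega>
  proof -
    have w: "bdd_borel (path01 \<omega>)" using \<omega> by (auto simp: G_def intro: bdd_borel_path01)
    have "real (\<Sum>i\<in>I. nat \<bar>code n (path01 \<omega>) i\<bar>) = (\<Sum>j\<le>m. \<Sum>k<n. \<bar>real_of_int (code n (path01 \<omega>) (j, k))\<bar>)"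
      by (simp add: I_def sum.cartesian_product)
    also have "\<dots> \<le> (\<Sum>j\<le>m. \<Sum>k<n. exp (cell_size (path01 \<omega>) n k) + (real m + 3))"
    proof (intro sum_mono)
      fix j k assume jk: "j \<in> {..m}" "k \<in> {..<n}"
      have "real j \<le> real m" using jk by simp
      moreover have "cell_size (path01 \<omega>) n k \<le> exp (cell_size (path01 \<omega>) n k)"
        using exp_ge_add_one_self[of "cell_size (path01 \<omega>) n k"] by linarith
      ultimately show "\<bar>real_of_int (code n (path01 \<omega>) (j, k))\<bar> \<le> exp (cell_size (path01 \<omega>) n k) + (real m + 3)"
        using abs_code_le[OF w, of k n j] jk by simp
    qed
    also have "\<dots> = (\<Sum>j\<le>m. (\<Sum>k<n. exp (cell_size (path01 \<omega>) n k)) + real n * (real m + 3))"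
      by (simp add: sum.distrib)
    also have "\<dots> \<le> (\<Sum>j\<le>m. 36 * real n + real n * (real m + 3))"
      using \<omega> by (intro sum_mono) (auto simp: G_def)
    also have "\<dots> = real L" by (simp add: L_def algebra_simps)
    finally have "(\<Sum>i\<in>I. nat \<bar>code n (path01 \<omega>) i\<bar>) \<le> L" by (simp only: of_nat_le_iff)
    then show ?thesis by (simp add: Z_def)
  qed
  have dis: "disjoint_family_on A Z"
  proof (unfold disjoint_family_on_def, intro ballI impI)
    fix y z assume yz: "y \<in> Z" "z \<in> Z" "y \<noteq> z"
    then have "\<exists>i\<in>I. y i \<noteq> z i" by (auto simp: Z_def dest: PiE_ext)
    then show "A y \<inter> A z = {}" by (auto simp: A_def)
  qed
  have UA: "(\<Union>z\<in>Z. A z) = G"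
  proof
    show "G \<subseteq> (\<Union>z\<in>Z. A z)"
    proof
      fix \<omega> assume "\<omega> \<in> G"
      then have "\<omega> \<in> A (restrict (code n (path01 \<omega>)) I)" by (auto simp: A_def)
      with codeZ[OF \<open>\<omega> \<in> G\<close>] show "\<omega> \<in> (\<Union>z\<in>Z. A z)" by blast
    qed
  qed (auto simp: A_def)
  have "measure M G = (\<Sum>z\<in>Z. measure M (A z))"
    unfolding UA[symmetric] using Z(1) dis by (intro finite_measure_finite_Union) auto
  then have half: "1 / 2 \<le> (\<Sum>z\<in>Z. measure M (A z))" using good_event[OF n] by (simp add: G_def)
  \<comment> \<open>The masses of the code classes sum to at least 1 / 2; by Cauchy-Schwarz against
    the constant 1 their squares sum to at least 1 / 4 divided by the number of codes.\<close>
  have "(1 / 2)\<^sup>2 \<le> (\<Sum>z\<in>Z. measure M (A z) * 1)\<^sup>2" using half by (intro power_mono) auto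
  also have "\<dots> \<le> (\<Sum>z\<in>Z. (measure M (A z))\<^sup>2) * (\<Sum>z\<in>Z. 1\<^sup>2)" by (rule Cauchy_Schwarz_ineq_sum)
  also have "\<dots> \<le> (\<Sum>z\<in>Z. (measure M (A z))\<^sup>2) * (2 ^ L * 3 ^ card I)"
    using Z(2) by (intro mult_left_mono sum_nonneg) auto
  finally have "1 / 4 / (2 ^ L * 3 ^ card I) \<le> (\<Sum>z\<in>Z. (measure M (A z))\<^sup>2)"
    by (simp add: field_simps power2_eq_square)
  also have "(2 :: real) ^ L * 3 ^ card I = (2 ^ ((m + 1) * (m + 39)) * 3 ^ (m + 1)) ^ n"
    unfolding L_def I(2) power_mult power_mult_distrib ..
  also have "(\<Sum>z\<in>Z. (measure M (A z))\<^sup>2) = (\<Sum>z\<in>Z. measure (M \<Otimes>\<^sub>M M) (A z \<times> A z))"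
  proof (intro sum.cong refl)
    fix z
    have "emeasure (M \<Otimes>\<^sub>M M) (A z \<times> A z) = emeasure M (A z) * emeasure M (A z)"
      by (rule emeasure_pair_measure_Times) measurable
    then show "(measure M (A z))\<^sup>2 = measure (M \<Otimes>\<^sub>M M) (A z \<times> A z)"
      by (simp add: emeasure_eq_measure pair.emeasure_eq_measure ennreal_mult[symmetric] power2_eq_square)
  qed
  also have "\<dots> = measure (M \<Otimes>\<^sub>M M) (\<Union>z\<in>Z. A z \<times> A z)"
    using Z(1) dis by (intro pair.finite_measure_finite_Union[symmetric]) (auto simp: disjoint_family_on_def)
  also have "\<dots> \<le> measure (M \<Otimes>\<^sub>M M) {z \<in> space (M \<Otimes>\<^sub>M M). int_norm p m (\<lambda>t. path01 (fst z) t - path01 (snd z) t) \<le> d}"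
  proof (rule pair.finite_measure_mono)
    show "{z \<in> space (M \<Otimes>\<^sub>M M). int_norm p m (\<lambda>t. path01 (fst z) t - path01 (snd z) t) \<le> d} \<in> sets (M \<Otimes>\<^sub>M M)"
    proof -
      have [measurable]: "(\<lambda>z. int_norm p m (\<lambda>t. path01 (fst z) t - path01 (snd z) t)) \<in> borel_measurable (M \<Otimes>\<^sub>M M)"
        using int_norm_pair_measurable[of p m 1 "-1"] by simp
      show ?thesis by measurable
    qed
    show "(\<Union>z\<in>Z. A z \<times> A z) \<subseteq> {z \<in> space (M \<Otimes>\<^sub>M M). int_norm p m (\<lambda>t. path01 (fst z) t - path01 (snd z) t) \<le> d}"
    proof (clarsimp simp: space_pair_measure)
      fix z \<omega> \<omega>' assume "\<omega> \<in> A z" "\<omega>' \<in> A z"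
      then have w: "\<omega> \<in> space M" "\<omega>' \<in> space M" "\<omega> \<in> G" "\<omega>' \<in> G"
        and eq: "\<And>i. i \<in> I \<Longrightarrow> code n (path01 \<omega>) i = code n (path01 \<omega>') i"
        by (auto simp: A_def G_def)
      have "int_norm p m (\<lambda>t. path01 \<omega> t - path01 \<omega>' t) \<le> d"
        unfolding d_def using w
        by (intro int_norm_diff_le p m n bdd_borel_path01 path01_0 eq) (auto simp: G_def I_def)
      with w show "\<omega> \<in> space M \<and> \<omega>' \<in> space M \<and> int_norm p m (\<lambda>t. path01 \<omega> t - path01 \<omega>' t) \<le> d" by simp
    qed
  qed
  also have "\<dots> \<le> measure M {\<omega> \<in> space M. int_norm p m (path01 \<omega>) \<le> d}"
    by (rule symmetrized_ball_le[OF p d])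
  finally show ?thesis unfolding d_def .
qed

end

text \<open>The number of cells is the least \<open>n\<close> for which the error K n^(-m - 1/2) of
  the grid is at most \<open>e\<close>, about (K / e)^\<beta>, and the probability in
  \<open>small_ball_grid\<close> is exponential in it. \<open>B\<close> is chosen before the
  probability space, so that the final constants depend on \<open>m\<close> and \<open>p\<close>
  alone.\<close>

lemma small_ball:
  fixes p :: real
  assumes p: "1 \<le> p" and m: "1 \<le> m"
  shows "\<exists>B>0. \<forall>(M :: 'a measure) W e. brownian M W \<longrightarrow> 0 < e \<longrightarrow> e \<le> 1 \<longrightarrow>
    exp (- (B * e powr (- (2 / (2 * real m + 1))))) \<le> measure M {\<omega> \<in> space M. int_norm p m (brownian.path01 W \<omega>) \<le> e}"
proof -
  define \<beta> where "\<beta> = 2 / (2 * real m + 1)"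
  define K where "K = (real (Suc m) + 2 * p) * 72 powr (1 / p)"
  define q :: real where "q = 2 ^ ((m + 1) * (m + 39)) * 3 ^ (m + 1)"
  \<comment> \<open>The summand 2 absorbs the factor 1 / 4 through exp (- 2), since e^(-\<beta>)
    \<ge> 1 for e \<le> 1. The factor 2 in the other summand comes from n \<le> 2 x, valid because x
    \<ge> 1.\<close>
  define B where "B = 2 + 2 * ln q * K powr \<beta>"
  have "1 * 1 \<le> K" unfolding K_def using p by (intro mult_mono ge_one_powr_ge_zero) auto
  then have K: "1 \<le> K" by simp
  have "1 * 1 \<le> q" unfolding q_def by (intro mult_mono one_le_power) auto
  then have q: "1 \<le> q" by simp
  have \<beta>: "\<beta> > 0" "\<beta> * (real m + 1 / 2) = 1" by (simp_all add: \<beta>_def field_simps)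
  have B: "B > 0" unfolding B_def using q by (intro add_pos_nonneg) auto
  show ?thesis
  proof (intro exI[of _ B] conjI allI impI B)
    fix M :: "'a measure" and W and e :: real assume "brownian M W" and e: "0 < e" "e \<le> 1"
    then interpret brownian M W by simp
    define x where "x = (K / e) powr \<beta>"
    define n where "n = nat \<lceil>x\<rceil>"
    have "1 \<le> K / e" using K e by simp
    then have x1: "1 \<le> x" unfolding x_def using \<beta> by (intro ge_one_powr_ge_zero) auto
    have nx: "x \<le> real n" "real n \<le> 2 * x" using x1 unfolding n_def by linarith+
    have n: "0 < n" using nx x1 by (auto intro: gr0I)
    have "K / e = x powr (real m + 1 / 2)"
      unfolding x_def powr_powr \<beta>(2) using K e by simp
    also have "\<dots> \<le> real n powr (real m + 1 / 2)" using nx x1 by (intro powr_mono2) auto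
    also have "\<dots> = real n ^ m * sqrt (real n)"
      using n by (simp add: powr_add powr_realpow powr_half_sqrt)
    finally have Kn: "K / (real n ^ m * sqrt (real n)) \<le> e" using e n by (simp add: field_simps)
    have "e powr \<beta> \<le> 1" using e \<beta> by (intro powr_le1) auto
    then have e1: "1 \<le> e powr (- \<beta>)" using e by (simp add: powr_minus_divide)
    have xe: "x = K powr \<beta> * e powr (- \<beta>)"
      unfolding x_def using K e by (simp add: powr_divide powr_minus_divide)
    have "exp (- (B * e powr (- \<beta>))) = exp (- (2 * e powr (- \<beta>)) - 2 * x * ln q)"
      unfolding B_def xe by (simp add: algebra_simps)
    also have "\<dots> \<le> exp (- 2 - real n * ln q)"
    proof -
      have "real n * ln q \<le> 2 * x * ln q" using nx q by (intro mult_right_mono) auto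
      then show ?thesis using e1 by simp
    qed
    also have "\<dots> = exp (- 2) / q ^ n"
      using q by (simp add: exp_diff exp_of_nat_mult)
    also have "\<dots> \<le> 1 / 4 / q ^ n"
    proof (rule divide_right_mono)
      have "2 \<le> exp (1::real)" using exp_ge_add_one_self[of 1] by simp
      then have "2 * 2 \<le> exp (1::real) * exp 1" by (intro mult_mono) auto
      then have "4 \<le> exp (2::real)" by (simp add: mult_exp_exp)
      then show "exp (- 2) \<le> (1 / 4 :: real)" by (simp add: exp_minus field_simps)
    qed (use q in auto)
    also have "\<dots> \<le> measure M {\<omega> \<in> space M. int_norm p m (path01 \<omega>) \<le> K / (real n ^ m * sqrt (real n))}"
      unfolding q_def K_def by (rule small_ball_grid[OF p m n])
    also have "\<dots> \<le> measure M {\<omega> \<in> space M. int_norm p m (path01 \<omega>) \<le> e}"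
      using Kn int_norm_path01_measurable[of p m] by (intro finite_measure_mono) auto
    finally show "exp (- (B * e powr (- (2 / (2 * real m + 1))))) \<le> measure M {\<omega> \<in> space M. int_norm p m (path01 \<omega>) \<le> e}"
      by (simp add: \<beta>_def)
  qed
qed

section \<open>Iteration of the recursion over geometric scales\<close>

theorem theorem1p3:
  fixes p :: real and m :: nat
  assumes "1 \<le> p" and "1 \<le> m"
  shows "\<exists>c1 c2. c1 > 0 \<and> c2 > 0 \<and>
           (\<forall>(M :: 'a measure) W. std_brownian_motion M W \<longrightarrow>
              (\<forall>r>0. measure M {\<omega> \<in> space M. Lp_norm01 p (\<lambda>t. X_proc m W t \<omega>) > r}
                     \<le> c1 * exp (- (r\<^sup>2 / (2 * A_norm m p)) + c2 * r powr (2 / (2 * real m + 3)))))"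
proof (cases "A_norm m p = 0")
  case True
  \<comment> \<open>Division by 0 yields 0, so the Gaussian term vanishes and the trivial bound by 1
    is enough.\<close>
  show ?thesis
  proof (intro exI[of _ 1] conjI allI impI)
    fix M :: "'a measure" and W and r :: real assume "std_brownian_motion M W"
    then interpret brownian M W by unfold_locales
    have "measure M {\<omega> \<in> space M. Lp_norm01 p (\<lambda>t. X_proc m W t \<omega>) > r} \<le> 1" by simp
    also have "1 \<le> exp (r powr (2 / (2 * real m + 3)))" by simp
    finally show "measure M {\<omega> \<in> space M. Lp_norm01 p (\<lambda>t. X_proc m W t \<omega>) > r} \<le>
        1 * exp (- (r\<^sup>2 / (2 * A_norm m p)) + 1 * r powr (2 / (2 * real m + 3)))"
      by (simp add: True)
  qed auto
next
  case False
  define A where "A = A_norm m p"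
  have A: "A > 0" using False A_norm_nonneg[OF assms(1), of m] by (simp add: A_def)
  obtain B where B: "B > 0" and ball: "\<forall>(M :: 'a measure) W e. brownian M W \<longrightarrow> 0 < e \<longrightarrow> e \<le> 1 \<longrightarrow>
    exp (- (B * e powr (- (2 / (2 * real m + 1))))) \<le> measure M {\<omega> \<in> space M. int_norm p m (brownian.path01 W \<omega>) \<le> e}"
    using small_ball[OF assms, where 'a = 'a] by (elim exE conjE) (rule that)
  define \<alpha> where "\<alpha> = 2 / (2 * real m + 3)"
  have \<alpha>: "0 < \<alpha>" "\<alpha> < 1" by (simp_all add: \<alpha>_def field_simps)
  \<comment> \<open>For e = r^(\<alpha> - 1) this says that r e and e^(-2 / (2 m + 1)) are the same
    power of \<open>r\<close>; it is the equation that determines \<alpha>.\<close>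
  have \<alpha>': "(1 - \<alpha>) * (2 / (2 * real m + 1)) = \<alpha>"
  proof -
    have "1 - \<alpha> = (2 * real m + 1) / (2 * real m + 3)" by (simp add: \<alpha>_def field_simps)
    moreover have "x / y * (2 / x) = 2 / y" if "x > 0" for x y :: real using that by simp
    then have "(2 * real m + 1) / (2 * real m + 3) * (2 / (2 * real m + 1)) = \<alpha>"
      unfolding \<alpha>_def by (metis add_nonneg_pos mult_nonneg_nonneg of_nat_0_le_iff zero_le_numeral zero_less_one)
    ultimately show ?thesis by (simp only:)
  qed
  have c\<alpha>: "(3 / 5) powr \<alpha> < 1" using powr_less_mono2[OF \<alpha>(1), of "3 / 5" 1] by simp
  \<comment> \<open>The fixed point of D = 6 / A + B + (3/5)^\<alpha> D: the errors made at the
    scales (3/5)^k r form a geometric series.\<close>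
  define D where "D = (6 / A + B) / (1 - (3 / 5) powr \<alpha>)"
  have D: "D > 0" unfolding D_def using A B c\<alpha> by (intro divide_pos_pos add_pos_pos) auto
  have "D * (1 - (3 / 5) powr \<alpha>) = 6 / A + B" unfolding D_def using c\<alpha> \<alpha>(1) by simp
  then have Deq: "6 / A + D * (3 / 5) powr \<alpha> + B = D" unfolding right_diff_distrib by linarith
  show ?thesis
  proof (rule exI[of _ "exp (50 / A)"], rule exI[of _ D], intro conjI allI impI)
    fix M :: "'a measure" and W and r :: real assume bmW: "std_brownian_motion M W" and r: "r > 0"
    then interpret brownian M W by unfold_locales
    define F where "F r = measure M {\<omega> \<in> space M. int_norm p m (path01 \<omega>) > r}" for r
    \<comment> \<open>A step maps \<open>r\<close> to at most 3/5 r, hence the ratio 5/3 between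
      scales. Up to 10 the factor exp (50 / A) makes the bound trivial, as r^2 / (2 A) \<le> 50 / A;
      above 10 the radius e \<le> 1 satisfies 10 e \<le> r, as \<open>tail_recursion\<close>
      demands.\<close>
    have main: "F r \<le> exp (50 / A) * exp (- (r\<^sup>2 / (2 * A)) + D * r powr \<alpha>)"
      if "0 < r" "r \<le> 10 * (5 / 3) ^ k" for r k
      using that
    proof (induction k arbitrary: r)
      case 0
      have "r\<^sup>2 \<le> 10\<^sup>2" using 0 by (intro power_mono) auto
      then have "r\<^sup>2 / (2 * A) \<le> 100 / (2 * A)" using A by (intro divide_right_mono) auto
      moreover have "0 \<le> D * r powr \<alpha>" using D by simp
      ultimately have "0 \<le> 50 / A + (- (r\<^sup>2 / (2 * A)) + D * r powr \<alpha>)" by simp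
      then have "1 \<le> exp (50 / A) * exp (- (r\<^sup>2 / (2 * A)) + D * r powr \<alpha>)"
        by (simp add: mult_exp_exp)
      then show ?case unfolding F_def by (meson order_trans prob_le_1)
    next
      case (Suc k)
      show ?case
      proof (cases "r \<le> 10 * (5 / 3) ^ k")
        case True
        then show ?thesis using Suc by blast
      next
        case False
        then have r10: "10 < r" using one_le_power[of "5 / 3 :: real" k] by linarith
        define e where "e = r powr (\<alpha> - 1)"
        have e: "0 < e" "e \<le> 1" using r10 \<alpha> powr_mono[of "\<alpha> - 1" 0 r] by (auto simp: e_def)
        have re: "r * e = r powr \<alpha>" using r10 by (simp add: e_def powr_diff)
        have ee: "e powr (- (2 / (2 * real m + 1))) = r powr \<alpha>"
        proof -
          have "(\<alpha> - 1) * (- (2 / (2 * real m + 1))) = \<alpha>"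
            using \<alpha>' minus_mult_minus[of "1 - \<alpha>" "2 / (2 * real m + 1)"] by (simp only: minus_diff_eq)
          then show ?thesis unfolding e_def powr_powr by simp
        qed
        define r' where "r' = 3/5 * r - 2 * e"
        have r': "0 < r'" "r' \<le> 3/5 * r" using e r10 unfolding r'_def by linarith+
        have "r' \<le> 10 * (5 / 3) ^ k" using r'(2) Suc.prems(2) by simp
        from Suc.IH[OF r'(1) this] have IH: "F r' \<le> exp (50 / A) * exp (- (r'\<^sup>2 / (2 * A)) + D * r' powr \<alpha>)" .
        have "r' powr \<alpha> \<le> (3/5 * r) powr \<alpha>" using \<alpha> r' by (intro powr_mono2) auto
        also have "\<dots> = (3/5) powr \<alpha> * r powr \<alpha>" using r10 by (subst powr_mult) auto
        finally have r'\<alpha>: "r' powr \<alpha> \<le> (3/5) powr \<alpha> * r powr \<alpha>" .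
        have "F r * exp (- (B * r powr \<alpha>)) \<le> F r * measure M {\<omega> \<in> space M. int_norm p m (path01 \<omega>) \<le> e}"
          using ball[rule_format, OF brownian_axioms e] unfolding ee by (intro mult_left_mono) (auto simp: F_def)
        also have "\<dots> \<le> F r' * exp (- ((4/5 * r - 6 * e)\<^sup>2 / (2 * A)))"
          unfolding F_def r'_def A_def
          using assms A e r10 by (intro tail_recursion) (auto simp: A_def)
        also have "\<dots> \<le> exp (50 / A) * exp (- (r'\<^sup>2 / (2 * A)) + D * r' powr \<alpha>) * exp (- ((4/5 * r - 6 * e)\<^sup>2 / (2 * A)))"
          using IH by (intro mult_right_mono) auto
        finally have "F r \<le> exp (50 / A) * exp (- (r'\<^sup>2 / (2 * A)) + D * r' powr \<alpha>) * exp (- ((4/5 * r - 6 * e)\<^sup>2 / (2 * A))) * exp (B * r powr \<alpha>)"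
          by (simp add: exp_minus field_simps)
        also have "\<dots> = exp (50 / A) * exp (- ((r'\<^sup>2 + (4/5 * r - 6 * e)\<^sup>2) / (2 * A)) + D * r' powr \<alpha> + B * r powr \<alpha>)"
          by (simp add: mult_exp_exp add_divide_distrib)
        \<comment> \<open>Since (3/5)^2 + (4/5)^2 = 1, the leading squares recombine to r^2 without
          loss. The cross terms amount to 2 (3/5 * 2 + 4/5 * 6) r e = 12 r e, which after division
          by 2 A is the 6 / A in \<open>D\<close>.\<close>
        also have "\<dots> \<le> exp (50 / A) * exp (- (r\<^sup>2 / (2 * A)) + D * r powr \<alpha>)"
        proof -
          have "r\<^sup>2 - 12 * (r * e) \<le> r'\<^sup>2 + (4/5 * r - 6 * e)\<^sup>2"
          proof -
            have "r'\<^sup>2 + (4/5 * r - 6 * e)\<^sup>2 = r\<^sup>2 - 12 * (r * e) + 40 * e\<^sup>2"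
              by (simp add: r'_def power2_eq_square algebra_simps)
            then show ?thesis by simp
          qed
          then have "(r\<^sup>2 - 12 * (r * e)) / (2 * A) \<le> (r'\<^sup>2 + (4/5 * r - 6 * e)\<^sup>2) / (2 * A)"
            using A by (intro divide_right_mono) auto
          moreover have "(r\<^sup>2 - 12 * (r * e)) / (2 * A) = r\<^sup>2 / (2 * A) - 6 / A * r powr \<alpha>"
            unfolding re by (simp add: diff_divide_distrib)
          moreover have "D * r' powr \<alpha> \<le> D * ((3/5) powr \<alpha> * r powr \<alpha>)"
            using r'\<alpha> D by (intro mult_left_mono) auto
          moreover have "6 / A * r powr \<alpha> + D * ((3/5) powr \<alpha> * r powr \<alpha>) + B * r powr \<alpha> = D * r powr \<alpha>"
            using arg_cong[OF Deq, of "\<lambda>x. x * r powr \<alpha>"] by (simp only: distrib_right mult.assoc)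
          ultimately have "- ((r'\<^sup>2 + (4/5 * r - 6 * e)\<^sup>2) / (2 * A)) + D * r' powr \<alpha> + B * r powr \<alpha>
            \<le> - (r\<^sup>2 / (2 * A)) + D * r powr \<alpha>"
            by linarith
          then show ?thesis by (intro mult_left_mono) auto
        qed
        finally show ?thesis .
      qed
    qed
    obtain k where "r / 10 < (5 / 3) ^ k" using real_arch_pow[of "5 / 3" "r / 10"] by auto
    then have "F r \<le> exp (50 / A) * exp (- (r\<^sup>2 / (2 * A)) + D * r powr \<alpha>)"
      using r by (intro main[of r k]) auto
    also have "F r = measure M {\<omega> \<in> space M. Lp_norm01 p (\<lambda>t. X_proc m W t \<omega>) > r}"
      unfolding F_def by (rule arg_cong[where f = "measure M"]) (auto simp: Lp_norm01_X_proc[OF assms(2)])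
    finally show "measure M {\<omega> \<in> space M. Lp_norm01 p (\<lambda>t. X_proc m W t \<omega>) > r} \<le>
        exp (50 / A) * exp (- (r\<^sup>2 / (2 * A_norm m p)) + D * r powr (2 / (2 * real m + 3)))"
      by (simp add: A_def \<alpha>_def)
  qed (use D in auto)
qed

end
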